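(* Let $h\in C^2((0,\infty))$ with $h''>0$, let $M:(0,\infty)\to[0,\infty)$ be $C^1$, let $r:(0,\infty)\to\mathbb R$ be a source function, and let $b\in C^1(\overline\Omega;\mathbb R^d)$ satisfy $\operatorname{div}b=0$. Assume $u:\Omega\times(0,T)\to(0,\infty)$ is a smooth positive solution of $$\partial_tu+\operatorname{div}\bigl(ub-M(u)\nabla\mu\bigr)=r(u),\qquad \mu=h'(u).$$ Then $$\frac{d}{dt}\mathcal F_{\mathrm{dd}}[u(t)]=-\int_\Omega M(u)|\nabla\mu|^2\,dx+\mathcal B_{\mathrm{dd}}[u(t)]+\int_\Omega\mu\,r(u)\,dx,$$ where $\mathcal F_{\mathrm{dd}}[u]=\int_\Omega h(u)\,dx$ and $$\mathcal B_{\mathrm{dd}}[u]=-\int_{\partial\Omega}\bigl(h(u)b-\mu M(u)\nabla\mu\bigr)\cdot n\,dS.$$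
   Context: $\Omega\subset\mathbb R^d$ is a bounded Lipschitz domain with outward unit normal $n$. "Smooth solution" means sufficiently regular in space and time for all terms in the equation and in the balance (including boundary integrals) to be meaningful, satisfying the equation almost everywhere. *)

theory Defs
  imports "HOL-Analysis.Analysis"
begin

section \<open>Differential operators and regularity up to the boundary\<close>

definition grad :: "('a::euclidean_space \<Rightarrow> real) \<Rightarrow> 'a \<Rightarrow> 'a" where
  "grad f x = (THE D. GDERIV f x :> D)"

definition divergence :: "('a::euclidean_space \<Rightarrow> 'a) \<Rightarrow> 'a \<Rightarrow> real" where
  "divergence F x = (\<Sum>i\<in>Basis. frechet_derivative F (at x) i \<bullet> i)"

text \<open>The class \<open>C\<^sup>1\<close> on the closure of an open set: \<open>f\<close> is continuous on the closure and its
  derivative, taken in the open set, extends continuously to the closure.\<close>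

definition C1_closure :: "'a::euclidean_space set \<Rightarrow> ('a \<Rightarrow> 'b::euclidean_space) \<Rightarrow> bool" where
  "C1_closure \<Omega> f \<longleftrightarrow> continuous_on (closure \<Omega>) f \<and>
     (\<exists>f' :: 'a \<Rightarrow> 'a \<Rightarrow>\<^sub>L 'b. (\<forall>x\<in>\<Omega>. (f has_derivative f' x) (at x)) \<and>
        continuous_on (closure \<Omega>) f')"

text \<open>The gradient in \<open>\<Omega>\<close> together with its boundary values, which are limits from inside \<open>\<Omega>\<close>.\<close>

definition closure_grad :: "'a::euclidean_space set \<Rightarrow> ('a \<Rightarrow> real) \<Rightarrow> 'a \<Rightarrow> 'a" where
  "closure_grad \<Omega> f x = (if x \<in> \<Omega> then grad f x else Lim (at x within \<Omega>) (grad f))"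

section \<open>Lipschitz domains, outward normal, surface integral\<close>

text \<open>A chart of \<open>\<Omega>\<close> over an open set \<open>U\<close>: in \<open>U\<close>, the set \<open>\<Omega>\<close> is the region below the graph, in
  direction \<open>e\<close>, of a Lipschitz function \<open>\<gamma>\<close> on the hyperplane orthogonal to \<open>e\<close>.  Functions on
  this hyperplane are encoded as functions on the whole space that are constant along \<open>e\<close>; the
  gradient of the encoding is then the tangential gradient.  Since \<open>U\<close> is open, the boundary of
  \<open>\<Omega>\<close> in \<open>U\<close> is automatically the graph of \<open>\<gamma>\<close>.\<close>

definition lipschitz_chart ::
    "'a::euclidean_space set \<Rightarrow> 'a \<Rightarrow> ('a \<Rightarrow> real) \<Rightarrow> 'a set \<Rightarrow> bool" where
  "lipschitz_chart \<Omega> e \<gamma> U \<longleftrightarrow> norm e = 1 \<and> open U \<and>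
     (\<exists>L. L-lipschitz_on UNIV \<gamma>) \<and> (\<forall>x s. \<gamma> (x + s *\<^sub>R e) = \<gamma> x) \<and>
     \<Omega> \<inter> U = {x \<in> U. x \<bullet> e < \<gamma> x}"

definition bounded_lipschitz_domain :: "'a::euclidean_space set \<Rightarrow> bool" where
  "bounded_lipschitz_domain \<Omega> \<longleftrightarrow> open \<Omega> \<and> connected \<Omega> \<and> \<Omega> \<noteq> {} \<and> bounded \<Omega> \<and>
     (\<forall>x\<in>frontier \<Omega>. \<exists>e \<gamma> U. x \<in> U \<and> lipschitz_chart \<Omega> e \<gamma> U)"

text \<open>\<open>\<nu>\<close> is the outward unit normal at \<open>x\<close> if, to first order at \<open>x\<close>, the set \<open>\<Omega>\<close> is the half-space
  \<open>{y. (y - x) \<bullet> \<nu> < 0}\<close>.  Such a \<open>\<nu>\<close> is unique; at a boundary point over which the function \<open>\<gamma>\<close> of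
  a chart is differentiable it is \<open>(e - grad \<gamma>) / sqrt (1 + |grad \<gamma>|\<^sup>2)\<close>.\<close>

definition is_outward_normal :: "'a::euclidean_space set \<Rightarrow> 'a \<Rightarrow> 'a \<Rightarrow> bool" where
  "is_outward_normal \<Omega> x \<nu> \<longleftrightarrow> norm \<nu> = 1 \<and>
     (\<forall>\<epsilon>>0. \<exists>\<delta>>0. \<forall>y\<in>ball x \<delta>.
        ((y - x) \<bullet> \<nu> > \<epsilon> * norm (y - x) \<longrightarrow> y \<notin> \<Omega>) \<and>
        ((y - x) \<bullet> \<nu> < - (\<epsilon> * norm (y - x)) \<longrightarrow> y \<in> \<Omega>))"

definition outward_normal :: "'a::euclidean_space set \<Rightarrow> 'a \<Rightarrow> 'a" where
  "outward_normal \<Omega> x = (THE \<nu>. is_outward_normal \<Omega> x \<nu>)"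

text \<open>The surface integral over the graph of \<open>\<gamma>\<close> is the integral of \<open>g (y + \<gamma> y e) sqrt (1 + |grad \<gamma>|\<^sup>2)\<close>
  over the hyperplane orthogonal to \<open>e\<close>.  To avoid a separate type for that hyperplane, the
  integrand is extended constantly along \<open>e\<close> and integrated over the slab of height one, which by
  Fubini has the same value.  The point \<open>x + (\<gamma> x - x \<bullet> e) e\<close> is the point of the graph on the line
  through \<open>x\<close> in direction \<open>e\<close>.\<close>

definition graph_integrand :: "'a::euclidean_space \<Rightarrow> ('a \<Rightarrow> real) \<Rightarrow> ('a \<Rightarrow> real) \<Rightarrow> 'a \<Rightarrow> real" where
  "graph_integrand e \<gamma> g x = g (x + (\<gamma> x - x \<bullet> e) *\<^sub>R e) * sqrt (1 + (norm (grad \<gamma> x))\<^sup>2)"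

definition slab :: "'a::euclidean_space \<Rightarrow> 'a set" where
  "slab e = {x. 0 \<le> x \<bullet> e \<and> x \<bullet> e \<le> 1}"

text \<open>A finite family of charts with a subordinate partition of unity of class \<open>C\<^sup>1\<close> with compact
  supports, along the boundary of \<open>\<Omega>\<close>.\<close>

definition boundary_partition ::
    "'a::euclidean_space set \<Rightarrow> nat \<Rightarrow> (nat \<Rightarrow> 'a) \<Rightarrow> (nat \<Rightarrow> 'a \<Rightarrow> real) \<Rightarrow> (nat \<Rightarrow> 'a set) \<Rightarrow>
      (nat \<Rightarrow> 'a \<Rightarrow> real) \<Rightarrow> bool" where
  "boundary_partition \<Omega> N e \<gamma> U \<psi> \<longleftrightarrow>
     (\<forall>i<N. lipschitz_chart \<Omega> (e i) (\<gamma> i) (U i) \<and> C1_closure UNIV (\<psi> i) \<and> (\<forall>x. 0 \<le> \<psi> i x) \<and>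
        compact (closure {x. \<psi> i x \<noteq> 0}) \<and> closure {x. \<psi> i x \<noteq> 0} \<subseteq> U i) \<and>
     (\<forall>x\<in>frontier \<Omega>. (\<Sum>i<N. \<psi> i x) = 1)"

text \<open>The usual partition-of-unity formula for the surface integral; independence of the choice
  of charts and partition is part of the requirement.\<close>

definition has_surface_integral ::
    "('a::euclidean_space \<Rightarrow> real) \<Rightarrow> real \<Rightarrow> 'a set \<Rightarrow> bool" where
  "has_surface_integral f I \<Omega> \<longleftrightarrow>
     (\<forall>N e \<gamma> U \<psi>. boundary_partition \<Omega> N e \<gamma> U \<psi> \<longrightarrow>
        (\<forall>i<N. set_integrable lebesgue (slab (e i))
                  (graph_integrand (e i) (\<gamma> i) (\<lambda>x. \<psi> i x * f x))) \<and>
        (\<Sum>i<N. set_lebesgue_integral lebesgue (slab (e i))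
                  (graph_integrand (e i) (\<gamma> i) (\<lambda>x. \<psi> i x * f x))) = I)"

definition surface_integral :: "'a::euclidean_space set \<Rightarrow> ('a \<Rightarrow> real) \<Rightarrow> real" where
  "surface_integral \<Omega> f = (THE I. has_surface_integral f I \<Omega>)"

section \<open>The equation and the functionals\<close>

text \<open>Throughout, \<open>h'\<close> stands for the derivative of \<open>h\<close>, so that \<open>\<mu> = h' (w x)\<close> for a state \<open>w\<close>.\<close>

definition flux ::
    "'a::euclidean_space set \<Rightarrow> ('a \<Rightarrow> 'a) \<Rightarrow> (real \<Rightarrow> real) \<Rightarrow> (real \<Rightarrow> real) \<Rightarrow>
      ('a \<Rightarrow> real) \<Rightarrow> 'a \<Rightarrow> 'a" where
  "flux \<Omega> b M h' w x = w x *\<^sub>R b x - M (w x) *\<^sub>R closure_grad \<Omega> (\<lambda>y. h' (w y)) x"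

definition equation_at ::
    "'a::euclidean_space set \<Rightarrow> ('a \<Rightarrow> 'a) \<Rightarrow> (real \<Rightarrow> real) \<Rightarrow> (real \<Rightarrow> real) \<Rightarrow> (real \<Rightarrow> real) \<Rightarrow>
      (real \<Rightarrow> 'a \<Rightarrow> real) \<Rightarrow> real \<Rightarrow> 'a \<Rightarrow> bool" where
  "equation_at \<Omega> b M h' r u t x \<longleftrightarrow>
     deriv (\<lambda>s. u s x) t + divergence (flux \<Omega> b M h' (u t)) x = r (u t x)"

text \<open>A smooth positive solution: \<open>u\<close> and its time derivative are continuous up to the spatial
  boundary; \<open>u\<close> and the flux are, at each time, of class \<open>C\<^sup>1\<close> up to the boundary (second
  derivatives of \<open>\<mu>\<close> enter only through the flux); \<open>u\<close> is positive up to the boundary, so that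
  \<open>h (u)\<close>, \<open>\<mu>\<close> and \<open>M (u)\<close> make sense there; and the equation holds almost everywhere in space-time.\<close>

definition smooth_positive_solution ::
    "'a::euclidean_space set \<Rightarrow> real \<Rightarrow> ('a \<Rightarrow> 'a) \<Rightarrow> (real \<Rightarrow> real) \<Rightarrow> (real \<Rightarrow> real) \<Rightarrow>
      (real \<Rightarrow> real) \<Rightarrow> (real \<Rightarrow> 'a \<Rightarrow> real) \<Rightarrow> bool" where
  "smooth_positive_solution \<Omega> T b M h' r u \<longleftrightarrow>
     (\<forall>t\<in>{0<..<T}. \<forall>x\<in>closure \<Omega>. 0 < u t x) \<and>
     continuous_on ({0<..<T} \<times> closure \<Omega>) (\<lambda>(t, x). u t x) \<and>
     (\<exists>v. continuous_on ({0<..<T} \<times> closure \<Omega>) (\<lambda>(t, x). v t x) \<and>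
        (\<forall>t\<in>{0<..<T}. \<forall>x\<in>\<Omega>. ((\<lambda>s. u s x) has_real_derivative v t x) (at t))) \<and>
     (\<forall>t\<in>{0<..<T}. C1_closure \<Omega> (u t) \<and> C1_closure \<Omega> (flux \<Omega> b M h' (u t))) \<and>
     (AE p in lebesgue. p \<in> {0<..<T} \<times> \<Omega> \<longrightarrow> equation_at \<Omega> b M h' r u (fst p) (snd p))"

definition energy :: "'a::euclidean_space set \<Rightarrow> (real \<Rightarrow> real) \<Rightarrow> ('a \<Rightarrow> real) \<Rightarrow> real" where
  "energy \<Omega> h w = set_lebesgue_integral lebesgue \<Omega> (\<lambda>x. h (w x))"

definition boundary_term ::
    "'a::euclidean_space set \<Rightarrow> ('a \<Rightarrow> 'a) \<Rightarrow> (real \<Rightarrow> real) \<Rightarrow> (real \<Rightarrow> real) \<Rightarrow> (real \<Rightarrow> real) \<Rightarrow>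
      ('a \<Rightarrow> real) \<Rightarrow> real" where
  "boundary_term \<Omega> b M h h' w = - surface_integral \<Omega> (\<lambda>x.
     (h (w x) *\<^sub>R b x - (h' (w x) * M (w x)) *\<^sub>R closure_grad \<Omega> (\<lambda>y. h' (w y)) x)
       \<bullet> outward_normal \<Omega> x)"

definition energy_balance_at ::
    "'a::euclidean_space set \<Rightarrow> ('a \<Rightarrow> 'a) \<Rightarrow> (real \<Rightarrow> real) \<Rightarrow> (real \<Rightarrow> real) \<Rightarrow> (real \<Rightarrow> real) \<Rightarrow>
      (real \<Rightarrow> real) \<Rightarrow> (real \<Rightarrow> 'a \<Rightarrow> real) \<Rightarrow> real \<Rightarrow> bool" where
  "energy_balance_at \<Omega> b M h h' r u t \<longleftrightarrow>
     ((\<lambda>s. energy \<Omega> h (u s)) has_real_derivative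
        - set_lebesgue_integral lebesgue \<Omega>
            (\<lambda>x. M (u t x) * (norm (grad (\<lambda>y. h' (u t y)) x))\<^sup>2)
        + boundary_term \<Omega> b M h h' (u t)
        + set_lebesgue_integral lebesgue \<Omega> (\<lambda>x. h' (u t x) * r (u t x))) (at t)"

end

theory Submission
  imports Defs
begin

text \<open>
  The identity is the equation tested with \<open>\<mu>\<close>.  Put
  \<open>G = h(u) b - \<mu> M(u) \<nabla>\<mu>\<close> and let \<open>J = u b - M(u) \<nabla>\<mu>\<close> be the flux.  Then
  \<open>G = (h(u) - \<mu> u) b + \<mu> J\<close>, and because the derivative of \<open>h(s) - h'(s) s\<close> is \<open>- s h''(s)\<close> and
  \<open>b\<close> is divergence free, \<open>div G = \<mu> div J - M(u) |\<nabla>\<mu>|\<^sup>2\<close>.  Differentiation under the integral gives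
  \<open>d/dt \<integral> h(u) = \<integral> \<mu> \<partial>\<^sub>t u = \<integral> \<mu> (r(u) - div J)\<close>, and integrating \<open>div G\<close> produces the boundary term.
  The second form of \<open>G\<close> matters: it shows that \<open>G\<close> is \<open>C\<^sup>1\<close> up to the boundary although \<open>\<nabla>\<mu>\<close> alone
  need not be.

  The substance of the proof is therefore the divergence theorem on a bounded Lipschitz domain, with
  the outward normal and the surface integral defined through charts (\<open>divergence_theorem\<close>).  It has
  two ingredients.

  The normal is computed from a chart at the points where the function \<open>\<gamma>\<close> of the chart is
  differentiable; that this is almost everywhere is Rademacher's theorem (\<open>rademacher\<close>).  On each
  line a Dini derivative argument gives right derivatives almost everywhere; they are additive in the direction because translating a compact set by a small
  vector changes little of it; and a countable dense set of directions suffices for a Lipschitz function.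

  All integrations by parts come from one principle.  For Lipschitz \<open>F\<close> the integral of a directional
  derivative over an open set \<open>A\<close> is the limit of the integrals of difference quotients, and by translation
  invariance these only see \<open>F\<close> between \<open>A\<close> and its translate.  If \<open>F\<close> vanishes on the boundary of \<open>A\<close>, nothing
  remains in the limit (\<open>integral_derivative_vanishing_on_frontier\<close>).  If \<open>A\<close> is the region
  below a graph, the layer between \<open>A\<close> and its translate has thickness proportional to
  \<open>v \<bullet> (e - \<nabla>\<gamma>)\<close>, which is the normal component of \<open>v\<close> times the surface element
  (\<open>divergence_theorem_below_graph\<close>).  A partition of unity along the boundary combines the two.
\<close>

section \<open>Right derivatives of Lipschitz functions on the line\<close>

text \<open>The set of points where \<open>k\<close> is at least \<open>k a\<close> is compact, and its largest element cannot lie before \<open>b\<close>.\<close>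

lemma dini_positive_imp_le:
  fixes k :: "real \<Rightarrow> real"
  assumes "continuous_on {a..b} k" "a \<le> b"
    and ex: "\<And>x. a \<le> x \<Longrightarrow> x < b \<Longrightarrow> \<exists>y. x < y \<and> y \<le> b \<and> k x \<le> k y"
  shows "k a \<le> k b"
proof -
  define S where "S = {x \<in> {a..b}. k a \<le> k x}"
  have "closed S"
    unfolding S_def
    using continuous_closed_preimage[OF assms(1), of "{k a..}"]
    by (simp add: vimage_def Int_def conj_commute)
  then have "compact S"
    by (auto simp: compact_eq_bounded_closed S_def intro: bounded_subset[OF bounded_closed_interval[of a b]])
  moreover have "a \<in> S" using assms(2) by (auto simp: S_def)
  ultimately obtain x where x: "x \<in> S" "\<And>y. y \<in> S \<Longrightarrow> y \<le> x"
    using compact_attains_sup[of S] by blast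
  have "x = b"
  proof (rule ccontr)
    assume "x \<noteq> b"
    then have "a \<le> x" "x < b" using x by (auto simp: S_def)
    from ex[OF this] obtain y where y: "x < y" "y \<le> b" "k x \<le> k y" by blast
    then have "y \<in> S" using x(1) by (auto simp: S_def)
    with x(2) y(1) show False by force
  qed
  then show ?thesis using x(1) by (simp add: S_def)
qed

text \<open>A set where the upper right Dini derivative exceeds \<open>c\<close> forces growth at least \<open>c\<close> times its measure.
  To see this, subtract \<open>c\<close> times the measure of \<open>K\<close> up to \<open>x\<close>: on \<open>K\<close> that term grows at most at rate \<open>c\<close>, and
  off the closed set \<open>K\<close> it is locally constant, so in both cases the difference, tilted by a
  small positive slope, can be increased by moving to the right.\<close>

lemma dini_lower_bound:
  fixes g :: "real \<Rightarrow> real"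
  assumes cont: "continuous_on UNIV g" and mono: "mono g" and "0 \<le> c" "closed K" "a \<le> b"
    and K: "\<And>x m. x \<in> K \<Longrightarrow> 0 < m \<Longrightarrow> \<exists>s. 0 < s \<and> s < m \<and> c * s < g (x + s) - g x"
  shows "c * measure lebesgue (K \<inter> {a..b}) \<le> g b - g a"
proof -
  define \<kappa> where "\<kappa> x = measure lebesgue (K \<inter> {a..x})" for x
  have meas: "K \<inter> {x..y} \<in> lmeasurable" for x y
    using \<open>closed K\<close> by (metis compact_Icc closed_Int_compact lmeasurable_compact)
  have step: "\<kappa> y \<le> \<kappa> x + measure lebesgue (K \<inter> {x..y})" if "a \<le> x" "x \<le> y" for x y
  proof -
    have "K \<inter> {a..y} = (K \<inter> {a..x}) \<union> (K \<inter> {x..y})" using that by auto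
    then show ?thesis unfolding \<kappa>_def
      using measure_Un_le[of "K \<inter> {a..x}" lebesgue "K \<inter> {x..y}"] meas by (simp add: fmeasurableD)
  qed
  have mon: "\<kappa> x \<le> \<kappa> y" if "x \<le> y" for x y
    unfolding \<kappa>_def by (rule measure_mono_fmeasurable) (use that meas in \<open>auto simp: fmeasurableD\<close>)
  have lip: "measure lebesgue (K \<inter> {x..y}) \<le> y - x" if "x \<le> y" for x y
  proof -
    have "measure lebesgue (K \<inter> {x..y}) \<le> measure lebesgue {x..y}"
      by (rule measure_mono_fmeasurable) (use meas in \<open>auto simp: fmeasurableD\<close>)
    then show ?thesis using that by simp
  qed
  have \<kappa>lip: "1-lipschitz_on {a..b} \<kappa>"
  proof (rule lipschitz_onI)
    fix x y assume xy: "x \<in> {a..b}" "y \<in> {a..b}"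
    show "dist (\<kappa> x) (\<kappa> y) \<le> 1 * dist x y"
      using step[of x y] step[of y x] mon[of x y] mon[of y x] lip[of x y] lip[of y x] xy
      by (cases "x \<le> y") (auto simp: dist_real_def)
  qed simp
  have pre: "g a - c * \<kappa> a + e * a \<le> g b - c * \<kappa> b + e * b" if "e > 0" for e
  proof (rule dini_positive_imp_le[where k = "\<lambda>x. g x - c * \<kappa> x + e * x"])
    show "continuous_on {a..b} (\<lambda>x. g x - c * \<kappa> x + e * x)"
      using lipschitz_on_continuous_on[OF \<kappa>lip] continuous_on_subset[OF cont]
      by (intro continuous_intros) auto
    fix x assume x: "a \<le> x" "x < b"
    show "\<exists>y. x < y \<and> y \<le> b \<and> g x - c * \<kappa> x + e * x \<le> g y - c * \<kappa> y + e * y"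
    proof (cases "x \<in> K")
      case True
      from K[OF True, of "b - x"] x obtain s where s: "0 < s" "s < b - x" "c * s < g (x + s) - g x"
        by auto
      have "\<kappa> (x + s) \<le> \<kappa> x + s" using step[of x "x+s"] lip[of x "x+s"] s x by simp
      then have "c * \<kappa> (x + s) \<le> c * \<kappa> x + c * s"
        using \<open>0 \<le> c\<close> by (metis distrib_left mult_left_mono)
      moreover have "e * x \<le> e * (x + s)" using \<open>e > 0\<close> s by simp
      ultimately show ?thesis using s by (intro exI[of _ "x + s"]) linarith
    next
      case False
      then obtain d where d: "d > 0" "ball x d \<subseteq> - K"
        using \<open>closed K\<close> open_contains_ball[of "- K"] by (auto simp: open_Compl)
      \<comment> \<open>Off \<open>K\<close> the measure term does not change, and monotonicity of \<open>g\<close> suffices.\<close>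
    define s where "s = min (d/2) (b - x)"
      have s: "0 < s" "s < d" "x + s \<le> b" using d x by (auto simp: s_def)
      have "K \<inter> {x..x+s} = {}"
        using d(2) s by (auto simp: dist_real_def subset_eq)
      then have "\<kappa> (x + s) \<le> \<kappa> x" using step[of x "x+s"] s x by simp
      then have "c * \<kappa> (x + s) \<le> c * \<kappa> x" using \<open>0 \<le> c\<close> by (rule mult_left_mono)
      moreover have "g x \<le> g (x + s)" using mono s by (simp add: monoD)
      moreover have "e * x \<le> e * (x + s)" using \<open>e > 0\<close> s by simp
      ultimately show ?thesis using s by (intro exI[of _ "x + s"]) linarith
    qed
  qed fact
  have *: "c * \<kappa> b - c * \<kappa> a \<le> (g b - g a) + e * (b - a)" if "e > 0" for e
    using pre[OF that] by (simp add: algebra_simps)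
  have "c * \<kappa> b - c * \<kappa> a \<le> g b - g a"
  proof (cases "a = b")
    case False
    show ?thesis
    proof (rule field_le_epsilon)
      fix e :: real assume "e > 0"
      then show "c * \<kappa> b - c * \<kappa> a \<le> g b - g a + e"
        using *[of "e / (b - a)"] \<open>a \<le> b\<close> False by simp
    qed
  qed simp
  moreover have "\<kappa> a = 0"
    unfolding \<kappa>_def using lip[of a a] by (simp add: measure_le_0_iff)
  ultimately show ?thesis by (simp add: \<kappa>_def)
qed

text \<open>This replaces the Lebesgue density theorem.  Nonoverlapping intervals that cover \<open>K\<close> with total
  length at most \<open>|K| + e\<close> show \<open>|K| \<le> \<theta> (|K| + e)\<close>.\<close>

lemma small_in_intervals_imp_null:
  fixes K :: "real set"
  assumes K: "K \<in> lmeasurable" "K \<subseteq> {A..B}" and th: "\<theta> < 1" "0 \<le> \<theta>"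
    and le: "\<And>a b. a \<le> b \<Longrightarrow> measure lebesgue (K \<inter> {a..b}) \<le> \<theta> * (b - a)"
  shows "measure lebesgue K = 0"
proof -
  have "measure lebesgue K \<le> \<theta> * measure lebesgue K + e" if "e > 0" for e
  proof -
    obtain \<D> where D: "countable \<D>"
        "\<And>I. I \<in> \<D> \<Longrightarrow> I \<subseteq> cbox A B \<and> I \<noteq> {} \<and> (\<exists>c d. I = cbox c d)"
        "pairwise (\<lambda>A B. interior A \<inter> interior B = {}) \<D>"
        "K \<subseteq> \<Union>\<D>" "\<Union>\<D> \<in> lmeasurable" "measure lebesgue (\<Union>\<D>) \<le> measure lebesgue K + e"
      by (rule measurable_outer_intervals_bounded[OF K(1) K(2)[folded cbox_interval] \<open>e > 0\<close>]) (rule that)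
    have msr: "emeasure lebesgue (K \<inter> interior I) \<le> ennreal \<theta> * emeasure lebesgue (interior I)" if "I \<in> \<D>" for I
    proof -
      obtain c d where I: "I = {c..d}" "c \<le> d" using D(2)[OF \<open>I \<in> \<D>\<close>] by (auto simp: cbox_interval)
      have "emeasure lebesgue (K \<inter> interior I) \<le> emeasure lebesgue (K \<inter> I)"
        using K I interior_subset by (intro emeasure_mono sets.Int) (auto simp: fmeasurableD)
      also have "emeasure lebesgue (K \<inter> I) = ennreal (measure lebesgue (K \<inter> I))"
        using K I by (intro emeasure_eq_measure2) (simp add: fmeasurable_Int_fmeasurable lmeasurable_cbox[of c d, unfolded cbox_interval])
      also have "\<dots> \<le> ennreal (\<theta> * (d - c))" using le[OF I(2)] I by (intro ennreal_leI) simp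
      also have "\<dots> = ennreal \<theta> * emeasure lebesgue (interior I)"
        using I th by (simp add: ennreal_mult)
      finally show ?thesis .
    qed
    have disj: "disjoint_family_on interior \<D>"
      using D(3) by (auto simp: disjoint_family_on_def pairwise_def)
    have Imeas: "interior I \<in> sets lebesgue" for I :: "real set" by simp
    \<comment> \<open>The intervals may share end points, which are discarded to obtain a disjoint family.\<close>
    have null: "(\<Union>I\<in>\<D>. frontier I) \<in> null_sets lebesgue"
    proof (rule null_sets_UN'[OF D(1)])
      fix I assume "I \<in> \<D>"
      then obtain c d where "I = cbox c d" using D(2) by blast
      then show "frontier I \<in> null_sets lebesgue"
        using negligible_convex_frontier[of I] by (simp add: negligible_iff_null_sets convex_box)
    qed
    have "emeasure lebesgue K \<le> emeasure lebesgue ((\<Union>I\<in>\<D>. K \<inter> interior I) \<union> (\<Union>I\<in>\<D>. frontier I))"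
    proof (rule emeasure_mono)
      show "K \<subseteq> (\<Union>I\<in>\<D>. K \<inter> interior I) \<union> (\<Union>I\<in>\<D>. frontier I)"
      proof
        fix x assume "x \<in> K"
        then obtain I where "I \<in> \<D>" "x \<in> I" using D(4) by blast
        then show "x \<in> (\<Union>I\<in>\<D>. K \<inter> interior I) \<union> (\<Union>I\<in>\<D>. frontier I)"
          using \<open>x \<in> K\<close> closure_subset[of I] by (cases "x \<in> interior I") (auto simp: frontier_def)
      qed
      show "(\<Union>I\<in>\<D>. K \<inter> interior I) \<union> (\<Union>I\<in>\<D>. frontier I) \<in> sets lebesgue"
        using null K D(1) by (intro sets.Un sets.countable_UN' sets.Int Imeas) (auto simp: fmeasurableD)
    qed
    also have "\<dots> = emeasure lebesgue (\<Union>I\<in>\<D>. K \<inter> interior I)"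
      using null K D(1) by (intro emeasure_Un_null_set sets.countable_UN' sets.Int Imeas) (auto simp: fmeasurableD)
    also have "\<dots> = (\<integral>\<^sup>+I. emeasure lebesgue (K \<inter> interior I) \<partial>count_space \<D>)"
      using disj K D(1) by (intro emeasure_UN_countable sets.Int Imeas) (auto simp: fmeasurableD disjoint_family_on_def)
    also have "\<dots> \<le> (\<integral>\<^sup>+I. ennreal \<theta> * emeasure lebesgue (interior I) \<partial>count_space \<D>)"
      by (intro nn_integral_mono) (use msr in auto)
    also have "\<dots> = ennreal \<theta> * (\<integral>\<^sup>+I. emeasure lebesgue (interior I) \<partial>count_space \<D>)"
      by (intro nn_integral_cmult) auto
    also have "(\<integral>\<^sup>+I. emeasure lebesgue (interior I) \<partial>count_space \<D>) = emeasure lebesgue (\<Union>I\<in>\<D>. interior I)"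
      by (intro emeasure_UN_countable[symmetric] D(1) disj) auto
    also have "\<dots> \<le> emeasure lebesgue (\<Union>\<D>)"
      using D(5) interior_subset by (intro emeasure_mono) (auto simp: fmeasurableD)
    also have "\<dots> = ennreal (measure lebesgue (\<Union>\<D>))" using D(5) by (rule emeasure_eq_measure2)
    also have "\<dots> \<le> ennreal (measure lebesgue K + e)" using D(6) by (rule ennreal_leI)
    finally have "measure lebesgue K \<le> \<theta> * (measure lebesgue K + e)"
      using K th \<open>e > 0\<close> by (simp add: emeasure_eq_measure2 mult_left_mono flip: ennreal_mult ennreal_plus)
    also have "\<dots> \<le> \<theta> * measure lebesgue K + e"
      using mult_right_mono[of \<theta> 1 e] th \<open>e>0\<close> by (simp add: algebra_simps)
    finally show ?thesis .
  qed
  then have "measure lebesgue K \<le> \<theta> * measure lebesgue K" by (rule field_le_epsilon)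
  then have "(1 - \<theta>) * measure lebesgue K \<le> 0" by (simp add: algebra_simps)
  with th have "measure lebesgue K \<le> 0" by (simp add: mult_le_0_iff)
  then show ?thesis by (simp add: measure_le_0_iff)
qed


text \<open>Inner regularity of Lebesgue measure.\<close>

lemma null_sets_if_compact_subsets_null:
  fixes A :: "'a::euclidean_space set"
  assumes A: "A \<in> sets lebesgue"
    and null: "\<And>K. compact K \<Longrightarrow> K \<subseteq> A \<Longrightarrow> measure lebesgue K = 0"
  shows "A \<in> null_sets lebesgue"
proof -
  have "A \<inter> cball 0 (real n) \<in> null_sets lebesgue" for n
  proof -
    have An: "A \<inter> cball 0 (real n) \<in> sets lebesgue" using A by auto
    have "emeasure lebesgue (A \<inter> cball 0 (real n)) \<le> ennreal e" if "e > 0" for e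
    proof -
      obtain T where T: "closed T" "T \<subseteq> A \<inter> cball 0 (real n)"
          "(A \<inter> cball 0 (real n)) - T \<in> lmeasurable" "emeasure lebesgue ((A \<inter> cball 0 (real n)) - T) < ennreal e"
        using sets_lebesgue_inner_closed[OF An \<open>e > 0\<close>] by blast
      have "compact T"
        using T bounded_subset[OF bounded_cball, of T] by (auto simp: compact_eq_bounded_closed)
      then have "T \<in> lmeasurable" "measure lebesgue T = 0"
        using null[of T] T by (auto intro: lmeasurable_compact)
      then have "emeasure lebesgue T = 0" by (simp add: emeasure_eq_measure2)
      moreover have "emeasure lebesgue (A \<inter> cball 0 (real n))
          \<le> emeasure lebesgue T + emeasure lebesgue ((A \<inter> cball 0 (real n)) - T)"
        using T(2) \<open>T \<in> lmeasurable\<close> T(3)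
        by (metis Un_Diff_cancel emeasure_subadditive fmeasurableD sup.absorb_iff2)
      ultimately show ?thesis using T(4) by simp
    qed
    note le = this
    have "emeasure lebesgue (A \<inter> cball 0 (real n)) \<le> 0"
    proof (rule ennreal_le_epsilon)
      fix e :: real assume "0 < e"
      then show "emeasure lebesgue (A \<inter> cball 0 (real n)) \<le> 0 + ennreal e" using le by simp
    qed
    then show ?thesis using An by (simp add: null_sets_def)
  qed
  then have "(\<Union>n. A \<inter> cball 0 (real n)) \<in> null_sets lebesgue" by (rule null_sets_UN)
  moreover have "(\<Union>n. A \<inter> cball 0 (real n)) = A"
  proof (intro set_eqI iffI)
    fix x assume "x \<in> A"
    moreover obtain n where "norm x \<le> real n" using real_arch_simple by blast
    ultimately show "x \<in> (\<Union>n. A \<inter> cball 0 (real n))" by (intro UN_I[of n]) simp_all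
  qed blast
  ultimately show ?thesis by simp
qed

text \<open>The points where the right difference quotient in direction \<open>v\<close> lies above \<open>q\<close> and below \<open>p\<close> at arbitrarily
  small scales.  The scales are bounded by \<open>1/(n+1)\<close> so that the set is visibly a countable intersection of
  open sets when \<open>f\<close> is continuous.\<close>

definition osc_set :: "('a::real_normed_vector \<Rightarrow> real) \<Rightarrow> 'a \<Rightarrow> real \<Rightarrow> real \<Rightarrow> 'a set" where
  "osc_set f v p q = {x. \<forall>n. (\<exists>s. 0 < s \<and> s < inverse (real (Suc n)) \<and> q * s < f (x + s *\<^sub>R v) - f x) \<and>
     (\<exists>s. 0 < s \<and> s < inverse (real (Suc n)) \<and> f (x + s *\<^sub>R v) - f x < p * s)}"

lemma osc_set_borel:
  assumes "continuous_on UNIV f"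
  shows "osc_set f v p q \<in> sets borel"
proof -
  have c: "continuous_on UNIV (\<lambda>x. f (x + s *\<^sub>R v))" for s
    by (intro continuous_on_compose2[OF assms] continuous_intros) auto
  have eq: "osc_set f v p q = (\<Inter>n. (\<Union>s\<in>{0<..<inverse (real (Suc n))}. {x. q * s < f (x + s *\<^sub>R v) - f x}) \<inter>
     (\<Union>s\<in>{0<..<inverse (real (Suc n))}. {x. f (x + s *\<^sub>R v) - f x < p * s}))"
    unfolding osc_set_def by (intro set_eqI) (simp add: conj_assoc Bex_def)
  show ?thesis
    unfolding eq
    by (intro sets.countable_INT'' borel_open open_Int open_UN ballI open_Collect_less continuous_intros assms c) auto
qed

text \<open>Both \<open>f(x) + L x\<close> and \<open>L x - f(x)\<close> are increasing, and on a compact part \<open>K\<close> of the set their upper right Dini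
  derivatives are at least \<open>q + L\<close> and \<open>L - p\<close>.  Adding the two growth bounds over \<open>[a, b]\<close> gives
  \<open>(2L + q - p) |K \<inter> [a,b]| \<le> 2L (b - a)\<close>, so \<open>K\<close> fills at most a fixed fraction below one of each interval.\<close>

lemma osc_set_real_null:
  fixes f :: "real \<Rightarrow> real"
  assumes lip: "L-lipschitz_on UNIV f" and "p < q"
  shows "osc_set f 1 p q \<in> null_sets lborel"
proof -
  have cont: "continuous_on UNIV f" by (rule lipschitz_on_continuous_on[OF lip])
  have L: "0 \<le> L" by (rule lipschitz_on_nonneg[OF lip])
  have lip': "\<bar>f y - f x\<bar> \<le> L * \<bar>y - x\<bar>" for x y
    using lipschitz_onD[OF lip, of y x] by (simp add: dist_real_def)
  have near: "(\<exists>s. 0 < s \<and> s < m \<and> q * s < f (x + s) - f x) \<and> (\<exists>s. 0 < s \<and> s < m \<and> f (x + s) - f x < p * s)"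
    if x: "x \<in> osc_set f 1 p q" and "m > 0" for x m
  proof -
    obtain n where n: "inverse (real (Suc n)) < m" using reals_Archimedean[OF \<open>m > 0\<close>] by blast
    from x have "(\<exists>s. 0 < s \<and> s < inverse (real (Suc n)) \<and> q * s < f (x + s) - f x) \<and>
        (\<exists>s. 0 < s \<and> s < inverse (real (Suc n)) \<and> f (x + s) - f x < p * s)"
      unfolding osc_set_def by simp
    then show ?thesis using n by (meson less_trans)
  qed
  have pq: "0 \<le> q + L \<and> 0 \<le> L - p" if x: "x \<in> osc_set f 1 p q" for x
  proof -
    obtain s s' where s: "0 < s" "q * s < f (x + s) - f x" "0 < s'" "f (x + s') - f x < p * s'"
      using near[OF x, of 1] by auto
    moreover have "f (x + s) - f x \<le> L * s" "- (L * s') \<le> f (x + s') - f x"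
      using lip'[of "x+s" x] lip'[of "x+s'" x] s by (simp_all add: abs_le_iff)
    ultimately have "q * s < L * s" "(- L) * s' < p * s'" by linarith+
    then have "q < L" "- L < p" using s by (simp_all only: mult_less_cancel_right_pos)
    then show ?thesis using \<open>p < q\<close> by linarith
  qed
  have bor: "osc_set f 1 p q \<in> sets borel" by (rule osc_set_borel[OF cont])
  have "measure lebesgue K = 0" if K: "compact K" "K \<subseteq> osc_set f 1 p q" for K
  proof (cases "K = {}")
    case False
    then obtain x0 where "x0 \<in> K" by blast
    then have pq': "0 \<le> q + L" "0 \<le> L - p" using pq[of x0] K by auto
    have main: "(2 * L + (q - p)) * measure lebesgue (K \<inter> {a..b}) \<le> 2 * L * (b - a)" if "a \<le> b" for a b
    proof -
      have 1: "(q + L) * measure lebesgue (K \<inter> {a..b}) \<le> (f b + L * b) - (f a + L * a)"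
      proof (rule dini_lower_bound)
        show "mono (\<lambda>x. f x + L * x)"
        proof (rule monoI)
          fix x y :: real assume "x \<le> y"
          then show "f x + L * x \<le> f y + L * y" using lip'[of y x] by (auto simp: algebra_simps abs_if split: if_splits)
        qed
        show "\<exists>s>0. s < m \<and> (q + L) * s < f (x + s) + L * (x + s) - (f x + L * x)"
          if "x \<in> K" "0 < m" for x m
          using near[of x m] that K by (auto simp: algebra_simps)
      qed (use cont pq' K that in \<open>auto intro!: continuous_intros compact_imp_closed\<close>)
      have 2: "(L - p) * measure lebesgue (K \<inter> {a..b}) \<le> (L * b - f b) - (L * a - f a)"
      proof (rule dini_lower_bound)
        show "mono (\<lambda>x. L * x - f x)"
        proof (rule monoI)
          fix x y :: real assume "x \<le> y"
          then show "L * x - f x \<le> L * y - f y" using lip'[of y x] by (auto simp: algebra_simps abs_if split: if_splits)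
        qed
        show "\<exists>s>0. s < m \<and> (L - p) * s < L * (x + s) - f (x + s) - (L * x - f x)"
          if "x \<in> K" "0 < m" for x m
          using near[of x m] that K by (auto simp: algebra_simps)
      qed (use cont pq' K that in \<open>auto intro!: continuous_intros compact_imp_closed\<close>)
      show ?thesis using 1 2 by (simp add: algebra_simps)
    qed
    define \<theta> where "\<theta> = 2 * L / (2 * L + (q - p))"
    have pos: "0 < 2 * L + (q - p)" using L \<open>p < q\<close> by linarith
    obtain R where R: "K \<subseteq> cbox (- R) R" using compact_imp_bounded[OF K(1)] bounded_subset_cbox_symmetric by blast
    show ?thesis
    proof (rule small_in_intervals_imp_null)
      show "K \<subseteq> {- R..R}" using R by (simp add: cbox_interval)
      show "\<theta> < 1" "0 \<le> \<theta>" using pos L \<open>p < q\<close> by (simp_all add: \<theta>_def)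
      show "measure lebesgue (K \<inter> {a..b}) \<le> \<theta> * (b - a)" if "a \<le> b" for a b
        using main[OF that] pos by (simp add: \<theta>_def field_simps)
    qed (use K lmeasurable_compact in auto)
  qed simp
  then have "osc_set f 1 p q \<in> null_sets lebesgue"
    using bor by (intro null_sets_if_compact_subsets_null) auto
  then show ?thesis using bor by (simp add: null_sets_completion_iff)
qed

text \<open>Averaging the measure of \<open>E\<close> over the translates by \<open>\<tau> v\<close>, \<open>0 \<le> \<tau> \<le> 1\<close>, turns it into an integral of
  the measures of its sections by lines in direction \<open>v\<close>.\<close>

lemma null_sets_if_null_on_lines:
  fixes E :: "'a::euclidean_space set"
  assumes E[measurable]: "E \<in> sets borel" and null: "\<And>x. {\<tau>. x + \<tau> *\<^sub>R v \<in> E} \<in> null_sets lborel"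
  shows "E \<in> null_sets lborel"
proof -
  have [measurable]: "(\<lambda>x. x + \<tau> *\<^sub>R v) \<in> borel_measurable borel" for \<tau> by simp
  have "(\<integral>\<^sup>+\<tau>. indicator {0..1} \<tau> * emeasure lborel E \<partial>(lborel::real measure))
      = (\<integral>\<^sup>+\<tau>. (\<integral>\<^sup>+x. indicator {0..1} \<tau> * indicator E (x + \<tau> *\<^sub>R v) \<partial>lborel) \<partial>(lborel::real measure))"
  proof (rule nn_integral_cong)
    fix \<tau> :: real
    have "emeasure lborel E = (\<integral>\<^sup>+x. indicator E x \<partial>distr lborel borel ((+) (\<tau> *\<^sub>R v)))"
      by (simp add: lborel_distr_plus)
    also have "\<dots> = (\<integral>\<^sup>+x. indicator E (x + \<tau> *\<^sub>R v) \<partial>lborel)"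
      by (subst nn_integral_distr) (auto simp: add.commute)
    finally show "indicator {0..1} \<tau> * emeasure lborel E = (\<integral>\<^sup>+x. indicator {0..1} \<tau> * indicator E (x + \<tau> *\<^sub>R v) \<partial>lborel)"
      by (subst nn_integral_cmult) auto
  qed
  also have "\<dots> = (\<integral>\<^sup>+x. (\<integral>\<^sup>+\<tau>. indicator {0..1} \<tau> * indicator E (x + \<tau> *\<^sub>R v) \<partial>lborel) \<partial>lborel)"
    by (rule lborel_pair.Fubini') measurable
  also have "\<dots> = (\<integral>\<^sup>+x. 0 \<partial>(lborel :: 'a measure))"
  proof (rule nn_integral_cong)
    fix x
    have "AE \<tau> in lborel. x + \<tau> *\<^sub>R v \<notin> E"
      using AE_not_in[OF null[of x]] by simp
    then have "AE \<tau> in lborel. indicator {0..1} \<tau> * indicator E (x + \<tau> *\<^sub>R v) = (0::ennreal)"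
      by eventually_elim simp
    then show "(\<integral>\<^sup>+\<tau>. indicator {0..1} \<tau> * indicator E (x + \<tau> *\<^sub>R v) \<partial>lborel) = (0::ennreal)"
      by (subst nn_integral_0_iff_AE) auto
  qed
  finally have "emeasure lborel E = 0"
    by (simp add: nn_integral_multc)
  then show ?thesis by (simp add: null_sets_def)
qed

lemma bounded_tendsto_or_oscillates:
  fixes X :: "'s \<Rightarrow> real"
  assumes F: "F \<noteq> bot" and bd: "eventually (\<lambda>s. \<bar>X s\<bar> \<le> C) F"
    and no: "\<And>p q :: rat. p < q \<Longrightarrow> \<not> ((\<exists>\<^sub>F s in F. of_rat q < X s) \<and> (\<exists>\<^sub>F s in F. X s < of_rat p))"
  shows "\<exists>l. (X \<longlongrightarrow> l) F"
proof -
  define f where "f s = ereal (X s)" for s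
  have le: "Liminf F f \<le> Limsup F f" by (rule Liminf_le_Limsup[OF F])
  have "Liminf F f = Limsup F f"
  proof (rule ccontr)
    assume "Liminf F f \<noteq> Limsup F f"
    with le have "Liminf F f < Limsup F f" by simp
    then obtain p q :: rat where pq: "Liminf F f < ereal (of_rat p)" "p < q" "ereal (of_rat q) < Limsup F f"
    proof -
      obtain p :: rat where p: "Liminf F f < real_of_rat p" "real_of_rat p < Limsup F f"
        using ereal_dense3[OF \<open>Liminf F f < Limsup F f\<close>] by blast
      obtain q :: rat where q: "real_of_rat p < real_of_rat q" "real_of_rat q < Limsup F f"
        using ereal_dense3[OF p(2)] by auto
      then have "p < q" using of_rat_less by auto
      then show ?thesis using that p q by blast
    qed
    have "\<exists>\<^sub>F s in F. of_rat q < X s"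
    proof (rule ccontr)
      assume "\<not> ?thesis"
      then have "eventually (\<lambda>s. f s \<le> ereal (of_rat q)) F" by (simp add: frequently_def not_less f_def)
      from Limsup_bounded[OF this] pq(3) show False by simp
    qed
    moreover have "\<exists>\<^sub>F s in F. X s < of_rat p"
    proof (rule ccontr)
      assume "\<not> ?thesis"
      then have "eventually (\<lambda>s. ereal (of_rat p) \<le> f s) F" by (simp add: frequently_def not_less f_def)
      from Liminf_bounded[OF this] pq(1) show False by simp
    qed
    ultimately show False using no[OF pq(2)] by blast
  qed
  then have lim: "(f \<longlongrightarrow> Limsup F f) F" using tendsto_iff_Liminf_eq_Limsup[OF F] by blast
  have "Limsup F f \<le> ereal C" "ereal (- C) \<le> Liminf F f"
    using bd by (auto intro!: Limsup_bounded Liminf_bounded elim!: eventually_mono simp: f_def)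
  then have "\<bar>Limsup F f\<bar> \<noteq> \<infinity>" using \<open>Liminf F f = Limsup F f\<close> by auto
  then obtain l where "Limsup F f = ereal l" by auto
  with lim show ?thesis unfolding f_def by auto
qed

section \<open>Rademacher's theorem\<close>

lemma directional_quotient_converges_AE:
  fixes f :: "'a::euclidean_space \<Rightarrow> real"
  assumes lip: "L-lipschitz_on UNIV f"
  shows "AE x in lborel. \<exists>l. ((\<lambda>s. (f (x + s *\<^sub>R v) - f x) / s) \<longlongrightarrow> l) (at_right 0)"
proof -
  have cont: "continuous_on UNIV f" by (rule lipschitz_on_continuous_on[OF lip])
  have L: "0 \<le> L" by (rule lipschitz_on_nonneg[OF lip])
  have lip': "\<bar>f y - f x\<bar> \<le> L * norm (y - x)" for x y
    using lipschitz_onD[OF lip, of y x] by (simp add: dist_norm dist_real_def)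
  have null: "osc_set f v p q \<in> null_sets lborel" if "p < q" for p q
  proof (rule null_sets_if_null_on_lines)
    fix x
    have "(L * norm v)-lipschitz_on UNIV (\<lambda>\<tau>. f (x + \<tau> *\<^sub>R v))"
    proof (rule lipschitz_onI)
      fix s t :: real
      show "dist (f (x + s *\<^sub>R v)) (f (x + t *\<^sub>R v)) \<le> L * norm v * dist s t"
        using lip'[of "x + s *\<^sub>R v" "x + t *\<^sub>R v"]
        by (simp add: dist_norm mult_ac flip: scaleR_left_diff_distrib)
    qed (use L in auto)
    from osc_set_real_null[OF this \<open>p < q\<close>]
    show "{\<tau>. x + \<tau> *\<^sub>R v \<in> osc_set f v p q} \<in> null_sets lborel"
      by (simp add: osc_set_def algebra_simps)
  qed (rule osc_set_borel[OF cont])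
  have "AE x in lborel. \<forall>p q :: rat. p < q \<longrightarrow> x \<notin> osc_set f v (of_rat p) (of_rat q)"
    unfolding AE_all_countable
  proof (intro allI)
    fix p q :: rat
    show "AE x in lborel. p < q \<longrightarrow> x \<notin> osc_set f v (of_rat p) (of_rat q)"
      using AE_not_in[OF null[of "of_rat p" "of_rat q"]] by (cases "p < q") (auto simp: of_rat_less)
  qed
  then show ?thesis
  proof eventually_elim
    fix x assume x: "\<forall>p q :: rat. p < q \<longrightarrow> x \<notin> osc_set f v (of_rat p) (of_rat q)"
    let ?X = "\<lambda>s. (f (x + s *\<^sub>R v) - f x) / s"
    have pos: "eventually (\<lambda>s::real. 0 < s) (at_right 0)" by (simp add: eventually_at_right_less)
    show "\<exists>l. (?X \<longlongrightarrow> l) (at_right 0)"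
    proof (rule bounded_tendsto_or_oscillates)
      show "eventually (\<lambda>s. \<bar>?X s\<bar> \<le> L * norm v) (at_right 0)"
        using pos
      proof eventually_elim
        fix s :: real assume "0 < s"
        then show "\<bar>?X s\<bar> \<le> L * norm v" using lip'[of "x + s *\<^sub>R v" x] by (simp add: field_simps)
      qed
      fix p q :: rat assume "p < q"
      show "\<not> ((\<exists>\<^sub>F s in at_right 0. of_rat q < ?X s) \<and> (\<exists>\<^sub>F s in at_right 0. ?X s < of_rat p))"
      proof
        assume freq: "(\<exists>\<^sub>F s in at_right 0. of_rat q < ?X s) \<and> (\<exists>\<^sub>F s in at_right 0. ?X s < of_rat p)"
        have "x \<in> osc_set f v (of_rat p) (of_rat q)"
          unfolding osc_set_def
        proof (intro CollectI allI)
          fix n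
          have near: "eventually (\<lambda>s::real. 0 < s \<and> s < inverse (real (Suc n))) (at_right 0)"
            unfolding eventually_at_right_field by (intro exI[of _ "inverse (real (Suc n))"]) auto
          show "(\<exists>s>0. s < inverse (real (Suc n)) \<and> real_of_rat q * s < f (x + s *\<^sub>R v) - f x) \<and>
             (\<exists>s>0. s < inverse (real (Suc n)) \<and> f (x + s *\<^sub>R v) - f x < real_of_rat p * s)"
            using frequently_ex[OF frequently_eventually_conj[OF conjunct1[OF freq] near]]
              frequently_ex[OF frequently_eventually_conj[OF conjunct2[OF freq] near]]
            by (auto simp: field_simps)
        qed
        with x \<open>p < q\<close> show False by blast
      qed
    qed simp
  qed
qed

text \<open>The limit is taken along the steps \<open>1/(n+1)\<close> to make this a Borel function on the whole space; it is the right
  directional derivative wherever the latter exists, hence almost everywhere for Lipschitz \<open>f\<close>.\<close>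

definition right_deriv :: "('a::real_normed_vector \<Rightarrow> real) \<Rightarrow> 'a \<Rightarrow> 'a \<Rightarrow> real" where
  "right_deriv f v x = lim (\<lambda>n. (f (x + inverse (real (Suc n)) *\<^sub>R v) - f x) / inverse (real (Suc n)))"

abbreviation right_grad :: "('a::euclidean_space \<Rightarrow> real) \<Rightarrow> 'a \<Rightarrow> 'a" where
  "right_grad f x \<equiv> (\<Sum>i\<in>Basis. right_deriv f i x *\<^sub>R i)"

lemma filterlim_inverse_Suc_at_right: "filterlim (\<lambda>n. inverse (real (Suc n))) (at_right 0) sequentially"
  unfolding filterlim_at using LIMSEQ_inverse_real_of_nat by (auto simp del: of_nat_Suc)

lemma right_deriv_eq:
  assumes "((\<lambda>s. (f (x + s *\<^sub>R v) - f x) / s) \<longlongrightarrow> l) (at_right 0)"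
  shows "right_deriv f v x = l"
  unfolding right_deriv_def
  by (rule limI[OF filterlim_compose[OF assms filterlim_inverse_Suc_at_right]])

lemma tendsto_right_deriv_AE:
  fixes f :: "'a::euclidean_space \<Rightarrow> real"
  assumes lip: "L-lipschitz_on UNIV f"
  shows "AE x in lborel. ((\<lambda>s. (f (x + s *\<^sub>R v) - f x) / s) \<longlongrightarrow> right_deriv f v x) (at_right 0)"
  using directional_quotient_converges_AE[OF lip, of v]
  by eventually_elim (auto simp: right_deriv_eq)

lemma borel_measurable_right_deriv:
  fixes f :: "'a::euclidean_space \<Rightarrow> real"
  assumes "continuous_on UNIV f"
  shows "right_deriv f v \<in> borel_measurable borel"
proof -
  have "continuous_on UNIV (\<lambda>x. (f (x + c *\<^sub>R v) - f x) / c)" for c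
    by (cases "c = 0") (auto intro!: continuous_intros continuous_on_compose2[OF assms] assms)
  then have [measurable]: "(\<lambda>x. (f (x + c *\<^sub>R v) - f x) / c) \<in> borel_measurable borel" for c
    by (rule borel_measurable_continuous_onI)
  show ?thesis unfolding right_deriv_def by measurable
qed

lemma AE_zero_if_compact_integrals_zero:
  fixes g :: "'a::euclidean_space \<Rightarrow> real"
  assumes g[measurable]: "g \<in> borel_measurable borel" and bd: "\<And>x. \<bar>g x\<bar> \<le> C"
    and zero: "\<And>K. compact K \<Longrightarrow> (LBINT x. indicator K x * g x) = 0"
  shows "AE x in lborel. g x = 0"
proof -
  have half: "AE x in lborel. \<not> 0 < h x" if h[measurable]: "h \<in> borel_measurable borel" and bd: "\<And>x. \<bar>h x\<bar> \<le> C"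
    and zero: "\<And>K. compact K \<Longrightarrow> (LBINT x. indicator K x * h x) = 0" for h :: "'a \<Rightarrow> real"
  proof -
    have A: "{x. 0 < h x} \<in> sets borel" by measurable
    have "{x. 0 < h x} \<in> null_sets lebesgue"
    proof (rule null_sets_if_compact_subsets_null)
      fix K assume K: "compact K" "K \<subseteq> {x. 0 < h x}"
      then have [measurable]: "K \<in> sets borel" by (simp add: borel_compact)
      have "integrable lborel (\<lambda>x. indicator K x * h x)"
      proof (rule Bochner_Integration.integrable_bound)
        show "integrable lborel (\<lambda>x. indicator K x * C)"
          using emeasure_compact_finite[OF K(1)] by (auto simp: less_top)
        show "AE x in lborel. norm (indicator K x * h x) \<le> norm (indicator K x * C)"
          using bd order_trans[OF abs_ge_zero bd] by (auto simp: indicator_def)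
      qed measurable
      moreover have "AE x in lborel. 0 \<le> indicator K x * h x"
        using K by (auto simp: indicator_def subset_eq less_imp_le)
      ultimately have "AE x in lborel. indicator K x * h x = 0"
        using integral_nonneg_eq_0_iff_AE zero[OF K(1)] by blast
      then have "AE x in lborel. x \<notin> K"
        by eventually_elim (use K in \<open>auto simp: indicator_def subset_eq split: if_splits\<close>)
      then have "emeasure lborel K = 0" by (subst (asm) AE_iff_measurable[OF _ refl]) auto
      then show "measure lebesgue K = 0" by (simp add: measure_def)
    qed (use A in auto)
    then have "{x. 0 < h x} \<in> null_sets lborel" using A by (simp add: null_sets_completion_iff)
    then show ?thesis using AE_not_in by fastforce
  qed
  have "AE x in lborel. \<not> 0 < g x" by (rule half[OF g bd zero])
  moreover have "AE x in lborel. \<not> 0 < - g x" by (rule half) (use g bd zero in auto)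
  ultimately show ?thesis by eventually_elim simp
qed

lemma integral_lborel_translate:
  fixes f :: "'a::euclidean_space \<Rightarrow> 'b::{banach, second_countable_topology}"
  assumes "f \<in> borel_measurable borel"
  shows "(LBINT x. f (x + c)) = (LBINT x. f x)"
proof -
  have "(LBINT x. f x) = (\<integral>x. f x \<partial>distr lborel borel ((+) c))"
    by (simp add: lborel_distr_plus)
  also have "\<dots> = (LBINT x. f (x + c))"
    using assms by (subst integral_distr) (auto simp: add.commute)
  finally show ?thesis by simp
qed

lemma integrable_lborel_translate:
  fixes f :: "'a::euclidean_space \<Rightarrow> 'b::{banach, second_countable_topology}"
  assumes "f \<in> borel_measurable borel" "integrable lborel f"
  shows "integrable lborel (\<lambda>x. f (x + c))"
proof -
  have "integrable (distr lborel borel ((+) c)) f"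
    using assms by (simp add: lborel_distr_plus)
  then show ?thesis
    using assms by (subst (asm) integrable_distr_eq) (auto simp: add.commute)
qed

lemma integrable_bounded_support:
  fixes f :: "'a::euclidean_space \<Rightarrow> real"
  assumes "f \<in> borel_measurable borel" "\<And>x. \<bar>f x\<bar> \<le> C" "\<And>x. norm x > R \<Longrightarrow> f x = 0"
  shows "integrable lborel f"
proof (rule Bochner_Integration.integrable_bound)
  show "integrable lborel (\<lambda>x. indicator (cball 0 R :: 'a set) x * C)"
    using emeasure_compact_finite[OF compact_cball[of "0::'a" R]] by (auto simp: less_top)
  show "AE x in lborel. norm (f x) \<le> norm (indicator (cball 0 R) x * C)"
    using assms(2,3) order_trans[OF abs_ge_zero assms(2)] by (auto simp: indicator_def not_le)
qed (use assms in simp)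

lemma integral_dominated_bounded_support:
  fixes f :: "'a::euclidean_space \<Rightarrow> real"
  assumes "\<And>n. F n \<in> borel_measurable borel" "f \<in> borel_measurable borel"
    and bd: "\<And>n x. \<bar>F n x\<bar> \<le> C" "\<And>n x. norm x > R \<Longrightarrow> F n x = 0"
    and lim: "AE x in lborel. (\<lambda>n. F n x) \<longlonglongrightarrow> f x"
  shows "(\<lambda>n. LBINT x. F n x) \<longlonglongrightarrow> (LBINT x. f x)" "integrable lborel f"
proof -
  have I: "integrable lborel (\<lambda>x. indicator (cball 0 R :: 'a set) x * C)"
    using emeasure_compact_finite[OF compact_cball[of "0::'a" R]] by (auto simp: less_top)
  have b: "AE x in lborel. norm (F n x) \<le> indicator (cball 0 R) x * C" for n
    using bd order_trans[OF abs_ge_zero bd(1)] by (auto simp: indicator_def not_le)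
  show "(\<lambda>n. LBINT x. F n x) \<longlonglongrightarrow> (LBINT x. f x)"
    by (rule integral_dominated_convergence[OF _ _ I lim b]) (use assms in auto)
  show "integrable lborel f"
    by (rule integrable_dominated_convergence[OF _ _ I lim b]) (use assms in auto)
qed

text \<open>A point outside a closed set stays outside after a small translation.\<close>

lemma tendsto_integral_escape_closed:
  fixes A :: "'a::euclidean_space set"
  assumes A: "compact A" and d: "d \<longlonglongrightarrow> 0"
  shows "(\<lambda>n. LBINT x. indicator A (x + d n) * (1 - indicator A x)) \<longlonglongrightarrow> (0::real)"
proof -
  have [measurable]: "A \<in> sets borel" using A by (simp add: borel_compact)
  obtain B where B: "\<And>n. norm (d n) \<le> B"
    using convergent_imp_Bseq[OF convergentI[OF d]] by (auto simp: Bseq_def)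
  obtain R where R: "\<And>x. x \<in> A \<Longrightarrow> norm x \<le> R"
    using compact_imp_bounded[OF A] by (auto simp: bounded_iff)
  have "(\<lambda>n. LBINT x. indicator A (x + d n) * (1 - indicator A x)) \<longlonglongrightarrow> (\<integral>x. (0::real) \<partial>(lborel :: 'a measure))"
  proof (rule integral_dominated_bounded_support)
    show "\<bar>indicator A (x + d n) * (1 - indicator A x)\<bar> \<le> (1::real)" for n x
      by (auto simp: indicator_def)
    show "indicator A (x + d n) * (1 - indicator A x) = (0::real)" if "norm x > R + B" for n x
    proof -
      have "norm x \<le> norm (x + d n) + norm (d n)" by (metis add_diff_cancel norm_triangle_ineq4)
      then have "norm (x + d n) > R" using that B[of n] by linarith
      then have "x + d n \<notin> A" using R by fastforce
      then show ?thesis by simp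
    qed
    show "AE x in lborel. (\<lambda>n. indicator A (x + d n) * (1 - indicator A x)) \<longlonglongrightarrow> (0::real)"
    proof (intro always_eventually allI)
      fix x
      show "(\<lambda>n. indicator A (x + d n) * (1 - indicator A x)) \<longlonglongrightarrow> (0::real)"
      proof (cases "x \<in> A")
        case False
        have "(\<lambda>n. x + d n) \<longlonglongrightarrow> x" using tendsto_add[OF tendsto_const d, of x] by simp
        then have "eventually (\<lambda>n. x + d n \<in> - A) sequentially"
          using topological_tendstoD[of _ x sequentially "- A"] False compact_imp_closed[OF A] by auto
        then have "eventually (\<lambda>n. indicator A (x + d n) * (1 - indicator A x) = (0::real)) sequentially"
          by eventually_elim simp
        then show ?thesis by (rule tendsto_eventually)
      qed simp
    qed
  qed measurable
  then show ?thesis by simp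
qed

text \<open>By translation invariance the two halves of the symmetric difference of \<open>A\<close> and its translate have
  equal measure, so twice one of them suffices.\<close>

lemma tendsto_integral_translate_compact:
  fixes A :: "'a::euclidean_space set"
  assumes A: "compact A" and d: "d \<longlonglongrightarrow> 0"
  shows "(\<lambda>n. LBINT x. \<bar>indicator A (x + d n) - indicator A x\<bar>) \<longlonglongrightarrow> (0::real)"
proof -
  have [measurable]: "A \<in> sets borel" using A by (simp add: borel_compact)
  have iA: "integrable lborel (indicator A :: 'a \<Rightarrow> real)"
    using emeasure_compact_finite[OF A] by (auto simp: less_top)
  have iB: "integrable lborel (\<lambda>x. indicator A (x + c) :: real)" for c
    by (rule integrable_lborel_translate[OF _ iA]) measurable
  have "(LBINT x. \<bar>indicator A (x + c) - indicator A x\<bar>)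
      = 2 * (LBINT x. indicator A (x + c) * (1 - indicator A x) :: real)" for c :: 'a
  proof -
    have i: "integrable lborel (\<lambda>x. indicator A (x + c) * (1 - indicator A x) :: real)"
      by (rule Bochner_Integration.integrable_bound[OF iB[of c]]) (auto simp: indicator_def)
    have "(LBINT x. \<bar>indicator A (x + c) - indicator A x :: real\<bar>)
      = (LBINT x. (indicator A x - indicator A (x + c) :: real) + 2 * (indicator A (x + c) * (1 - indicator A x)))"
      by (intro Bochner_Integration.integral_cong refl) (auto simp: indicator_def)
    also have "\<dots> = ((LBINT x. indicator A x) - (LBINT x. indicator A (x + c)))
        + 2 * (LBINT x. indicator A (x + c) * (1 - indicator A x))"
      using i iA iB[of c] by simp
    also have "(LBINT x. indicator A (x + c)) = (LBINT x. indicator A x :: real)"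
      by (rule integral_lborel_translate) measurable
    finally show ?thesis by simp
  qed
  then show ?thesis using tendsto_mult_left[OF tendsto_integral_escape_closed[OF A d], of 2] by simp
qed

text \<open>Going from \<open>x\<close> to \<open>x + s (v + w)\<close> through \<open>x + s v\<close> shows that the defect of additivity at scale \<open>s\<close> is the
  difference of the \<open>w\<close>-quotients at \<open>x + s v\<close> and at \<open>x\<close>.  These quotients are bounded, so integrating over a
  compact set \<open>K\<close> and translating leaves at most a constant times the measure of the symmetric difference
  of \<open>K\<close> and its translate, which tends to zero.  The limiting defect thus has integral zero over every compact set.\<close>

lemma right_deriv_add_AE:
  fixes f :: "'a::euclidean_space \<Rightarrow> real"
  assumes lip: "L-lipschitz_on UNIV f"
  shows "AE x in lborel. right_deriv f (v + w) x = right_deriv f v x + right_deriv f w x"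
proof -
  have cont: "continuous_on UNIV f" by (rule lipschitz_on_continuous_on[OF lip])
  have L: "0 \<le> L" by (rule lipschitz_on_nonneg[OF lip])
  have lip': "\<bar>f y - f x\<bar> \<le> L * norm (y - x)" for x y
    using lipschitz_onD[OF lip, of y x] by (simp add: dist_norm dist_real_def)
  define \<delta> where "\<delta> n = inverse (real (Suc n))" for n
  have \<delta>: "\<delta> n > 0" for n by (simp add: \<delta>_def)
  have \<delta>0: "(\<lambda>n. \<delta> n *\<^sub>R u) \<longlonglongrightarrow> 0" for u :: 'a
    using tendsto_scaleR[OF LIMSEQ_inverse_real_of_nat tendsto_const, of u] by (simp add: \<delta>_def)
  define Q where "Q u n x = (f (x + \<delta> n *\<^sub>R u) - f x) / \<delta> n" for u n x
  have Qc: "continuous_on UNIV (Q u n)" for u n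
    unfolding Q_def using \<delta>[of n]
    by (auto intro!: continuous_intros continuous_on_compose2[OF cont] cont)
  have [measurable]: "Q u n \<in> borel_measurable borel" for u n
    by (rule borel_measurable_continuous_onI[OF Qc])
  have Qb: "\<bar>Q u n x\<bar> \<le> L * norm u" for u n x
    using lip'[of "x + \<delta> n *\<^sub>R u" x] \<delta>[of n] by (simp add: Q_def field_simps)
  have Qlim: "AE x in lborel. (\<lambda>n. Q u n x) \<longlonglongrightarrow> right_deriv f u x" for u
    using tendsto_right_deriv_AE[OF lip, of u]
  proof eventually_elim
    fix x assume "((\<lambda>s. (f (x + s *\<^sub>R u) - f x) / s) \<longlongrightarrow> right_deriv f u x) (at_right 0)"
    from filterlim_compose[OF this filterlim_inverse_Suc_at_right]
    show "(\<lambda>n. Q u n x) \<longlonglongrightarrow> right_deriv f u x" by (simp add: Q_def \<delta>_def)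
  qed
  \<comment> \<open>The defect of additivity at scale \<open>\<delta> n\<close>.\<close>
  define \<Delta> where "\<Delta> n x = Q w n (x + \<delta> n *\<^sub>R v) - Q w n x" for n x
  have \<Delta>: "\<Delta> n x = Q (v + w) n x - Q v n x - Q w n x" for n x
    by (simp add: \<Delta>_def Q_def algebra_simps diff_divide_distrib add_divide_distrib)
  define g where "g x = (if convergent (\<lambda>n. \<Delta> n x) then lim (\<lambda>n. \<Delta> n x) else 0)" for x
  have [measurable]: "\<Delta> n \<in> borel_measurable borel" for n unfolding \<Delta>_def by measurable
  have g[measurable]: "g \<in> borel_measurable borel"
    unfolding g_def Cauchy_convergent_iff[symmetric] by measurable
  have \<Delta>b: "\<bar>\<Delta> n x\<bar> \<le> 2 * (L * norm w)" for n x
    using Qb[of w n x] Qb[of w n "x + \<delta> n *\<^sub>R v"] by (simp add: \<Delta>_def)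
  have gb: "\<bar>g x\<bar> \<le> 2 * (L * norm w)" for x
  proof (cases "convergent (\<lambda>n. \<Delta> n x)")
    case True
    then have "(\<lambda>n. \<bar>\<Delta> n x\<bar>) \<longlonglongrightarrow> \<bar>g x\<bar>" by (simp add: g_def convergent_LIMSEQ_iff tendsto_rabs)
    then show ?thesis by (rule LIMSEQ_le_const2) (use \<Delta>b in auto)
  qed (use L in \<open>simp add: g_def\<close>)
  have glim: "AE x in lborel. (\<lambda>n. \<Delta> n x) \<longlonglongrightarrow> g x
      \<and> g x = right_deriv f (v + w) x - right_deriv f v x - right_deriv f w x"
    using Qlim[of v] Qlim[of w] Qlim[of "v + w"]
  proof eventually_elim
    fix x
    assume "(\<lambda>n. Q v n x) \<longlonglongrightarrow> right_deriv f v x" "(\<lambda>n. Q w n x) \<longlonglongrightarrow> right_deriv f w x"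
      "(\<lambda>n. Q (v + w) n x) \<longlonglongrightarrow> right_deriv f (v + w) x"
    then have l: "(\<lambda>n. \<Delta> n x) \<longlonglongrightarrow> right_deriv f (v + w) x - right_deriv f v x - right_deriv f w x"
      unfolding \<Delta> by (intro tendsto_diff)
    then have "g x = right_deriv f (v + w) x - right_deriv f v x - right_deriv f w x"
      unfolding g_def using limI[OF l] by (auto simp: convergent_def)
    then show "(\<lambda>n. \<Delta> n x) \<longlonglongrightarrow> g x \<and> g x = right_deriv f (v + w) x - right_deriv f v x - right_deriv f w x"
      using l by simp
  qed
  have "AE x in lborel. g x = 0"
  proof (rule AE_zero_if_compact_integrals_zero[OF g gb])
    fix K :: "'a set" assume K: "compact K"
    have [measurable]: "K \<in> sets borel" using K by (simp add: borel_compact)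
    obtain R where R: "\<And>x. x \<in> K \<Longrightarrow> norm x \<le> R"
      using compact_imp_bounded[OF K] by (auto simp: bounded_iff)
    have 1: "(\<lambda>n. LBINT x. indicator K x * \<Delta> n x) \<longlonglongrightarrow> (LBINT x. indicator K x * g x)"
    proof (rule integral_dominated_bounded_support)
      show "\<bar>indicator K x * \<Delta> n x\<bar> \<le> 2 * (L * norm w)" for n x
        using \<Delta>b[of n x] L by (auto simp: indicator_def)
      show "indicator K x * \<Delta> n x = 0" if "norm x > R" for n x
        using R[of x] that by (auto simp: indicator_def)
      show "AE x in lborel. (\<lambda>n. indicator K x * \<Delta> n x) \<longlonglongrightarrow> indicator K x * g x"
        using glim by eventually_elim (rule tendsto_mult_left, erule conjunct1)
    qed measurable
    let ?k = "\<lambda>n x. indicator K (x + \<delta> n *\<^sub>R (- v)) - indicator K x :: real"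
    have bound: "\<bar>LBINT x. indicator K x * \<Delta> n x\<bar>
        \<le> (L * norm w) * (LBINT x. \<bar>?k n x\<bar>)" for n
    proof -
      have iK: "integrable lborel (indicator K :: 'a \<Rightarrow> real)"
        using emeasure_compact_finite[OF K] by (auto simp: less_top)
      have iK': "integrable lborel (\<lambda>x. indicator K (x + c) :: real)" for c
        by (rule integrable_lborel_translate[OF _ iK]) measurable
      have i1: "integrable lborel (\<lambda>x. h x * Q w n x)" if "integrable lborel h" for h :: "'a \<Rightarrow> real"
        by (rule Bochner_Integration.integrable_bound[where f="\<lambda>x. h x * (L * norm w)"])
          (use that Qb[of w n] L in \<open>auto simp: abs_mult intro!: mult_left_mono\<close>)
      have i2: "integrable lborel (\<lambda>x. indicator K x * Q w n (x + \<delta> n *\<^sub>R v))"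
        using integrable_lborel_translate[OF _ i1[OF iK'[of "- (\<delta> n *\<^sub>R v)"]], of "\<delta> n *\<^sub>R v"]
        by simp
      have "(LBINT x. indicator K x * \<Delta> n x)
          = (LBINT x. indicator K x * Q w n (x + \<delta> n *\<^sub>R v)) - (LBINT x. indicator K x * Q w n x)"
        unfolding \<Delta>_def right_diff_distrib by (rule Bochner_Integration.integral_diff[OF i2 i1[OF iK]])
      also have "(LBINT x. indicator K x * Q w n (x + \<delta> n *\<^sub>R v))
          = (LBINT x. indicator K (x + \<delta> n *\<^sub>R (- v)) * Q w n x)"
        using integral_lborel_translate[of "\<lambda>x. indicator K (x + \<delta> n *\<^sub>R (- v)) * Q w n x" "\<delta> n *\<^sub>R v"] by simp
      also have "\<dots> - (LBINT x. indicator K x * Q w n x)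
          = (LBINT x. (?k n x) * Q w n x)"
        using i1[OF iK] i1[OF iK'[of "\<delta> n *\<^sub>R (- v)"]]
        by (subst Bochner_Integration.integral_diff[symmetric]) (auto simp: left_diff_distrib)
      finally have "\<bar>LBINT x. indicator K x * \<Delta> n x\<bar>
          \<le> (LBINT x. \<bar>(?k n x) * Q w n x\<bar>)"
        by (simp only: integral_abs_bound)
      also have "\<dots> \<le> (LBINT x. (L * norm w) * \<bar>?k n x\<bar>)"
      proof (rule integral_mono)
        show "integrable lborel (\<lambda>x. \<bar>(?k n x) * Q w n x\<bar>)"
          by (intro integrable_abs i1 Bochner_Integration.integrable_diff iK iK')
        show "integrable lborel (\<lambda>x. (L * norm w) * \<bar>?k n x\<bar>)"
          by (intro integrable_mult_right integrable_abs Bochner_Integration.integrable_diff iK iK')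
        fix x
        show "\<bar>(?k n x) * Q w n x\<bar>
            \<le> (L * norm w) * \<bar>?k n x\<bar>"
          using mult_left_mono[OF Qb[of w n x], of "\<bar>?k n x\<bar>"]
          by (simp add: abs_mult mult.commute)
      qed
      finally show ?thesis by simp
    qed
    have "(\<lambda>n. (L * norm w) * (LBINT x. \<bar>?k n x\<bar>)) \<longlonglongrightarrow> (L * norm w) * 0"
      by (intro tendsto_mult_left tendsto_integral_translate_compact[OF K] \<delta>0)
    then have "(\<lambda>n. (L * norm w) * (LBINT x. \<bar>?k n x\<bar>)) \<longlonglongrightarrow> 0"
      by (simp only: mult_zero_right)
    then have "(\<lambda>n. LBINT x. indicator K x * \<Delta> n x) \<longlonglongrightarrow> 0"
      by (rule Lim_null_comparison[rotated]) (simp only: real_norm_def bound eventually_True)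
    with 1 show "(LBINT x. indicator K x * g x) = 0" by (rule LIMSEQ_unique)
  qed
  with glim show ?thesis by eventually_elim simp
qed

lemma right_deriv_scaleR_AE:
  fixes f :: "'a::euclidean_space \<Rightarrow> real"
  assumes lip: "L-lipschitz_on UNIV f"
  shows "AE x in lborel. right_deriv f (c *\<^sub>R v) x = c * right_deriv f v x"
proof -
  have pos: "AE x in lborel. right_deriv f (c *\<^sub>R v) x = c * right_deriv f v x" if "c > 0" for c and v :: 'a
    using tendsto_right_deriv_AE[OF lip, of v]
  proof eventually_elim
    fix x assume l: "((\<lambda>s. (f (x + s *\<^sub>R v) - f x) / s) \<longlongrightarrow> right_deriv f v x) (at_right 0)"
    have "filterlim (\<lambda>s. s * c) (at_right 0) (at_right (0::real))"
      using \<open>c > 0\<close> by real_asymp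
    from tendsto_mult_left[OF filterlim_compose[OF l this], of c]
    have "((\<lambda>s. (f (x + s *\<^sub>R (c *\<^sub>R v)) - f x) / s) \<longlongrightarrow> c * right_deriv f v x) (at_right 0)"
      using \<open>c > 0\<close> by simp
    then show "right_deriv f (c *\<^sub>R v) x = c * right_deriv f v x" by (rule right_deriv_eq)
  qed
  have zero: "right_deriv f 0 x = 0" for x by (rule right_deriv_eq) simp
  consider "c > 0" | "c = 0" | "c < 0" by linarith
  then show ?thesis
  proof cases
    case 1 then show ?thesis by (rule pos)
  next
    case 2 then show ?thesis by (simp add: zero)
  next
    case 3
    then have "0 < - c" by simp
    from pos[OF this, of v] right_deriv_add_AE[OF lip, of "c *\<^sub>R v" "(- c) *\<^sub>R v"]
    show ?thesis by eventually_elim (simp add: zero)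
  qed
qed

lemma right_deriv_linear_AE:
  fixes f :: "'a::euclidean_space \<Rightarrow> real"
  assumes lip: "L-lipschitz_on UNIV f"
  shows "AE x in lborel. right_deriv f v x = v \<bullet> right_grad f x"
proof -
  have zero: "right_deriv f 0 x = 0" for x by (rule right_deriv_eq) simp
  have "AE x in lborel. right_deriv f (\<Sum>i\<in>S. (v \<bullet> i) *\<^sub>R i) x = (\<Sum>i\<in>S. (v \<bullet> i) * right_deriv f i x)"
    if "finite S" for S
    using that
  proof (induction S)
    case (insert j S)
    show ?case
      using insert.IH right_deriv_add_AE[OF lip, of "(v \<bullet> j) *\<^sub>R j" "\<Sum>i\<in>S. (v \<bullet> i) *\<^sub>R i"]
        right_deriv_scaleR_AE[OF lip, of "v \<bullet> j" j]
      by eventually_elim (use insert.hyps in simp)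
  qed (simp add: zero)
  from this[OF finite_Basis] show ?thesis
    by eventually_elim (simp add: euclidean_representation inner_sum_right mult.commute)
qed

text \<open>At almost every point the right derivatives in all directions of a countable dense set exist and are given by one
  vector.  A finite subset that is dense enough on the unit sphere approximates every increment, and the Lipschitz
  bound controls the error made by replacing the direction.\<close>

theorem rademacher:
  fixes f :: "'a::euclidean_space \<Rightarrow> real"
  assumes lip: "L-lipschitz_on UNIV f"
  shows "AE x in lborel. GDERIV f x :> right_grad f x"
proof -
  have L: "0 \<le> L" by (rule lipschitz_on_nonneg[OF lip])
  have lip': "\<bar>f y - f x\<bar> \<le> L * norm (y - x)" for x y
    using lipschitz_onD[OF lip, of y x] by (simp add: dist_norm dist_real_def)
  obtain W :: "'a set" where W: "countable W" "\<And>X. open X \<Longrightarrow> X \<noteq> {} \<Longrightarrow> \<exists>d\<in>W. d \<in> X"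
    by (rule countable_dense_setE) blast
  have "AE x in lborel. \<forall>v\<in>W. ((\<lambda>s. (f (x + s *\<^sub>R v) - f x) / s) \<longlongrightarrow> v \<bullet> right_grad f x) (at_right 0)"
    unfolding AE_ball_countable[OF W(1)]
  proof
    fix v
    show "AE x in lborel. ((\<lambda>s. (f (x + s *\<^sub>R v) - f x) / s) \<longlongrightarrow> v \<bullet> right_grad f x) (at_right 0)"
      using tendsto_right_deriv_AE[OF lip, of v] right_deriv_linear_AE[OF lip, of v]
      by eventually_elim simp
  qed
  then show ?thesis
  proof eventually_elim
    fix x
    define g where "g = right_grad f x"
    assume "\<forall>v\<in>W. ((\<lambda>s. (f (x + s *\<^sub>R v) - f x) / s) \<longlongrightarrow> v \<bullet> right_grad f x) (at_right 0)"
    then have lim: "((\<lambda>s. (f (x + s *\<^sub>R v) - f x) / s) \<longlongrightarrow> v \<bullet> g) (at_right 0)" if "v \<in> W" for v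
      using that by (simp add: g_def)
    have "(f has_derivative (\<lambda>h. h \<bullet> g)) (at x)"
      unfolding has_derivative_at_alt
    proof (intro conjI allI impI)
      show "bounded_linear (\<lambda>h. h \<bullet> g)" by (rule bounded_linear_inner_left)
      fix e :: real assume "e > 0"
      \<comment> \<open>Replacing a unit direction by one at distance \<open>\<eta>\<close> costs at most \<open>(L + |g|) \<eta>\<close>; the summand one keeps the divisor positive.\<close>
      define D where "D = L + norm g + 1"
      define \<eta> where "\<eta> = e / (2 * D)"
      have pos: "D > 0" using L norm_ge_zero[of g] unfolding D_def by linarith
      have \<eta>: "\<eta> > 0" using \<open>e > 0\<close> pos by (simp add: \<eta>_def)
      have "sphere (0::'a) 1 \<subseteq> (\<Union>v\<in>W. ball v \<eta>)"
      proof
        fix \<theta> :: 'a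
        obtain v where "v \<in> W" "v \<in> ball \<theta> \<eta>" using W(2)[of "ball \<theta> \<eta>"] \<eta> by auto
        then show "\<theta> \<in> (\<Union>v\<in>W. ball v \<eta>)" by (auto simp: dist_commute)
      qed
      then obtain V where V: "V \<subseteq> W" "finite V" "sphere (0::'a) 1 \<subseteq> (\<Union>v\<in>V. ball v \<eta>)"
        using compactE_image[OF compact_sphere, of W "\<lambda>v. ball v \<eta>" 0 1] by (metis open_ball)
      have "eventually (\<lambda>s. \<forall>v\<in>V. \<bar>(f (x + s *\<^sub>R v) - f x) / s - v \<bullet> g\<bar> < e / 2) (at_right 0)"
      proof (rule eventually_ball_finite[OF V(2)], rule ballI)
        fix v assume "v \<in> V"
        then show "eventually (\<lambda>s. \<bar>(f (x + s *\<^sub>R v) - f x) / s - v \<bullet> g\<bar> < e / 2) (at_right 0)"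
          using tendstoD[OF lim[of v], of "e / 2"] V(1) \<open>e > 0\<close> by (auto simp: dist_real_def)
      qed
      then obtain d where d: "d > 0"
        "\<And>s v. 0 < s \<Longrightarrow> s < d \<Longrightarrow> v \<in> V \<Longrightarrow> \<bar>(f (x + s *\<^sub>R v) - f x) / s - v \<bullet> g\<bar> < e / 2"
        unfolding eventually_at_right_field by (auto simp: )
      show "\<exists>d>0. \<forall>y. norm (y - x) < d \<longrightarrow> norm (f y - f x - (y - x) \<bullet> g) \<le> e * norm (y - x)"
      proof (intro exI conjI allI impI)
        show "d > 0" by fact
        fix y assume y: "norm (y - x) < d"
        show "norm (f y - f x - (y - x) \<bullet> g) \<le> e * norm (y - x)"
        proof (cases "y = x")
          case False
          define s where "s = norm (y - x)"
          define \<theta> where "\<theta> = (y - x) /\<^sub>R s"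
          have s: "s > 0" "s < d" using False y by (auto simp: s_def)
          have ys: "y = x + s *\<^sub>R \<theta>" using s by (simp add: \<theta>_def)
          have "\<theta> \<in> sphere 0 1" using s by (simp add: \<theta>_def s_def)
          then obtain v where v: "v \<in> V" "norm (\<theta> - v) < \<eta>"
            using V(3) by (auto simp: dist_norm norm_minus_commute)
          have a: "\<bar>f (x + s *\<^sub>R v) - f x - s * (v \<bullet> g)\<bar> \<le> s * (e / 2)"
          proof -
            have "f (x + s *\<^sub>R v) - f x - s * (v \<bullet> g) = s * ((f (x + s *\<^sub>R v) - f x) / s - v \<bullet> g)"
              using s by (simp add: field_simps)
            then show ?thesis using d(2)[OF s v(1)] s by (simp add: abs_mult)
          qed
          have b: "\<bar>f y - f (x + s *\<^sub>R v)\<bar> \<le> s * (L * \<eta>)"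
          proof -
            have "norm (y - (x + s *\<^sub>R v)) = s * norm (\<theta> - v)"
              using s by (simp add: ys flip: scaleR_diff_right)
            then have "\<bar>f y - f (x + s *\<^sub>R v)\<bar> \<le> L * (s * norm (\<theta> - v))" using lip'[of y "x + s *\<^sub>R v"] by simp
            also have "\<dots> \<le> L * (s * \<eta>)" using v L s by (intro mult_left_mono) auto
            finally show ?thesis by (simp add: mult_ac)
          qed
          have c: "\<bar>s * (v \<bullet> g) - (y - x) \<bullet> g\<bar> \<le> s * (norm g * \<eta>)"
          proof -
            have "s * (v \<bullet> g) - (y - x) \<bullet> g = s * ((v - \<theta>) \<bullet> g)"
              by (simp add: ys inner_diff_left right_diff_distrib)
            moreover have "\<bar>(v - \<theta>) \<bullet> g\<bar> \<le> norm (v - \<theta>) * norm g" by (rule Cauchy_Schwarz_ineq2)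
            moreover have "norm (v - \<theta>) * norm g \<le> \<eta> * norm g"
              using v by (intro mult_right_mono) (auto simp: norm_minus_commute)
            ultimately show ?thesis using s by (simp add: abs_mult mult.commute)
          qed
          have "L * \<eta> + norm g * \<eta> \<le> D * \<eta>" using \<eta> by (simp add: D_def algebra_simps)
          also have "\<dots> = e / 2" using pos by (simp add: \<eta>_def)
          finally have "s * (L * \<eta> + norm g * \<eta>) \<le> s * (e / 2)"
            using s by (intro mult_left_mono) auto
          then have "s * (L * \<eta>) + s * (norm g * \<eta>) \<le> s * (e / 2)" by (simp only: distrib_left)
          then have "\<bar>f y - f x - (y - x) \<bullet> g\<bar> \<le> s * (e / 2) + s * (e / 2)" using a b c by linarith
          also have "s * (e / 2) + s * (e / 2) = e * norm (y - x)" by (simp add: s_def)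
          finally show ?thesis by simp
        qed simp
      qed
    qed
    then show "GDERIV f x :> g" by (simp add: gderiv_def)
  qed
qed

section \<open>The divergence theorem below a Lipschitz graph\<close>

lemma slab_borel[measurable]: "slab e \<in> sets borel"
  unfolding slab_def by measurable

lemma nn_integral_slab_section:
  fixes e :: "'a::euclidean_space"
  assumes "norm e = 1"
  shows "(\<integral>\<^sup>+\<tau>. indicator (slab e) (y - \<tau> *\<^sub>R e) \<partial>lborel) = 1"
proof -
  have "e \<bullet> e = 1" using assms by (simp add: norm_eq_1)
  then have "(\<lambda>\<tau>. indicator (slab e) (y - \<tau> *\<^sub>R e) :: ennreal) = indicator {y \<bullet> e - 1..y \<bullet> e}"
    by (auto simp: fun_eq_iff slab_def indicator_def inner_diff_left)
  then show ?thesis by simp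
qed

text \<open>The same identity for nonnegative functions supplies the integrability that the signed version needs.\<close>

lemma nn_integral_slab:
  fixes \<phi> :: "'a::euclidean_space \<Rightarrow> ennreal"
  assumes e: "norm e = 1" and \<phi>[measurable]: "\<phi> \<in> borel_measurable borel"
  shows "(\<integral>\<^sup>+y. \<phi> y \<partial>lborel) = (\<integral>\<^sup>+x. indicator (slab e) x * (\<integral>\<^sup>+\<tau>. \<phi> (x + \<tau> *\<^sub>R e) \<partial>lborel) \<partial>lborel)"
proof -
  have "(\<integral>\<^sup>+y. \<phi> y \<partial>lborel) = (\<integral>\<^sup>+y. (\<integral>\<^sup>+\<tau>. \<phi> y * indicator (slab e) (y - \<tau> *\<^sub>R e) \<partial>lborel) \<partial>lborel)"
    by (simp add: nn_integral_cmult nn_integral_slab_section[OF e])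
  also have "\<dots> = (\<integral>\<^sup>+\<tau>. (\<integral>\<^sup>+y. \<phi> y * indicator (slab e) (y - \<tau> *\<^sub>R e) \<partial>lborel) \<partial>lborel)"
    by (rule lborel_pair.Fubini'[symmetric]) measurable
  also have "\<dots> = (\<integral>\<^sup>+\<tau>. (\<integral>\<^sup>+x. indicator (slab e) x * \<phi> (x + \<tau> *\<^sub>R e) \<partial>lborel) \<partial>lborel)"
  proof (rule nn_integral_cong)
    fix \<tau> :: real
    have "(\<integral>\<^sup>+y. \<phi> y * indicator (slab e) (y - \<tau> *\<^sub>R e) \<partial>lborel)
        = (\<integral>\<^sup>+y. \<phi> y * indicator (slab e) (y - \<tau> *\<^sub>R e) \<partial>distr lborel borel ((+) (\<tau> *\<^sub>R e)))"
      by (simp add: lborel_distr_plus)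
    also have "\<dots> = (\<integral>\<^sup>+x. indicator (slab e) x * \<phi> (x + \<tau> *\<^sub>R e) \<partial>lborel)"
      by (subst nn_integral_distr) (auto simp: add.commute mult.commute)
    finally show "(\<integral>\<^sup>+y. \<phi> y * indicator (slab e) (y - \<tau> *\<^sub>R e) \<partial>lborel)
        = (\<integral>\<^sup>+x. indicator (slab e) x * \<phi> (x + \<tau> *\<^sub>R e) \<partial>lborel)" .
  qed
  also have "\<dots> = (\<integral>\<^sup>+x. (\<integral>\<^sup>+\<tau>. indicator (slab e) x * \<phi> (x + \<tau> *\<^sub>R e) \<partial>lborel) \<partial>lborel)"
    by (rule lborel_pair.Fubini') measurable
  finally show ?thesis by (simp add: nn_integral_cmult)
qed

text \<open>Every line in direction \<open>e\<close> meets the slab in a segment of length one; inserting this factor and translating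
  gives Fubini's theorem along \<open>e\<close>, with the slab in the role of the hyperplane orthogonal to \<open>e\<close>.\<close>

lemma integral_slab:
  fixes \<phi> :: "'a::euclidean_space \<Rightarrow> real"
  assumes e: "norm e = 1" and \<phi>[measurable]: "\<phi> \<in> borel_measurable borel" and int: "integrable lborel \<phi>"
  shows "(LBINT y. \<phi> y) = (LBINT x. indicator (slab e) x * (LBINT \<tau>. \<phi> (x + \<tau> *\<^sub>R e)))"
proof -
  let ?P = "lborel \<Otimes>\<^sub>M lborel :: ('a \<times> real) measure"
  have fin: "(\<integral>\<^sup>+y. ennreal \<bar>\<phi> y\<bar> \<partial>lborel) < \<infinity>" using int by (simp add: integrable_iff_bounded)
  have i1: "integrable ?P (\<lambda>(y, \<tau>). \<phi> y * indicator (slab e) (y - \<tau> *\<^sub>R e))"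
  proof (rule integrableI_bounded)
    have "(\<integral>\<^sup>+p. ennreal (norm (case p of (y, \<tau>) \<Rightarrow> \<phi> y * indicator (slab e) (y - \<tau> *\<^sub>R e))) \<partial>?P)
        = (\<integral>\<^sup>+y. (\<integral>\<^sup>+\<tau>. ennreal \<bar>\<phi> y\<bar> * indicator (slab e) (y - \<tau> *\<^sub>R e) \<partial>lborel) \<partial>lborel)"
      by (subst lborel.nn_integral_fst[symmetric])
        (auto intro!: nn_integral_cong simp: indicator_def)
    also have "\<dots> = (\<integral>\<^sup>+y. ennreal \<bar>\<phi> y\<bar> \<partial>lborel)"
      by (simp add: nn_integral_cmult nn_integral_slab_section[OF e])
    finally show "(\<integral>\<^sup>+p. ennreal (norm (case p of (y, \<tau>) \<Rightarrow> \<phi> y * indicator (slab e) (y - \<tau> *\<^sub>R e))) \<partial>?P) < \<infinity>"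
      using fin by simp
  qed measurable
  have i2: "integrable ?P (\<lambda>(x, \<tau>). indicator (slab e) x * \<phi> (x + \<tau> *\<^sub>R e))"
  proof (rule integrableI_bounded)
    have "(\<integral>\<^sup>+p. ennreal (norm (case p of (x, \<tau>) \<Rightarrow> indicator (slab e) x * \<phi> (x + \<tau> *\<^sub>R e))) \<partial>?P)
        = (\<integral>\<^sup>+x. (\<integral>\<^sup>+\<tau>. indicator (slab e) x * ennreal \<bar>\<phi> (x + \<tau> *\<^sub>R e)\<bar> \<partial>lborel) \<partial>lborel)"
      by (subst lborel.nn_integral_fst[symmetric])
        (auto intro!: nn_integral_cong simp: indicator_def)
    also have "\<dots> = (\<integral>\<^sup>+y. ennreal \<bar>\<phi> y\<bar> \<partial>lborel)"
      by (subst nn_integral_slab[OF e]) (simp_all add: nn_integral_cmult)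
    finally show "(\<integral>\<^sup>+p. ennreal (norm (case p of (x, \<tau>) \<Rightarrow> indicator (slab e) x * \<phi> (x + \<tau> *\<^sub>R e))) \<partial>?P) < \<infinity>"
      using fin by simp
  qed measurable
  have one: "(LBINT \<tau>. indicator (slab e) (y - \<tau> *\<^sub>R e)) = (1::real)" for y
  proof -
    have "e \<bullet> e = 1" using e by (simp add: norm_eq_1)
    then have "(\<lambda>\<tau>. indicator (slab e) (y - \<tau> *\<^sub>R e) :: real) = indicator {y \<bullet> e - 1..y \<bullet> e}"
      by (auto simp: fun_eq_iff slab_def indicator_def inner_diff_left)
    then show ?thesis by simp
  qed
  have "(LBINT y. \<phi> y) = (LBINT y. (LBINT \<tau>. \<phi> y * indicator (slab e) (y - \<tau> *\<^sub>R e)))"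
    by (simp add: one)
  also have "\<dots> = (LBINT \<tau>. (LBINT y. \<phi> y * indicator (slab e) (y - \<tau> *\<^sub>R e)))"
    by (rule lborel_pair.Fubini_integral[OF i1, symmetric])
  also have "\<dots> = (LBINT \<tau>. (LBINT x. indicator (slab e) x * \<phi> (x + \<tau> *\<^sub>R e)))"
  proof (rule Bochner_Integration.integral_cong[OF refl])
    fix \<tau> :: real
    show "(LBINT y. \<phi> y * indicator (slab e) (y - \<tau> *\<^sub>R e))
        = (LBINT x. indicator (slab e) x * \<phi> (x + \<tau> *\<^sub>R e))"
      using integral_lborel_translate[of "\<lambda>y. \<phi> y * indicator (slab e) (y - \<tau> *\<^sub>R e)" "\<tau> *\<^sub>R e"]
      by (simp add: mult.commute)
  qed
  also have "\<dots> = (LBINT x. (LBINT \<tau>. indicator (slab e) x * \<phi> (x + \<tau> *\<^sub>R e)))"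
    by (rule lborel_pair.Fubini_integral[OF i2])
  finally show ?thesis by simp
qed

text \<open>The region below the graph need not be convex, but two of its points are joined inside it by going down,
  across and up, with a detour proportional to their distance.\<close>

lemma lipschitz_below_graph:
  fixes f :: "'a::euclidean_space \<Rightarrow> real"
  assumes e: "norm e = 1" and lip: "L-lipschitz_on UNIV \<gamma>" and inv: "\<And>x s. \<gamma> (x + s *\<^sub>R e) = \<gamma> x"
    and cont: "continuous_on {x. x \<bullet> e \<le> \<gamma> x} f"
    and der: "\<And>x. x \<bullet> e < \<gamma> x \<Longrightarrow> (f has_derivative f' x) (at x)"
    and bd: "\<And>x h. x \<bullet> e < \<gamma> x \<Longrightarrow> \<bar>f' x h\<bar> \<le> B * norm h" and "0 \<le> B"
  shows "(B * (2 * L + 3))-lipschitz_on {x. x \<bullet> e \<le> \<gamma> x} f"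
proof -
  let ?D = "{x. x \<bullet> e < \<gamma> x}" and ?E = "{x. x \<bullet> e \<le> \<gamma> x}"
  have L: "0 \<le> L" by (rule lipschitz_on_nonneg[OF lip])
  have ee: "e \<bullet> e = 1" using e by (simp add: norm_eq_1)
  have lip': "\<bar>\<gamma> y - \<gamma> x\<bar> \<le> L * norm (y - x)" for x y
    using lipschitz_onD[OF lip, of y x] by (simp add: dist_norm dist_real_def)
  have inv': "\<gamma> (x - s *\<^sub>R e) = \<gamma> x" for x s using inv[of x "- s"] by simp
  have seg: "\<bar>f x - f y\<bar> \<le> B * norm (x - y)" if "closed_segment x y \<subseteq> ?D" for x y
  proof -
    have "norm (f x - f y) \<le> B * norm (x - y)"
    proof (rule differentiable_bound[OF convex_closed_segment])
      fix z assume "z \<in> closed_segment x y"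
      then have z: "z \<bullet> e < \<gamma> z" using that by blast
      then show "(f has_derivative f' z) (at z within closed_segment x y)"
        using der has_derivative_at_withinI by blast
      show "onorm (f' z) \<le> B" using bd[OF z] by (intro onorm_le) simp
    qed auto
    then show ?thesis by simp
  qed
  have lipD: "(B * (2 * L + 3))-lipschitz_on ?D f"
  proof (rule lipschitz_onI)
    fix x y assume "x \<in> ?D" "y \<in> ?D"
    then have xy: "x \<bullet> e < \<gamma> x" "y \<bullet> e < \<gamma> y" by auto
    \<comment> \<open>Deep enough that the horizontal segment stays below the graph, however it rises.\<close>
    define t where "t = (L + 1) * norm (x - y)"
    have t: "t \<ge> 0" using L by (simp add: t_def)
    have down: "closed_segment z (z - t *\<^sub>R e) \<subseteq> ?D" if "z \<bullet> e < \<gamma> z" for z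
    proof
      fix p assume "p \<in> closed_segment z (z - t *\<^sub>R e)"
      then obtain u where u: "0 \<le> u" "p = z - (u * t) *\<^sub>R e"
        by (auto simp: in_segment algebra_simps)
      have "0 \<le> u * t" using u t by simp
      then show "p \<in> ?D" using that inv'[of z "u * t"] by (simp add: u inner_diff_left ee del: mult_nonneg_nonneg)
    qed
    have across: "closed_segment (x - t *\<^sub>R e) (y - t *\<^sub>R e) \<subseteq> ?D"
    proof
      fix p assume "p \<in> closed_segment (x - t *\<^sub>R e) (y - t *\<^sub>R e)"
      then obtain u where u: "0 \<le> u" "u \<le> 1" "p = (x + u *\<^sub>R (y - x)) - t *\<^sub>R e"
        by (auto simp: in_segment algebra_simps)
      define z where "z = x + u *\<^sub>R (y - x)"
      have zn: "norm (z - x) \<le> norm (x - y)"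
        using u mult_right_mono[of u 1 "norm (y - x)"] by (simp add: z_def norm_minus_commute)
      have "\<gamma> z \<ge> \<gamma> x - L * norm (x - y)"
        using lip'[of z x] mult_left_mono[OF zn L] by (simp add: abs_le_iff)
      moreover have "z \<bullet> e \<le> x \<bullet> e + norm (x - y)"
        using Cauchy_Schwarz_ineq2[of "z - x" e] zn e by (simp add: inner_diff_left abs_le_iff)
      moreover have "p \<bullet> e = z \<bullet> e - t" "\<gamma> p = \<gamma> z"
        using inv'[of z t] by (simp_all add: u z_def inner_diff_left ee)
      ultimately show "p \<in> ?D" using xy by (simp add: t_def algebra_simps)
    qed
    have "\<bar>f x - f y\<bar> \<le> \<bar>f x - f (x - t *\<^sub>R e)\<bar> + \<bar>f (x - t *\<^sub>R e) - f (y - t *\<^sub>R e)\<bar> + \<bar>f y - f (y - t *\<^sub>R e)\<bar>"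
      by linarith
    also have "\<dots> \<le> B * t + B * norm (x - y) + B * t"
      using seg[OF down[OF xy(1)]] seg[OF down[OF xy(2)]] seg[OF across] t e by simp
    also have "\<dots> = B * (2 * L + 3) * norm (x - y)" by (simp add: t_def algebra_simps)
    finally show "dist (f x) (f y) \<le> B * (2 * L + 3) * dist x y" by (simp add: dist_norm)
  qed (use L \<open>0 \<le> B\<close> in simp)
  have c\<gamma>: "continuous_on UNIV \<gamma>" by (rule lipschitz_on_continuous_on[OF lip])
  have "closed ?E" by (intro closed_Collect_le continuous_intros c\<gamma>)
  then have "closure ?D \<subseteq> ?E" by (intro closure_minimal) auto
  moreover have "?E \<subseteq> closure ?D"
  proof
    fix x assume "x \<in> ?E"
    show "x \<in> closure ?D"
      unfolding closure_approachable
    proof (intro allI impI)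
      fix \<epsilon> :: real assume "\<epsilon> > 0"
      then show "\<exists>y\<in>?D. dist y x < \<epsilon>"
        using \<open>x \<in> ?E\<close> inv'[of x "\<epsilon>/2"] e
        by (intro bexI[of _ "x - (\<epsilon>/2) *\<^sub>R e"]) (auto simp: dist_norm inner_diff_left ee)
    qed
  qed
  ultimately have "closure ?D = ?E" by blast
  then show ?thesis using lipschitz_on_closure[OF lipD] cont by simp
qed

lemma integral_between:
  fixes g :: "real \<Rightarrow> real"
  assumes lip: "C-lipschitz_on UNIV g"
  shows "\<bar>(LBINT \<tau>. (indicator {..<b} \<tau> - indicator {..<a} \<tau>) * g \<tau>) - g a * (b - a)\<bar> \<le> C * (b - a)\<^sup>2"
proof -
  have C: "0 \<le> C" by (rule lipschitz_on_nonneg[OF lip])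
  have cont: "continuous_on UNIV g" by (rule lipschitz_on_continuous_on[OF lip])
  have [measurable]: "g \<in> borel_measurable borel" by (rule borel_measurable_continuous_onI[OF cont])
  define s :: "real \<Rightarrow> real" where "s \<tau> = indicator {..<b} \<tau> - indicator {..<a} \<tau>" for \<tau>
  have s: "s \<tau> = indicator {a..<b} \<tau> - indicator {b..<a} \<tau>" for \<tau>
    by (auto simp: s_def indicator_def)
  have [measurable]: "s \<in> borel_measurable borel" unfolding s_def by measurable
  have sabs: "\<bar>s \<tau>\<bar> = indicator {min a b..<max a b} \<tau>" for \<tau>
    by (auto simp: s indicator_def)
  have "integrable lborel s \<and> (LBINT \<tau>. s \<tau>) = b - a"
  proof (cases "a \<le> b")
    case True
    then have "s = indicator {a..<b}" by (simp add: s fun_eq_iff)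
    with True show ?thesis by simp
  next
    case False
    then have "s = (\<lambda>\<tau>. - indicator {b..<a} \<tau>)" by (simp add: s fun_eq_iff)
    with False show ?thesis by simp
  qed
  then have s_int: "integrable lborel s" and Is: "(LBINT \<tau>. s \<tau>) = b - a" by auto
  have gb: "\<bar>s \<tau> * (g \<tau> - g a)\<bar> \<le> indicator {min a b..<max a b} \<tau> * (C * \<bar>b - a\<bar>)" for \<tau>
  proof (cases "\<tau> \<in> {min a b..<max a b}")
    case True
    have "\<bar>g \<tau> - g a\<bar> \<le> C * \<bar>\<tau> - a\<bar>" using lipschitz_onD[OF lip, of \<tau> a] by (simp add: dist_real_def)
    also have "\<dots> \<le> C * \<bar>b - a\<bar>" using True C by (intro mult_left_mono) auto
    finally show ?thesis using True by (simp add: abs_mult sabs)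
  next
    case False
    then show ?thesis using sabs[of \<tau>] by simp
  qed
  have ib: "integrable lborel (\<lambda>\<tau>. indicator {min a b..<max a b} \<tau> * (C * \<bar>b - a\<bar>))"
    by (simp add: not_le)
  have ig: "integrable lborel (\<lambda>\<tau>. s \<tau> * (g \<tau> - g a))"
    by (rule Bochner_Integration.integrable_bound[OF ib]) (use gb C in \<open>auto simp: abs_mult\<close>)
  have "(LBINT \<tau>. s \<tau> * g \<tau>) = (LBINT \<tau>. s \<tau> * (g \<tau> - g a) + g a * s \<tau>)"
    by (simp add: algebra_simps)
  also have "\<dots> = (LBINT \<tau>. s \<tau> * (g \<tau> - g a)) + g a * (b - a)"
    using ig s_int Is by simp
  finally have "\<bar>(LBINT \<tau>. s \<tau> * g \<tau>) - g a * (b - a)\<bar> = \<bar>LBINT \<tau>. s \<tau> * (g \<tau> - g a)\<bar>" by simp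
  also have "\<dots> \<le> (LBINT \<tau>. \<bar>s \<tau> * (g \<tau> - g a)\<bar>)" by (rule integral_abs_bound)
  also have "\<dots> \<le> (LBINT \<tau>. indicator {min a b..<max a b} \<tau> * (C * \<bar>b - a\<bar>))"
    by (rule integral_mono[OF integrable_abs[OF ig] ib gb])
  also have "\<dots> = C * (b - a)\<^sup>2" by (auto simp: power2_eq_square max_def min_def algebra_simps)
  finally show ?thesis by (simp add: s_def)
qed

lemma difference_quotient_tendsto:
  fixes F :: "'a::real_normed_vector \<Rightarrow> real"
  assumes F: "(F has_derivative F') (at x)" and d: "d \<longlonglongrightarrow> 0" "\<And>n. d n \<noteq> 0"
  shows "(\<lambda>n. (F (x + d n *\<^sub>R v) - F x) / d n) \<longlonglongrightarrow> F' v"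
proof -
  have "((\<lambda>s. F (x + s *\<^sub>R v)) has_derivative (\<lambda>s. F' (s *\<^sub>R v))) (at 0)"
    by (rule has_derivative_compose[where g = F and g' = F' and f = "\<lambda>s. x + s *\<^sub>R v", simplified])
      (use F in \<open>auto intro!: derivative_eq_intros\<close>)
  moreover have "F' (s *\<^sub>R v) = F' v * s" for s
    using linear_scale[OF has_derivative_linear[OF F]] by simp
  ultimately have "((\<lambda>s. F (x + s *\<^sub>R v)) has_real_derivative F' v) (at 0)"
    by (simp add: has_field_derivative_def fun_eq_iff)
  then have "((\<lambda>s. (F (x + s *\<^sub>R v) - F x) / s) \<longlongrightarrow> F' v) (at 0)"
    by (simp add: has_field_derivative_iff)
  from filterlim_compose[OF this, of d sequentially] show ?thesis
    using d by (simp add: filterlim_at)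
qed

text \<open>Dominated convergence; the Lipschitz bound is the majorant.\<close>

lemma tendsto_integral_difference_quotient:
  fixes F :: "'a::euclidean_space \<Rightarrow> real"
  assumes A: "open A" and lip: "\<And>x y. \<bar>F x - F y\<bar> \<le> C * norm (x - y)" and "0 \<le> C"
    and der: "\<And>x. x \<in> A \<Longrightarrow> (F has_derivative f' x) (at x)"
    and d: "d \<longlonglongrightarrow> 0" "\<And>n. 0 < d n"
    and supp: "\<And>n x. x \<in> A \<Longrightarrow> norm x > R \<Longrightarrow> F (x + d n *\<^sub>R v) = F x"
  shows "(\<lambda>n. (LBINT x. indicator A x * (F (x + d n *\<^sub>R v) - F x)) / d n)
    \<longlonglongrightarrow> (LBINT x. indicator A x * f' x v)"
proof -
  have [measurable]: "A \<in> sets borel" using A by simp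
  have "continuous_on UNIV F"
    by (rule lipschitz_on_continuous_on[of C]) (auto intro!: lipschitz_onI simp: \<open>0 \<le> C\<close> dist_norm lip)
  then have [measurable]: "F \<in> borel_measurable borel" by (rule borel_measurable_continuous_onI)
  define q where "q n x = indicator A x * ((F (x + d n *\<^sub>R v) - F x) / d n)" for n x
  have q[measurable]: "q n \<in> borel_measurable borel" for n unfolding q_def by measurable
  have qlim: "(\<lambda>n. q n x) \<longlonglongrightarrow> indicator A x * f' x v" for x
  proof (cases "x \<in> A")
    case True
    have "d n \<noteq> 0" for n using d(2)[of n] by simp
    from difference_quotient_tendsto[OF der[OF True] d(1) this]
    show ?thesis using True by (simp add: q_def)
  qed (simp add: q_def)
  have "(\<lambda>n. LBINT x. q n x) \<longlonglongrightarrow> (LBINT x. indicator A x * f' x v)"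
  proof (rule integral_dominated_bounded_support(1)[OF q borel_measurable_LIMSEQ_real[OF qlim q]])
    fix n x
    have "\<bar>(F (x + d n *\<^sub>R v) - F x) / d n\<bar> \<le> C * norm v"
      using lip[of "x + d n *\<^sub>R v" x] d(2)[of n] by (simp add: field_simps)
    then show "\<bar>q n x\<bar> \<le> C * norm v" using \<open>0 \<le> C\<close> by (auto simp: q_def indicator_def)
    show "q n x = 0" if "norm x > R" using supp[of x n] that by (simp add: q_def indicator_def)
  qed (use qlim in auto)
  then show ?thesis by (simp add: q_def)
qed

abbreviation graph_point :: "'a::euclidean_space \<Rightarrow> ('a \<Rightarrow> real) \<Rightarrow> 'a \<Rightarrow> 'a" where
  "graph_point e \<gamma> x \<equiv> x + (\<gamma> x - x \<bullet> e) *\<^sub>R e"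

text \<open>Extend \<open>f\<close> above the graph constantly along \<open>e\<close>; the extension \<open>F\<close> is Lipschitz.  By translation, the
  integral over the region of the difference quotient of \<open>F\<close> in direction \<open>v\<close> is the signed integral of \<open>F\<close> over the layer
  between the region and its translate by \<open>s v\<close>, divided by \<open>s\<close>.
  On the line through \<open>x\<close> in direction \<open>e\<close>, the layer is an interval with one end on the graph and length
  \<open>s (v \<bullet> e) + \<gamma> (x - s v) - \<gamma> x\<close>, and \<open>F\<close> differs there from its value on the graph by \<open>O(s)\<close>.  Fubini's
  theorem along \<open>e\<close> and dominated convergence give the integral over the slab.\<close>

theorem divergence_theorem_below_graph:
  fixes f :: "'a::euclidean_space \<Rightarrow> real"
  assumes e: "norm e = 1" and lip: "L-lipschitz_on UNIV \<gamma>" and inv: "\<And>x s. \<gamma> (x + s *\<^sub>R e) = \<gamma> x"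
    and cont: "continuous_on {x. x \<bullet> e \<le> \<gamma> x} f"
    and der: "\<And>x. x \<bullet> e < \<gamma> x \<Longrightarrow> (f has_derivative f' x) (at x)"
    and bd: "\<And>x h. x \<bullet> e < \<gamma> x \<Longrightarrow> \<bar>f' x h\<bar> \<le> B * norm h"
    and supp: "\<And>x. x \<bullet> e \<le> \<gamma> x \<Longrightarrow> norm x > R \<Longrightarrow> f x = 0"
  shows "integrable lborel (\<lambda>x. indicator (slab e) x * (f (graph_point e \<gamma> x) * (v \<bullet> (e - right_grad \<gamma> x))))"
    and "(LBINT x. indicator {x. x \<bullet> e < \<gamma> x} x * f' x v)
      = (LBINT x. indicator (slab e) x * (f (graph_point e \<gamma> x) * (v \<bullet> (e - right_grad \<gamma> x))))"
proof -
  let ?S = "\<lambda>x. indicator (slab e) x * (f (graph_point e \<gamma> x) * (v \<bullet> (e - right_grad \<gamma> x))) :: real"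
  let ?D = "{x. x \<bullet> e < \<gamma> x}" and ?E = "{x. x \<bullet> e \<le> \<gamma> x}"
  define B' where "B' = \<bar>B\<bar>"
  have bd': "\<bar>f' x h\<bar> \<le> B' * norm h" if "x \<bullet> e < \<gamma> x" for x h
    using bd[OF that, of h] mult_right_mono[of B B' "norm h", OF _ norm_ge_zero] abs_ge_self[of B]
    unfolding B'_def by linarith
  have L: "0 \<le> L" by (rule lipschitz_on_nonneg[OF lip])
  have ee: "e \<bullet> e = 1" using e by (simp add: norm_eq_1)
  have lip': "\<bar>\<gamma> y - \<gamma> x\<bar> \<le> L * norm (y - x)" for x y
    using lipschitz_onD[OF lip, of y x] by (simp add: dist_norm dist_real_def)
  have c\<gamma>: "continuous_on UNIV \<gamma>" by (rule lipschitz_on_continuous_on[OF lip])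
  have oD: "open ?D" by (intro open_Collect_less continuous_intros c\<gamma>)
  have [measurable]: "?D \<in> sets borel" using oD by simp
  \<comment> \<open>The projection onto the closed region below the graph, along \<open>e\<close>.\<close>
  define \<pi> where "\<pi> x = x + min 0 (\<gamma> x - x \<bullet> e) *\<^sub>R e" for x
  define F where "F x = f (\<pi> x)" for x
  have \<pi>E: "\<pi> x \<in> ?E" for x
    using inv[of x "min 0 (\<gamma> x - x \<bullet> e)"] by (auto simp: \<pi>_def inner_add_left ee)
  have \<pi>id: "\<pi> x = x" if "x \<bullet> e \<le> \<gamma> x" for x using that by (simp add: \<pi>_def)
  have \<pi>lip: "norm (\<pi> x - \<pi> y) \<le> (L + 2) * norm (x - y)" for x y
  proof -
    have "\<bar>min 0 (\<gamma> x - x \<bullet> e) - min 0 (\<gamma> y - y \<bullet> e)\<bar> \<le> \<bar>\<gamma> x - \<gamma> y\<bar> + \<bar>(x - y) \<bullet> e\<bar>"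
      by (auto simp: inner_diff_left min_def abs_if)
    also have "\<dots> \<le> L * norm (x - y) + norm (x - y)"
      using lip'[of x y] Cauchy_Schwarz_ineq2[of "x - y" e] e by simp
    finally have m: "\<bar>min 0 (\<gamma> x - x \<bullet> e) - min 0 (\<gamma> y - y \<bullet> e)\<bar> \<le> (L + 1) * norm (x - y)"
      by (simp add: algebra_simps)
    have "\<pi> x - \<pi> y = (x - y) + (min 0 (\<gamma> x - x \<bullet> e) - min 0 (\<gamma> y - y \<bullet> e)) *\<^sub>R e"
      by (simp add: \<pi>_def algebra_simps)
    also have "norm \<dots> \<le> norm (x - y) + \<bar>min 0 (\<gamma> x - x \<bullet> e) - min 0 (\<gamma> y - y \<bullet> e)\<bar>"
      by (metis e mult.right_neutral norm_scaleR norm_triangle_ineq)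
    finally show ?thesis using m by (simp add: algebra_simps)
  qed
  define C where "C = B' * (2 * L + 3) * (L + 2)"
  have C: "C \<ge> 0" using L by (simp add: C_def B'_def)
  have flip: "(B' * (2 * L + 3))-lipschitz_on ?E f"
    by (rule lipschitz_below_graph[OF e lip inv cont der bd']) (auto simp: B'_def)
  have Flip: "\<bar>F x - F y\<bar> \<le> C * norm (x - y)" for x y
  proof -
    have "\<bar>F x - F y\<bar> \<le> B' * (2 * L + 3) * norm (\<pi> x - \<pi> y)"
      using lipschitz_onD[OF flip \<pi>E[of x] \<pi>E[of y]] by (simp add: F_def dist_norm)
    also have "\<dots> \<le> B' * (2 * L + 3) * ((L + 2) * norm (x - y))"
      using L by (intro mult_left_mono \<pi>lip) (simp add: B'_def)
    finally show ?thesis by (simp add: C_def mult_ac)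
  qed
  have cF: "continuous_on UNIV F"
    by (rule lipschitz_on_continuous_on[of C]) (auto intro!: lipschitz_onI simp: C dist_norm Flip)
  have [measurable]: "F \<in> borel_measurable borel" by (rule borel_measurable_continuous_onI[OF cF])
  have FR: "norm (\<pi> x) \<le> R" if "F x \<noteq> 0" for x
    using supp[of "\<pi> x"] \<pi>E[of x] that by (force simp: F_def)
  obtain K where K: "\<And>x. \<bar>F x\<bar> \<le> K" "K \<ge> 0"
  proof -
    have "closed ?E" by (intro closed_Collect_le continuous_intros c\<gamma>)
    then have "compact (?E \<inter> cball 0 R)" by (simp add: closed_Int_compact)
    then have "compact (f ` (?E \<inter> cball 0 R))"
      by (intro compact_continuous_image continuous_on_subset[OF cont]) auto
    then obtain K where K: "\<And>x. x \<in> ?E \<inter> cball 0 R \<Longrightarrow> \<bar>f x\<bar> \<le> K"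
      using compact_imp_bounded bounded_iff by (metis (no_types, lifting) imageI real_norm_def)
    have "\<bar>F x\<bar> \<le> max 0 K" for x
    proof (cases "F x = 0")
      case False
      then show ?thesis using K[of "\<pi> x"] \<pi>E[of x] FR[of x] by (simp add: F_def)
    qed simp
    then show ?thesis by (intro that[of "max 0 K"]) auto
  qed
  define d where "d n = inverse (real (Suc n))" for n
  have d: "d n > 0" "d n \<le> 1" for n by (auto simp: d_def inverse_le_1_iff)
  have d0: "d \<longlonglongrightarrow> 0" unfolding d_def by (rule LIMSEQ_inverse_real_of_nat)
  define m where "m = (L + 2) * norm v"
  have m: "m \<ge> 0" using L by (simp add: m_def)
  have dist: "norm x \<le> R + m" if "x \<in> ?D" "F (x + d n *\<^sub>R v) \<noteq> 0" for x n
  proof -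
    have "norm x \<le> norm (\<pi> (x + d n *\<^sub>R v)) + norm (\<pi> (x + d n *\<^sub>R v) - \<pi> x)"
      using that(1) \<pi>id[of x] norm_triangle_ineq4[of "\<pi> (x + d n *\<^sub>R v)" "\<pi> (x + d n *\<^sub>R v) - x"] by simp
    also have "norm (\<pi> (x + d n *\<^sub>R v) - \<pi> x) \<le> (L + 2) * (d n * norm v)"
      using \<pi>lip[of "x + d n *\<^sub>R v" x] d(1)[of n] by simp
    also have "\<dots> \<le> m" unfolding m_def
      using L d[of n] by (intro mult_left_mono mult_left_le_one_le) auto
    finally show ?thesis using FR[OF that(2)] by simp
  qed
  have dist0: "norm x \<le> R + m" if "x \<in> ?D" "F x \<noteq> 0" for x
    using FR[OF that(2)] \<pi>id[of x] that(1) m by simp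
  have dF: "(F has_derivative f' x) (at x)" if "x \<in> ?D" for x
    by (rule has_derivative_transform_within_open[OF der oD that]) (use that in \<open>auto simp: F_def \<pi>id\<close>)
  define Q where "Q n = (LBINT x. indicator ?D x * (F (x + d n *\<^sub>R v) - F x)) / d n" for n
  have lim1: "Q \<longlonglongrightarrow> (LBINT x. indicator ?D x * f' x v)"
    unfolding Q_def
  proof (rule tendsto_integral_difference_quotient[OF oD Flip C dF d0 d(1)])
    show "F (x + d n *\<^sub>R v) = F x" if "x \<in> ?D" "norm x > R + m" for n x
      using dist[OF that(1), of n] dist0[OF that(1)] that(2) by fastforce
  qed
  define \<phi> where "\<phi> n x = (indicator ?D (x - d n *\<^sub>R v) - indicator ?D x) * F x" for n x
  have [measurable]: "\<phi> n \<in> borel_measurable borel" for n unfolding \<phi>_def by measurable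
  have i1: "integrable lborel (\<lambda>x. indicator ?D x * F x)"
  proof (rule integrable_bounded_support)
    show "\<bar>indicator ?D x * F x\<bar> \<le> K" for x using K by (auto simp: indicator_def)
    show "indicator ?D x * F x = 0" if "norm x > R + m" for x
      using dist0[of x] that by (cases "x \<in> ?D") (auto simp: not_le[symmetric])
  qed measurable
  have i2: "integrable lborel (\<lambda>x. indicator ?D x * F (x + d n *\<^sub>R v))" for n
  proof (rule integrable_bounded_support)
    show "\<bar>indicator ?D x * F (x + d n *\<^sub>R v)\<bar> \<le> K" for x using K by (auto simp: indicator_def)
    show "indicator ?D x * F (x + d n *\<^sub>R v) = 0" if "norm x > R + m" for x
      using dist[of x n] that by (cases "x \<in> ?D") (auto simp: not_le[symmetric])
  qed measurable
  have i3: "integrable lborel (\<lambda>x. indicator ?D (x - d n *\<^sub>R v) * F x)" for n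
    using integrable_lborel_translate[OF _ i2[of n], of "- (d n *\<^sub>R v)"] by simp
  have i\<phi>: "integrable lborel (\<phi> n)" for n
    unfolding \<phi>_def left_diff_distrib by (intro Bochner_Integration.integrable_diff i1 i3)
  have Q\<phi>: "Q n = (LBINT x. \<phi> n x) / d n" for n
  proof -
    have "(LBINT x. indicator ?D x * (F (x + d n *\<^sub>R v) - F x))
        = (LBINT x. indicator ?D x * F (x + d n *\<^sub>R v)) - (LBINT x. indicator ?D x * F x)"
      using i1 i2 by (simp add: right_diff_distrib)
    also have "(LBINT x. indicator ?D x * F (x + d n *\<^sub>R v)) = (LBINT x. indicator ?D (x - d n *\<^sub>R v) * F x)"
      using integral_lborel_translate[of "\<lambda>x. indicator ?D (x - d n *\<^sub>R v) * F x" "d n *\<^sub>R v"] by simp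
    also have "\<dots> - (LBINT x. indicator ?D x * F x) = (LBINT x. \<phi> n x)"
      unfolding \<phi>_def left_diff_distrib by (rule Bochner_Integration.integral_diff[OF i3 i1, symmetric])
    finally show ?thesis by (simp add: Q_def)
  qed
  define I where "I n x = (LBINT \<tau>. \<phi> n (x + \<tau> *\<^sub>R e)) / d n" for n x
  have [measurable]: "I n \<in> borel_measurable borel" for n
    unfolding I_def by measurable
  have QI: "Q n = (LBINT x. indicator (slab e) x * I n x)" for n
    using integral_slab[OF e _ i\<phi>[of n]] by (simp add: Q\<phi> I_def)
  define p where "p x = graph_point e \<gamma> x" for x
  have pE: "\<pi> (p x) = p x" for x
    using inv[of x "\<gamma> x - x \<bullet> e"] by (intro \<pi>id) (simp add: p_def inner_add_left ee)
  \<comment> \<open>The signed thickness of the layer at scale \<open>d n\<close>, divided by \<open>d n\<close>.\<close>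
  define \<rho> where "\<rho> n x = v \<bullet> e + (\<gamma> (x - d n *\<^sub>R v) - \<gamma> x) / d n" for n x
  have \<rho>b: "\<bar>\<rho> n x\<bar> \<le> m" for n x
  proof -
    have "\<bar>\<gamma> (x - d n *\<^sub>R v) - \<gamma> x\<bar> / d n \<le> L * norm v"
      using lip'[of "x - d n *\<^sub>R v" x] d(1)[of n] by (simp add: field_simps)
    moreover have "\<bar>v \<bullet> e\<bar> \<le> norm v" using Cauchy_Schwarz_ineq2[of v e] e by simp
    moreover have "\<bar>\<rho> n x\<bar> \<le> \<bar>v \<bullet> e\<bar> + \<bar>\<gamma> (x - d n *\<^sub>R v) - \<gamma> x\<bar> / d n"
      using d(1)[of n] abs_triangle_ineq[of "v \<bullet> e" "(\<gamma> (x - d n *\<^sub>R v) - \<gamma> x) / d n"] by (simp add: \<rho>_def)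
    moreover have "m = L * norm v + norm v + norm v" by (simp add: m_def algebra_simps)
    ultimately show ?thesis using norm_ge_zero[of v] by linarith
  qed
  have Iest: "\<bar>I n x - F (p x) * \<rho> n x\<bar> \<le> C * m\<^sup>2 * d n" for n x
  proof -
    define a where "a = \<gamma> x - x \<bullet> e"
    define b where "b = a + d n * \<rho> n x"
    have b: "b = \<gamma> (x - d n *\<^sub>R v) + d n * (v \<bullet> e) - x \<bullet> e"
      using d(1)[of n] by (simp add: a_def b_def \<rho>_def field_simps)
    have "\<phi> n (x + \<tau> *\<^sub>R e) = (indicator {..<b} \<tau> - indicator {..<a} \<tau>) * F (x + \<tau> *\<^sub>R e)" for \<tau>
    proof -
      have "\<gamma> (x + \<tau> *\<^sub>R e - d n *\<^sub>R v) = \<gamma> (x - d n *\<^sub>R v)"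
        using inv[of "x - d n *\<^sub>R v" \<tau>] by (simp add: algebra_simps)
      then have "x + \<tau> *\<^sub>R e - d n *\<^sub>R v \<in> ?D \<longleftrightarrow> \<tau> < b"
        by (simp add: b inner_add_left inner_diff_left ee) linarith
      moreover have "x + \<tau> *\<^sub>R e \<in> ?D \<longleftrightarrow> \<tau> < a"
        by (simp add: a_def inner_add_left ee inv) linarith
      ultimately show ?thesis by (simp add: \<phi>_def indicator_def)
    qed
    then have In: "I n x = (LBINT \<tau>. (indicator {..<b} \<tau> - indicator {..<a} \<tau>) * F (x + \<tau> *\<^sub>R e)) / d n"
      by (simp add: I_def)
    have "C-lipschitz_on UNIV (\<lambda>\<tau>. F (x + \<tau> *\<^sub>R e))"
    proof (rule lipschitz_onI)
      fix s t :: real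
      show "dist (F (x + s *\<^sub>R e)) (F (x + t *\<^sub>R e)) \<le> C * dist s t"
        using Flip[of "x + s *\<^sub>R e" "x + t *\<^sub>R e"] e by (simp add: dist_norm flip: scaleR_left_diff_distrib)
    qed (rule C)
    from integral_between[OF this, of b a]
    have "\<bar>I n x * d n - F (p x) * (b - a)\<bar> \<le> C * (b - a)\<^sup>2"
      using d(1)[of n] by (simp add: In p_def a_def)
    also have "\<dots> = d n * (C * (\<rho> n x)\<^sup>2 * d n)"
      by (simp add: b_def power2_eq_square mult_ac)
    also have "I n x * d n - F (p x) * (b - a) = d n * (I n x - F (p x) * \<rho> n x)"
      by (simp add: b_def algebra_simps)
    finally have "\<bar>I n x - F (p x) * \<rho> n x\<bar> \<le> C * (\<rho> n x)\<^sup>2 * d n"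
      using d(1)[of n] by (simp add: abs_mult)
    also have "\<dots> \<le> C * m\<^sup>2 * d n"
      using \<rho>b[of n x] C d(1)[of n] m
      by (intro mult_right_mono mult_left_mono) (auto simp: abs_le_square_iff[symmetric])
    finally show ?thesis .
  qed
  have Ib: "\<bar>indicator (slab e) x * I n x\<bar> \<le> K * m + C * m\<^sup>2" for n x
  proof -
    have "\<bar>F (p x) * \<rho> n x\<bar> \<le> K * m" unfolding abs_mult by (intro mult_mono K \<rho>b) auto
    moreover have "C * m\<^sup>2 * d n \<le> C * m\<^sup>2" using C d[of n] by (intro mult_left_le) auto
    ultimately have "\<bar>I n x\<bar> \<le> K * m + C * m\<^sup>2" using Iest[of n x] by linarith
    then show ?thesis by (auto simp: indicator_def)
  qed
  have Isupp: "indicator (slab e) x * I n x = 0" if "norm x > 2 * R + 1" for n x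
  proof (cases "x \<in> slab e")
    case True
    have "F (x + \<tau> *\<^sub>R e) = 0" for \<tau>
    proof (rule ccontr)
      assume "F (x + \<tau> *\<^sub>R e) \<noteq> 0"
      then have "norm (\<pi> (x + \<tau> *\<^sub>R e)) \<le> R" by (rule FR)
      moreover obtain \<sigma> where \<sigma>: "\<pi> (x + \<tau> *\<^sub>R e) = x + \<sigma> *\<^sub>R e"
        by (rule that[of "\<tau> + min 0 (\<gamma> (x + \<tau> *\<^sub>R e) - (x + \<tau> *\<^sub>R e) \<bullet> e)"])
          (simp add: \<pi>_def scaleR_left_distrib)
      ultimately have n: "norm (x + \<sigma> *\<^sub>R e) \<le> R" by simp
      have "\<bar>x \<bullet> e + \<sigma>\<bar> \<le> R"
        using Cauchy_Schwarz_ineq2[of "x + \<sigma> *\<^sub>R e" e] n e by (simp add: inner_add_left ee)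
      then have "\<bar>\<sigma>\<bar> \<le> R + 1" using True by (auto simp: slab_def)
      moreover have "norm x \<le> norm (x + \<sigma> *\<^sub>R e) + \<bar>\<sigma>\<bar>"
        using norm_triangle_ineq4[of "x + \<sigma> *\<^sub>R e" "\<sigma> *\<^sub>R e"] e by simp
      ultimately show False using n that by linarith
    qed
    then show ?thesis by (simp add: I_def \<phi>_def)
  qed simp
  have [measurable]: "right_grad \<gamma> \<in> borel_measurable borel"
    using borel_measurable_right_deriv[OF c\<gamma>] by measurable
  have cp: "continuous_on UNIV p"
    unfolding p_def by (intro continuous_intros c\<gamma>)
  have [measurable]: "p \<in> borel_measurable borel" by (rule borel_measurable_continuous_onI[OF cp])
  have S: "?S x = indicator (slab e) x * (F (p x) * (v \<bullet> (e - right_grad \<gamma> x)))" for x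
    using pE[of x] by (simp add: F_def p_def)
  have Smeas: "?S \<in> borel_measurable borel" unfolding S by measurable
  have Ilim: "AE x in lborel. (\<lambda>n. indicator (slab e) x * I n x) \<longlonglongrightarrow> ?S x"
    using tendsto_right_deriv_AE[OF lip, of "- v"] right_deriv_linear_AE[OF lip, of "- v"]
  proof eventually_elim
    fix x
    assume l: "((\<lambda>s. (\<gamma> (x + s *\<^sub>R (- v)) - \<gamma> x) / s) \<longlongrightarrow> right_deriv \<gamma> (- v) x) (at_right 0)"
      and "right_deriv \<gamma> (- v) x = (- v) \<bullet> right_grad \<gamma> x"
    then have r: "right_deriv \<gamma> (- v) x = - (v \<bullet> right_grad \<gamma> x)" by simp
    have "(\<lambda>n. (\<gamma> (x - d n *\<^sub>R v) - \<gamma> x) / d n) \<longlonglongrightarrow> - (v \<bullet> right_grad \<gamma> x)"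
      using filterlim_compose[OF l filterlim_inverse_Suc_at_right] by (simp add: r d_def)
    then have "(\<lambda>n. \<rho> n x) \<longlonglongrightarrow> v \<bullet> e + - (v \<bullet> right_grad \<gamma> x)"
      unfolding \<rho>_def by (intro tendsto_intros)
    then have "(\<lambda>n. F (p x) * \<rho> n x) \<longlonglongrightarrow> F (p x) * (v \<bullet> (e - right_grad \<gamma> x))"
      by (intro tendsto_mult_left) (simp add: inner_diff_right)
    moreover have "(\<lambda>n. I n x - F (p x) * \<rho> n x) \<longlonglongrightarrow> 0"
    proof (rule Lim_null_comparison)
      show "eventually (\<lambda>n. norm (I n x - F (p x) * \<rho> n x) \<le> C * m\<^sup>2 * d n) sequentially"
        using Iest by simp
      show "(\<lambda>n. C * m\<^sup>2 * d n) \<longlonglongrightarrow> 0" using tendsto_mult_left[OF d0, of "C * m\<^sup>2"] by simp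
    qed
    ultimately have "(\<lambda>n. (I n x - F (p x) * \<rho> n x) + F (p x) * \<rho> n x) \<longlonglongrightarrow> 0 + F (p x) * (v \<bullet> (e - right_grad \<gamma> x))"
      by (intro tendsto_add)
    then show "(\<lambda>n. indicator (slab e) x * I n x) \<longlonglongrightarrow> ?S x"
      unfolding S by (intro tendsto_mult_left) simp
  qed
  note fin = integral_dominated_bounded_support[OF _ Smeas Ib Isupp Ilim]
  show "integrable lborel ?S" by (rule fin(2)) measurable
  have "Q \<longlonglongrightarrow> (LBINT x. ?S x)"
    unfolding QI[abs_def] by (rule fin(1)) measurable
  then show "(LBINT x. indicator ?D x * f' x v) = (LBINT x. ?S x)"
    by (rule LIMSEQ_unique[OF lim1])
qed

section \<open>Functions vanishing on the boundary\<close>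

text \<open>Measurability of \<open>h\<close> follows from completeness of Lebesgue measure.  This is how the surface
  integrand, which is arbitrary at points without a normal, and the source term become integrable.\<close>

lemma lebesgue_integral_AE_eq_lborel:
  fixes h S :: "'a::euclidean_space \<Rightarrow> real"
  assumes S: "integrable lborel S" and ae: "AE x in lborel. h x = S x"
  shows "integrable lebesgue h" "integral\<^sup>L lebesgue h = integral\<^sup>L lborel S"
proof -
  have Sm: "S \<in> borel_measurable lborel" using S by simp
  have ae': "AE x in lebesgue. S x = h x" using AE_completion[OF ae] by eventually_elim simp
  have Sl: "integrable lebesgue S" using S integrable_completion[OF Sm] by simp
  then have hm: "h \<in> borel_measurable lebesgue" using ae' by (intro borel_measurable_AE[OF _ ae']) auto
  show "integrable lebesgue h"
    by (rule integrable_cong_AE_imp[OF Sl hm ae'])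
  have "integral\<^sup>L lebesgue h = integral\<^sup>L lebesgue S"
    using ae' Sl by (intro integral_cong_AE hm) auto
  then show "integral\<^sup>L lebesgue h = integral\<^sup>L lborel S" by (simp add: integral_completion[OF Sm])
qed

lemma bounded_on_closure:
  fixes g :: "'a::euclidean_space \<Rightarrow> 'b::real_normed_vector"
  assumes "bounded \<Omega>" "continuous_on (closure \<Omega>) g"
  obtains B where "B \<ge> 0" "\<And>x. x \<in> closure \<Omega> \<Longrightarrow> norm (g x) \<le> B"
proof -
  have "compact (closure \<Omega>)" using assms(1) by (simp add: compact_closure)
  then have "bounded (g ` closure \<Omega>)" by (intro compact_imp_bounded compact_continuous_image assms(2))
  then obtain B where "\<And>x. x \<in> closure \<Omega> \<Longrightarrow> norm (g x) \<le> B" by (auto simp: bounded_iff)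
  then have "norm (g x) \<le> max 0 B" if "x \<in> closure \<Omega>" for x using that by fastforce
  then show ?thesis by (intro that[of "max 0 B"]) auto
qed

lemma integrable_indicator_continuous_closure:
  fixes g :: "'a::euclidean_space \<Rightarrow> real"
  assumes "open \<Omega>" "bounded \<Omega>" "continuous_on (closure \<Omega>) g"
  shows "integrable lborel (\<lambda>x. indicator \<Omega> x * g x)"
proof -
  obtain B where B: "B \<ge> 0" "\<And>x. x \<in> closure \<Omega> \<Longrightarrow> norm (g x) \<le> B"
    using bounded_on_closure[OF assms(2,3)] by blast
  obtain R where R: "\<And>x. x \<in> \<Omega> \<Longrightarrow> norm x \<le> R" using assms(2) by (auto simp: bounded_iff)
  show ?thesis
  proof (rule integrable_bounded_support)
    have "(\<lambda>x. indicator \<Omega> x *\<^sub>R g x) \<in> borel_measurable borel"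
      by (rule borel_measurable_continuous_on_indicator)
        (use assms continuous_on_subset[OF assms(3) closure_subset] in auto)
    then show "(\<lambda>x. indicator \<Omega> x * g x) \<in> borel_measurable borel" by simp
    show "\<bar>indicator \<Omega> x * g x\<bar> \<le> B" for x
      using B closure_subset[of \<Omega>] by (cases "x \<in> \<Omega>") auto
    show "indicator \<Omega> x * g x = 0" if "norm x > R" for x
      using R[of x] that by (cases "x \<in> \<Omega>") auto
  qed
qed

text \<open>A segment that starts in \<open>\<Omega>\<close> and leaves it meets the frontier at its first exit point, where \<open>f\<close> is zero; the
  mean value theorem up to that point bounds \<open>f\<close> by the distance to it.\<close>

lemma lipschitz_zero_extension:
  fixes f :: "'a::euclidean_space \<Rightarrow> real"
  assumes \<Omega>: "open \<Omega>" and cont: "continuous_on (closure \<Omega>) f"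
    and der: "\<And>x. x \<in> \<Omega> \<Longrightarrow> (f has_derivative f' x) (at x)"
    and bd: "\<And>x h. x \<in> \<Omega> \<Longrightarrow> \<bar>f' x h\<bar> \<le> B * norm h" and "0 \<le> B"
    and zero: "\<And>x. x \<in> frontier \<Omega> \<Longrightarrow> f x = 0"
  shows "\<bar>(if x \<in> \<Omega> then f x else 0) - (if y \<in> \<Omega> then f y else 0)\<bar> \<le> B * norm (x - y)"
proof -
  have out: "\<bar>f x\<bar> \<le> B * norm (x - z)" if x: "x \<in> \<Omega>" and z: "z \<notin> \<Omega>" for x z
  proof -
    define c where "c u = x + u *\<^sub>R (z - x)" for u :: real
    have cc: "continuous_on S c" for S unfolding c_def by (intro continuous_intros)
    define S where "S = {u \<in> {0..1}. c u \<notin> \<Omega>}"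
    have "closed S"
      using continuous_closed_preimage[OF cc closed_atLeastAtMost closed_Compl[OF \<Omega>], of 0 1]
      by (simp add: S_def vimage_def Int_def)
    then have "compact S"
      by (auto simp: compact_eq_bounded_closed S_def intro: bounded_subset[OF bounded_closed_interval[of 0 1]])
    moreover have "1 \<in> S" using z by (simp add: S_def c_def)
    ultimately obtain u where u: "u \<in> S" "\<And>w. w \<in> S \<Longrightarrow> u \<le> w"
      using compact_attains_inf[of S] by blast
    have c0: "c 0 = x" by (simp add: c_def)
    have u01: "0 < u" "u \<le> 1" using u x c0 by (auto simp: S_def less_le)
    have inside: "c w \<in> \<Omega>" if "0 \<le> w" "w < u" for w
      using u(2)[of w] that u01 by (force simp: S_def)
    have "c ` {0..u} \<subseteq> closure \<Omega>"
    proof -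
      have "c ` closure {0..<u} \<subseteq> closure \<Omega>"
        by (rule image_closure_subset[OF cc closed_closure]) (use inside closure_subset in fastforce)
      then show ?thesis using u01 by (simp add: closure_atLeastLessThan)
    qed
    then have cl: "c w \<in> closure \<Omega>" if "0 \<le> w" "w \<le> u" for w using that by auto
    have "c u \<in> frontier \<Omega>"
      using cl[of u] u01 u(1) \<Omega> by (simp add: frontier_def S_def interior_open)
    then have fu: "f (c u) = 0" by (rule zero)
    have "\<exists>w\<in>{0<..<u}. norm (f (c u) - f (c 0)) \<le> norm (f' (c w) ((u - 0) *\<^sub>R (z - x)))"
    proof (rule mvt_general[OF u01(1), where f = "\<lambda>w. f (c w)" and f' = "\<lambda>w h. f' (c w) (h *\<^sub>R (z - x))"])
      show "continuous_on {0..u} (\<lambda>w. f (c w))"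
        by (rule continuous_on_compose2[OF cont cc]) (use cl in auto)
      fix w assume w: "0 < w" "w < u"
      show "((\<lambda>w. f (c w)) has_derivative (\<lambda>h. f' (c w) (h *\<^sub>R (z - x)))) (at w)"
      proof (rule has_derivative_compose[where g = f and g' = "f' (c w)" and f = c])
        show "(c has_derivative (\<lambda>h. h *\<^sub>R (z - x))) (at w)"
          unfolding c_def by (auto intro!: derivative_eq_intros)
        show "(f has_derivative f' (c w)) (at (c w))" using inside w by (intro der) auto
      qed
    qed
    then obtain w where w: "0 < w" "w < u" "\<bar>f x\<bar> \<le> \<bar>f' (c w) (u *\<^sub>R (z - x))\<bar>"
      by (auto simp: fu c0)
    note w(3)
    also have "\<bar>f' (c w) (u *\<^sub>R (z - x))\<bar> \<le> B * norm (u *\<^sub>R (z - x))"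
      by (rule bd) (use inside w in auto)
    also have "\<dots> \<le> B * norm (x - z)"
      using u01 \<open>0 \<le> B\<close> by (intro mult_left_mono) (auto simp: norm_minus_commute intro: mult_left_le_one_le)
    finally show ?thesis .
  qed
  show ?thesis
  proof (cases "closed_segment x y \<subseteq> \<Omega>")
    case True
    have "norm (f x - f y) \<le> B * norm (x - y)"
    proof (rule differentiable_bound[OF convex_closed_segment])
      fix z assume "z \<in> closed_segment x y"
      then have z: "z \<in> \<Omega>" using True by blast
      then show "(f has_derivative f' z) (at z within closed_segment x y)"
        using der has_derivative_at_withinI by blast
      show "onorm (f' z) \<le> B" using bd[OF z] by (intro onorm_le) simp
    qed auto
    moreover have "x \<in> \<Omega>" "y \<in> \<Omega>" using True by auto
    ultimately show ?thesis by simp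
  next
    case False
    then obtain z where z: "z \<in> closed_segment x y" "z \<notin> \<Omega>" by blast
    have "\<bar>if x \<in> \<Omega> then f x else 0\<bar> \<le> B * norm (x - z)" "\<bar>if y \<in> \<Omega> then f y else 0\<bar> \<le> B * norm (y - z)"
      using out[OF _ z(2)] \<open>0 \<le> B\<close> by auto
    moreover have "B * norm (x - z) + B * norm (y - z) = B * norm (x - y)"
    proof -
      have "dist x y = dist x z + dist z y" using z(1) by (simp flip: between_mem_segment between)
      then have "norm (x - y) = norm (x - z) + norm (y - z)" by (simp add: dist_norm norm_minus_commute)
      then show ?thesis by (simp add: distrib_left)
    qed
    ultimately show ?thesis by linarith
  qed
qed

text \<open>A point of an open set stays inside after a small translation.\<close>

lemma tendsto_integral_escape_open:
  fixes A :: "'a::euclidean_space set"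
  assumes A: "open A" "bounded A" and d: "d \<longlonglongrightarrow> 0"
  shows "(\<lambda>n. LBINT x. indicator A x * (1 - indicator A (x + d n))) \<longlonglongrightarrow> (0::real)"
proof -
  have [measurable]: "A \<in> sets borel" using A by simp
  obtain R where R: "\<And>x. x \<in> A \<Longrightarrow> norm x \<le> R" using A by (auto simp: bounded_iff)
  have "(\<lambda>n. LBINT x. indicator A x * (1 - indicator A (x + d n))) \<longlonglongrightarrow> (\<integral>x. (0::real) \<partial>(lborel :: 'a measure))"
  proof (rule integral_dominated_bounded_support)
    show "\<bar>indicator A x * (1 - indicator A (x + d n))\<bar> \<le> (1::real)" for n x
      by (auto simp: indicator_def)
    show "indicator A x * (1 - indicator A (x + d n)) = (0::real)" if "norm x > R" for n x
      using R[of x] that by (cases "x \<in> A") auto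
    show "AE x in lborel. (\<lambda>n. indicator A x * (1 - indicator A (x + d n))) \<longlonglongrightarrow> (0::real)"
    proof (intro always_eventually allI)
      fix x
      show "(\<lambda>n. indicator A x * (1 - indicator A (x + d n))) \<longlonglongrightarrow> (0::real)"
      proof (cases "x \<in> A")
        case True
        have "(\<lambda>n. x + d n) \<longlonglongrightarrow> x" using tendsto_add[OF tendsto_const d, of x] by simp
        then have "eventually (\<lambda>n. x + d n \<in> A) sequentially"
          using topological_tendstoD[of _ x sequentially A] True A by auto
        then have "eventually (\<lambda>n. indicator A x * (1 - indicator A (x + d n)) = (0::real)) sequentially"
          by eventually_elim simp
        then show ?thesis by (rule tendsto_eventually)
      qed simp
    qed
  qed measurable
  then show ?thesis by simp
qed

text \<open>Extend \<open>f\<close> by zero.  The integral of the difference quotient over \<open>\<Omega>\<close> equals, up to sign, the integral of the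
  extension over the part of \<open>\<Omega>\<close> that leaves \<open>\<Omega>\<close> under translation by \<open>- s v\<close>, divided by \<open>s\<close>.  There the extension is
  at most \<open>B s |v|\<close>, and that part of \<open>\<Omega>\<close> shrinks to a null set.\<close>

lemma integral_derivative_vanishing_on_frontier:
  fixes f :: "'a::euclidean_space \<Rightarrow> real"
  assumes \<Omega>: "open \<Omega>" "bounded \<Omega>" and cont: "continuous_on (closure \<Omega>) f"
    and der: "\<And>x. x \<in> \<Omega> \<Longrightarrow> (f has_derivative f' x) (at x)"
    and bd: "\<And>x h. x \<in> \<Omega> \<Longrightarrow> \<bar>f' x h\<bar> \<le> B * norm h" and "0 \<le> B"
    and zero: "\<And>x. x \<in> frontier \<Omega> \<Longrightarrow> f x = 0"
  shows "(LBINT x. indicator \<Omega> x * f' x v) = 0"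
proof -
  have [measurable]: "\<Omega> \<in> sets borel" using \<Omega> by simp
  define F where "F x = (if x \<in> \<Omega> then f x else 0)" for x
  have Flip: "\<bar>F x - F y\<bar> \<le> B * norm (x - y)" for x y
    unfolding F_def by (rule lipschitz_zero_extension[OF \<Omega>(1) cont der bd \<open>0 \<le> B\<close> zero])
  have cF: "continuous_on UNIV F"
    by (rule lipschitz_on_continuous_on[of B]) (auto intro!: lipschitz_onI simp: \<open>0 \<le> B\<close> dist_norm Flip)
  have [measurable]: "F \<in> borel_measurable borel" by (rule borel_measurable_continuous_onI[OF cF])
  obtain R where R: "\<And>x. x \<in> \<Omega> \<Longrightarrow> norm x \<le> R" using \<Omega> by (auto simp: bounded_iff)
  obtain K where K: "K \<ge> 0" "\<And>x. x \<in> closure \<Omega> \<Longrightarrow> norm (f x) \<le> K"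
    using bounded_on_closure[OF \<Omega>(2) cont] by blast
  have FK: "\<bar>F x\<bar> \<le> K" for x using K closure_subset[of \<Omega>] by (auto simp: F_def)
  define d where "d n = inverse (real (Suc n))" for n
  have d: "d n > 0" for n by (auto simp: d_def)
  have d0: "d \<longlonglongrightarrow> 0" unfolding d_def by (rule LIMSEQ_inverse_real_of_nat)
  have dF: "(F has_derivative f' x) (at x)" if "x \<in> \<Omega>" for x
    by (rule has_derivative_transform_within_open[OF der[OF that] \<Omega>(1) that]) (simp add: F_def)
  define Q where "Q n = (LBINT x. indicator \<Omega> x * (F (x + d n *\<^sub>R v) - F x)) / d n" for n
  have lim1: "Q \<longlonglongrightarrow> (LBINT x. indicator \<Omega> x * f' x v)"
    unfolding Q_def
    by (rule tendsto_integral_difference_quotient[OF \<Omega>(1) Flip \<open>0 \<le> B\<close> dF d0 d]) (use R in \<open>auto simp: not_less[symmetric]\<close>)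
  have i1: "integrable lborel F"
  proof (rule integrable_bounded_support[OF _ FK])
    show "F x = 0" if "norm x > R" for x using R[of x] that by (cases "x \<in> \<Omega>") (auto simp: F_def)
  qed measurable
  have i2: "integrable lborel (\<lambda>x. indicator \<Omega> x * F (x + d n *\<^sub>R v))" for n
  proof (rule integrable_bounded_support)
    show "\<bar>indicator \<Omega> x * F (x + d n *\<^sub>R v)\<bar> \<le> K" for x using FK K by (auto simp: indicator_def)
    show "indicator \<Omega> x * F (x + d n *\<^sub>R v) = 0" if "norm x > R" for x
      using R[of x] that by (cases "x \<in> \<Omega>") auto
  qed measurable
  have i3: "integrable lborel (\<lambda>x. indicator \<Omega> (x + d n *\<^sub>R (- v)) * F x)" for n
    using integrable_lborel_translate[OF _ i2[of n], of "- (d n *\<^sub>R v)"] by simp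
  let ?k = "\<lambda>n x. indicator \<Omega> x * (1 - indicator \<Omega> (x + d n *\<^sub>R (- v))) :: real"
  have i\<Omega>: "integrable lborel (\<lambda>x. ?k n x :: real)" for n
  proof (rule integrable_bounded_support)
    show "\<bar>?k n x\<bar> \<le> (1::real)" for x
      by (auto simp: indicator_def)
    show "?k n x = (0::real)" if "norm x > R" for x
      using R[of x] that by (cases "x \<in> \<Omega>") auto
  qed measurable
  have Q\<phi>: "Q n = (LBINT x. (indicator \<Omega> (x + d n *\<^sub>R (- v)) - 1) * F x) / d n" for n
  proof -
    have "indicator \<Omega> x * (F (x + d n *\<^sub>R v) - F x) = indicator \<Omega> x * F (x + d n *\<^sub>R v) - F x" for x
      by (cases "x \<in> \<Omega>") (auto simp: F_def)
    then have "(LBINT x. indicator \<Omega> x * (F (x + d n *\<^sub>R v) - F x))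
        = (LBINT x. indicator \<Omega> x * F (x + d n *\<^sub>R v)) - (LBINT x. F x)"
      using i1 i2 by simp
    also have "(LBINT x. indicator \<Omega> x * F (x + d n *\<^sub>R v)) = (LBINT x. indicator \<Omega> (x + d n *\<^sub>R (- v)) * F x)"
      using integral_lborel_translate[of "\<lambda>x. indicator \<Omega> (x + d n *\<^sub>R (- v)) * F x" "d n *\<^sub>R v"] by simp
    also have "\<dots> - (LBINT x. F x) = (LBINT x. (indicator \<Omega> (x + d n *\<^sub>R (- v)) - 1) * F x)"
      using i3[of n] i1 by (simp add: left_diff_distrib)
    finally show ?thesis by (simp add: Q_def)
  qed
  have Qest: "\<bar>Q n\<bar> \<le> (B * norm v) * (LBINT x. ?k n x)" for n
  proof -
    have pt: "\<bar>(indicator \<Omega> (x + d n *\<^sub>R (- v)) - 1) * F x\<bar>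
        \<le> (d n * (B * norm v)) * (?k n x)" for x
    proof (cases "x \<in> \<Omega> \<and> x + d n *\<^sub>R (- v) \<notin> \<Omega>")
      case True
      then have "F (x + d n *\<^sub>R (- v)) = 0" by (simp add: F_def)
      then show ?thesis using Flip[of x "x + d n *\<^sub>R (- v)"] True d[of n] by (simp add: mult_ac)
    next
      case False
      then show ?thesis by (auto simp: F_def indicator_def)
    qed
    have "\<bar>LBINT x. (indicator \<Omega> (x + d n *\<^sub>R (- v)) - 1) * F x\<bar>
        \<le> (LBINT x. \<bar>(indicator \<Omega> (x + d n *\<^sub>R (- v)) - 1) * F x\<bar>)" by (rule integral_abs_bound)
    also have "\<dots> \<le> (LBINT x. (d n * (B * norm v)) * (?k n x))"
      by (rule integral_mono[OF _ _ pt])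
        (use i3[of n] i1 i\<Omega>[of n] in \<open>auto simp: left_diff_distrib simp del: scaleR_minus_right\<close>)
    also have "\<dots> = (d n * (B * norm v)) * (LBINT x. ?k n x)"
      by (rule integral_mult_right_zero)
    finally have "\<bar>LBINT x. (indicator \<Omega> (x + d n *\<^sub>R (- v)) - 1) * F x\<bar> \<le> \<dots>" .
    moreover have "\<bar>X / c\<bar> \<le> b * J" if "\<bar>X\<bar> \<le> (c * b) * J" "c > 0" for X c b J :: real
      using that by (simp add: field_simps)
    ultimately show ?thesis unfolding Q\<phi> using d[of n] by blast
  qed
  have "(\<lambda>n. d n *\<^sub>R (- v)) \<longlonglongrightarrow> 0" using tendsto_scaleR[OF d0 tendsto_const, of "- v"] by simp
  from tendsto_mult_left[OF tendsto_integral_escape_open[OF \<Omega> this], of "B * norm v"]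
  have "(\<lambda>n. (B * norm v) * (LBINT x. ?k n x)) \<longlonglongrightarrow> 0"
    by (simp only: mult_zero_right)
  then have "Q \<longlonglongrightarrow> 0"
    by (rule Lim_null_comparison[rotated]) (simp only: real_norm_def Qest eventually_True)
  then show ?thesis using LIMSEQ_unique[OF lim1] by blast
qed

section \<open>Charts and outward normals\<close>

lemma chart_below_closure:
  assumes chart: "lipschitz_chart \<Omega> e \<gamma> U" and x: "x \<in> U" "x \<bullet> e \<le> \<gamma> x"
  shows "x \<in> closure \<Omega>"
proof -
  have e: "norm e = 1" and U: "open U" and inv: "\<And>x s. \<gamma> (x + s *\<^sub>R e) = \<gamma> x"
    and \<Omega>U: "\<Omega> \<inter> U = {x \<in> U. x \<bullet> e < \<gamma> x}"
    using chart by (auto simp: lipschitz_chart_def)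
  have ee: "e \<bullet> e = 1" using e by (simp add: norm_eq_1)
  obtain r where r: "r > 0" "ball x r \<subseteq> U" using U x(1) openE by blast
  show ?thesis
    unfolding closure_approachable
  proof (intro allI impI)
    fix \<epsilon> :: real assume "\<epsilon> > 0"
    define t where "t = min \<epsilon> r / 2"
    have t: "t > 0" "t < \<epsilon>" "t < r" using r \<open>\<epsilon> > 0\<close> by (auto simp: t_def)
    define y where "y = x + (- t) *\<^sub>R e"
    have dy: "dist y x = t" using t e by (simp add: y_def dist_norm)
    have "y \<in> U" using r(2) dy t by (auto simp: subset_eq dist_commute)
    moreover have "\<gamma> y = \<gamma> x" unfolding y_def by (rule inv)
    moreover have "y \<bullet> e < x \<bullet> e" using t by (simp add: y_def inner_diff_left ee)
    ultimately have "y \<in> {x \<in> U. x \<bullet> e < \<gamma> x}" using x(2) by simp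
    then have "y \<in> \<Omega>" using \<Omega>U by blast
    then show "\<exists>y\<in>\<Omega>. dist y x < \<epsilon>" using dy t by auto
  qed
qed

lemma has_derivative_eq_zero_locally:
  assumes "(f has_derivative f') (at x)" "open V" "x \<in> V" "\<And>y. y \<in> V \<Longrightarrow> f y = 0"
  shows "f' h = 0"
proof -
  have "((\<lambda>_. 0) has_derivative f') (at x)"
    by (rule has_derivative_transform_within_open[OF assms(1-3)]) (use assms(4) in auto)
  then have "f' = (\<lambda>_. 0)" by (rule has_derivative_unique) simp
  then show ?thesis by simp
qed

text \<open>The product \<open>\<psi> f\<close>, extended by zero, is a function on the whole region below the graph, because the support of
  \<open>\<psi>\<close> is a compact subset of \<open>U\<close>.\<close>

lemma divergence_theorem_in_chart:
  fixes \<Omega> :: "'a::euclidean_space set" and f :: "'a \<Rightarrow> real"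
  assumes \<Omega>: "open \<Omega>" "bounded \<Omega>" and chart: "lipschitz_chart \<Omega> e \<gamma> U"
    and f: "continuous_on (closure \<Omega>) f" "\<And>x. x \<in> \<Omega> \<Longrightarrow> (f has_derivative f' x) (at x)"
      "\<And>x h. x \<in> \<Omega> \<Longrightarrow> \<bar>f' x h\<bar> \<le> B * norm h"
    and \<psi>: "\<And>x. (\<psi> has_derivative \<psi>' x) (at x)" "\<And>x h. x \<in> \<Omega> \<Longrightarrow> \<bar>\<psi>' x h\<bar> \<le> B\<^sub>\<psi> * norm h"
    and supp: "compact (closure {x. \<psi> x \<noteq> 0})" "closure {x. \<psi> x \<noteq> 0} \<subseteq> U"
  shows "integrable lborel (\<lambda>x. indicator (slab e) x *
      (\<psi> (graph_point e \<gamma> x) * f (graph_point e \<gamma> x) * (v \<bullet> (e - right_grad \<gamma> x))))"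
    and "(LBINT x. indicator \<Omega> x * (\<psi> x * f' x v + \<psi>' x v * f x))
      = (LBINT x. indicator (slab e) x *
      (\<psi> (graph_point e \<gamma> x) * f (graph_point e \<gamma> x) * (v \<bullet> (e - right_grad \<gamma> x))))"
proof -
  let ?D = "{x. x \<bullet> e < \<gamma> x}" and ?E = "{x. x \<bullet> e \<le> \<gamma> x}"
  define K where "K = closure {x. \<psi> x \<noteq> 0}"
  have e: "norm e = 1" and U: "open U" and inv: "\<And>x s. \<gamma> (x + s *\<^sub>R e) = \<gamma> x"
    and \<Omega>U: "\<Omega> \<inter> U = {x \<in> U. x \<bullet> e < \<gamma> x}" and "\<exists>L. L-lipschitz_on UNIV \<gamma>"
    using chart by (auto simp: lipschitz_chart_def)
  then obtain L where lip: "L-lipschitz_on UNIV \<gamma>" by blast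
  have c\<gamma>: "continuous_on UNIV \<gamma>" by (rule lipschitz_on_continuous_on[OF lip])
  have ee: "e \<bullet> e = 1" using e by (simp add: norm_eq_1)
  have mem: "x \<in> \<Omega> \<longleftrightarrow> x \<bullet> e < \<gamma> x" if "x \<in> U" for x using \<Omega>U that by blast
  have K: "closed K" "K \<subseteq> U" using supp by (auto simp: K_def)
  have \<psi>0: "\<psi> x = 0" if "x \<notin> K" for x using that closure_subset[of "{x. \<psi> x \<noteq> 0}"] by (auto simp: K_def)
  have \<psi>'0: "\<psi>' x h = 0" if "x \<notin> K" for x h
    by (rule has_derivative_eq_zero_locally[OF \<psi>(1), of "- K"]) (use that K \<psi>0 in auto)
  obtain R where R: "\<And>x. x \<in> K \<Longrightarrow> norm x \<le> R"
    using compact_imp_bounded[OF supp(1)] by (auto simp: K_def bounded_iff)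
  have c\<psi>: "continuous_on S \<psi>" for S
    using \<psi>(1) by (intro continuous_at_imp_continuous_on ballI has_derivative_continuous) auto
  define f0 where "f0 x = (if x \<in> U \<inter> closure \<Omega> then \<psi> x * f x else 0)" for x
  define f0' where "f0' x h = (if x \<in> U then \<psi> x * f' x h + \<psi>' x h * f x else 0)" for x h
  have f0E: "f0 x = \<psi> x * f x" if "x \<in> ?E" for x
    using chart_below_closure[OF chart, of x] that \<psi>0[of x] K by (auto simp: f0_def)
  have cont0: "continuous_on ?E f0"
  proof -
    have "continuous_on (?E \<inter> U) f0"
    proof (rule continuous_on_eq)
      show "continuous_on (?E \<inter> U) (\<lambda>x. \<psi> x * f x)"
        using chart_below_closure[OF chart] by (intro continuous_intros c\<psi> continuous_on_subset[OF f(1)]) auto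
    qed (use f0E in auto)
    moreover have "continuous_on (?E \<inter> - K) f0"
      by (rule continuous_on_eq[of _ "\<lambda>_. 0"]) (use f0E \<psi>0 in auto)
    moreover have "?E \<inter> U \<union> ?E \<inter> - K = ?E" using K by auto
    ultimately show ?thesis
      using continuous_on_Un_local_open[of "?E \<inter> U" "?E \<inter> - K" f0] U K by (simp add: openin_open_Int open_Compl)
  qed
  obtain C where C: "C \<ge> 0" "\<And>x. x \<in> closure \<Omega> \<Longrightarrow> norm (\<psi> x) \<le> C \<and> norm (f x) \<le> C"
  proof -
    obtain C1 where C1: "\<And>x. x \<in> closure \<Omega> \<Longrightarrow> norm (\<psi> x) \<le> C1"
      using bounded_on_closure[OF \<Omega>(2) c\<psi>] by blast
    obtain C2 where C2: "\<And>x. x \<in> closure \<Omega> \<Longrightarrow> norm (f x) \<le> C2"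
      using bounded_on_closure[OF \<Omega>(2) f(1)] by blast
    show ?thesis by (rule that[of "max 0 (max C1 C2)"]) (use C1 C2 in \<open>auto simp: le_max_iff_disj\<close>)
  qed
  have der0: "(f0 has_derivative f0' x) (at x)" if x: "x \<bullet> e < \<gamma> x" for x
  proof (cases "x \<in> U")
    case True
    then have x\<Omega>: "x \<in> \<Omega> \<inter> U" using mem x by auto
    have "((\<lambda>x. \<psi> x * f x) has_derivative (\<lambda>h. \<psi> x * f' x h + \<psi>' x h * f x)) (at x)"
      by (rule has_derivative_mult[OF \<psi>(1) f(2)]) (use x\<Omega> in auto)
    then have "(f0 has_derivative (\<lambda>h. \<psi> x * f' x h + \<psi>' x h * f x)) (at x)"
      by (rule has_derivative_transform_within_open[OF _ open_Int[OF \<Omega>(1) U] x\<Omega>])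
        (use closure_subset[of \<Omega>] in \<open>auto simp: f0_def\<close>)
    then show ?thesis using True by (simp add: f0'_def[abs_def])
  next
    case False
    have "(f0 has_derivative (\<lambda>_. 0)) (at x)"
      by (rule has_derivative_transform_within_open[of "\<lambda>_. 0" _ _ _ "- K"])
        (use False K \<psi>0 in \<open>auto simp: f0_def\<close>)
    then show ?thesis using False by (simp add: f0'_def[abs_def])
  qed
  have bd0: "\<bar>f0' x h\<bar> \<le> (C * \<bar>B\<bar> + \<bar>B\<^sub>\<psi>\<bar> * C) * norm h" if x: "x \<bullet> e < \<gamma> x" for x h
  proof (cases "x \<in> U")
    case True
    then have x\<Omega>: "x \<in> \<Omega>" using mem x by auto
    then have "\<bar>\<psi> x\<bar> \<le> C" "\<bar>f x\<bar> \<le> C" using C closure_subset[of \<Omega>] by auto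
    moreover have "\<bar>f' x h\<bar> \<le> \<bar>B\<bar> * norm h"
      using f(3)[OF x\<Omega>, of h] mult_right_mono[OF abs_ge_self norm_ge_zero, of B h] by linarith
    moreover have "\<bar>\<psi>' x h\<bar> \<le> \<bar>B\<^sub>\<psi>\<bar> * norm h"
      using \<psi>(2)[OF x\<Omega>, of h] mult_right_mono[OF abs_ge_self norm_ge_zero, of B\<^sub>\<psi> h] by linarith
    ultimately have "\<bar>\<psi> x * f' x h\<bar> \<le> C * (\<bar>B\<bar> * norm h)" "\<bar>\<psi>' x h * f x\<bar> \<le> (\<bar>B\<^sub>\<psi>\<bar> * norm h) * C"
      unfolding abs_mult by (intro mult_mono; simp)+
    then have "\<bar>\<psi> x * f' x h + \<psi>' x h * f x\<bar> \<le> C * (\<bar>B\<bar> * norm h) + (\<bar>B\<^sub>\<psi>\<bar> * norm h) * C" by linarith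
    then show ?thesis using True by (simp add: f0'_def algebra_simps)
  qed (use C in \<open>simp add: f0'_def\<close>)
  have supp0: "f0 x = 0" if "norm x > R" for x
    using \<psi>0[of x] R[of x] that by (force simp: f0_def)
  have pE: "graph_point e \<gamma> x \<in> ?E" for x
    using inv[of x "\<gamma> x - x \<bullet> e"] by (simp add: inner_add_left ee)
  note main = divergence_theorem_below_graph[OF e lip inv cont0 der0 bd0 supp0, where v = v]
  have S: "f0 (graph_point e \<gamma> x) = \<psi> (graph_point e \<gamma> x) * f (graph_point e \<gamma> x)" for x
    by (rule f0E[OF pE])
  show "integrable lborel (\<lambda>x. indicator (slab e) x *
      (\<psi> (graph_point e \<gamma> x) * f (graph_point e \<gamma> x) * (v \<bullet> (e - right_grad \<gamma> x))))"
    using main(1) by (simp only: S)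
  have "indicator \<Omega> x * (\<psi> x * f' x v + \<psi>' x v * f x) = indicator ?D x * f0' x v" for x
  proof (cases "x \<in> U")
    case True
    then show ?thesis using mem[of x] by (simp add: f0'_def indicator_def)
  next
    case False
    then have "x \<notin> K" using K by blast
    then show ?thesis using False by (simp add: \<psi>0 \<psi>'0 f0'_def)
  qed
  then show "(LBINT x. indicator \<Omega> x * (\<psi> x * f' x v + \<psi>' x v * f x))
      = (LBINT x. indicator (slab e) x *
      (\<psi> (graph_point e \<gamma> x) * f (graph_point e \<gamma> x) * (v \<bullet> (e - right_grad \<gamma> x))))"
    using main(2) by (simp only: S)
qed

lemma GDERIV_unique:
  fixes f :: "'a::euclidean_space \<Rightarrow> real"
  assumes "GDERIV f x :> D" "GDERIV f x :> D'"
  shows "D = D'"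
proof -
  have "(\<lambda>h. h \<bullet> D) = (\<lambda>h. h \<bullet> D')"
    using assms unfolding gderiv_def by (rule has_derivative_unique)
  then have "\<forall>h. h \<bullet> D = h \<bullet> D'" by (simp add: fun_eq_iff)
  then show ?thesis by (metis inner_commute vector_eq_rdot)
qed

lemma grad_eq:
  fixes f :: "'a::euclidean_space \<Rightarrow> real"
  assumes "GDERIV f x :> D"
  shows "grad f x = D"
  unfolding grad_def
  by (rule the_equality[where P = "\<lambda>D. GDERIV f x :> D", OF assms GDERIV_unique[OF _ assms]])

text \<open>Two different normals would place points in the direction of their difference both inside and outside \<open>\<Omega>\<close>.\<close>

lemma outward_normal_eqI:
  fixes \<Omega> :: "'a::euclidean_space set"
  assumes \<nu>: "is_outward_normal \<Omega> x \<nu>"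
  shows "outward_normal \<Omega> x = \<nu>"
  unfolding outward_normal_def
proof (rule the_equality[where P = "is_outward_normal \<Omega> x", OF \<nu>])
  fix \<nu>' assume \<nu>': "is_outward_normal \<Omega> x \<nu>'"
  show "\<nu>' = \<nu>"
  proof (rule ccontr)
    assume "\<nu>' \<noteq> \<nu>"
    define w where "w = \<nu> - \<nu>'"
    have n: "\<nu> \<bullet> \<nu> = 1" "\<nu>' \<bullet> \<nu>' = 1" using \<nu> \<nu>' by (auto simp: is_outward_normal_def norm_eq_1)
    have w0: "norm w > 0" using \<open>\<nu>' \<noteq> \<nu>\<close> by (simp add: w_def)
    have "w \<bullet> w = 2 * (1 - \<nu> \<bullet> \<nu>')" using n by (simp add: w_def inner_diff inner_commute)
    then have c: "1 - \<nu> \<bullet> \<nu>' > 0" using w0 inner_gt_zero_iff[of w] by simp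
    define \<epsilon> where "\<epsilon> = (1 - \<nu> \<bullet> \<nu>') / (2 * norm w)"
    have \<epsilon>: "\<epsilon> > 0" "\<epsilon> * norm w < 1 - \<nu> \<bullet> \<nu>'" using c w0 by (auto simp: \<epsilon>_def)
    obtain \<delta> where \<delta>: "\<delta> > 0" "\<And>y. y \<in> ball x \<delta> \<Longrightarrow> (y - x) \<bullet> \<nu> > \<epsilon> * norm (y - x) \<Longrightarrow> y \<notin> \<Omega>"
      using conjunct2[OF \<nu>[unfolded is_outward_normal_def], rule_format, OF \<epsilon>(1)] by auto
    obtain \<delta>' where \<delta>': "\<delta>' > 0" "\<And>y. y \<in> ball x \<delta>' \<Longrightarrow> (y - x) \<bullet> \<nu>' < - (\<epsilon> * norm (y - x)) \<Longrightarrow> y \<in> \<Omega>"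
      using conjunct2[OF \<nu>'[unfolded is_outward_normal_def], rule_format, OF \<epsilon>(1)] by auto
    define t where "t = min \<delta> \<delta>' / (2 * norm w)"
    have t: "t > 0" "t * norm w < \<delta>" "t * norm w < \<delta>'"
      using \<delta>(1) \<delta>'(1) w0 by (auto simp: t_def)
    define y where "y = x + t *\<^sub>R w"
    have yx: "norm (y - x) = t * norm w" "dist x y = t * norm w" using t by (auto simp: y_def dist_norm)
    have sc: "t * (\<epsilon> * norm w) < t * (1 - \<nu> \<bullet> \<nu>')" using t(1) \<epsilon>(2) by simp
    have "(y - x) \<bullet> \<nu> = t * (1 - \<nu> \<bullet> \<nu>')" "(y - x) \<bullet> \<nu>' = - (t * (1 - \<nu> \<bullet> \<nu>'))"
      using n by (simp_all add: y_def w_def inner_diff_left inner_commute algebra_simps)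
    then have "y \<notin> \<Omega>" "y \<in> \<Omega>"
      using \<delta>(2)[of y] \<delta>'(2)[of y] yx t sc by (auto simp: mult_ac)
    then show False by blast
  qed
qed

text \<open>In the chart, membership in \<open>\<Omega>\<close> is the sign of \<open>y \<bullet> e - \<gamma> y\<close>, whose linearization at the graph point is
  \<open>(y - p) \<bullet> (e - g)\<close>.  As \<open>\<gamma>\<close> is constant along \<open>e\<close>, \<open>g\<close> is orthogonal to \<open>e\<close> and \<open>e - g\<close> has length
  \<open>sqrt (1 + |g|\<^sup>2)\<close>.\<close>

lemma outward_normal_graph:
  fixes \<Omega> :: "'a::euclidean_space set"
  assumes chart: "lipschitz_chart \<Omega> e \<gamma> U" and gd: "GDERIV \<gamma> x :> g" and p: "graph_point e \<gamma> x \<in> U"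
  shows "outward_normal \<Omega> (graph_point e \<gamma> x) = (e - g) /\<^sub>R sqrt (1 + (norm g)\<^sup>2)"
proof (rule outward_normal_eqI)
  define c where "c = \<gamma> x - x \<bullet> e"
  let ?p = "graph_point e \<gamma> x"
  have e: "norm e = 1" and U: "open U" and inv: "\<And>x s. \<gamma> (x + s *\<^sub>R e) = \<gamma> x"
    and \<Omega>U: "\<Omega> \<inter> U = {x \<in> U. x \<bullet> e < \<gamma> x}"
    using chart by (auto simp: lipschitz_chart_def)
  have ee: "e \<bullet> e = 1" using e by (simp add: norm_eq_1)
  have der: "(\<gamma> has_derivative (\<lambda>h. h \<bullet> g)) (at x)" using gd by (simp add: gderiv_def)
  have ge: "e \<bullet> g = 0"
  proof -
    have "((\<lambda>s. \<gamma> (x + s *\<^sub>R e)) has_derivative (\<lambda>s. (s *\<^sub>R e) \<bullet> g)) (at 0)"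
      by (intro has_derivative_compose[where g=\<gamma> and g'="\<lambda>h. h \<bullet> g" and f="\<lambda>s. x + s *\<^sub>R e", simplified])
        (auto intro!: derivative_eq_intros der)
    then have "((\<lambda>_::real. \<gamma> x) has_derivative (\<lambda>s. (s *\<^sub>R e) \<bullet> g)) (at 0)" by (simp add: inv)
    then have "(\<lambda>s::real. (s *\<^sub>R e) \<bullet> g) = (\<lambda>_. 0)" by (rule has_derivative_unique) simp
    from fun_cong[OF this, of 1] show ?thesis by simp
  qed
  define N where "N = sqrt (1 + (norm g)\<^sup>2)"
  have N1: "N \<ge> 1" by (simp add: N_def)
  have "(norm (e - g))\<^sup>2 = 1 + (norm g)\<^sup>2"
    using ge by (simp add: power2_norm_eq_inner inner_diff inner_commute ee)
  then have nN: "norm (e - g) = N" unfolding N_def using real_sqrt_unique[of "norm (e - g)"] by simp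
  have \<gamma>p: "\<gamma> ?p = \<gamma> x" "?p \<bullet> e = \<gamma> x" using inv[of x c] by (simp_all add: c_def inner_add_left ee)
  show "is_outward_normal \<Omega> ?p ((e - g) /\<^sub>R sqrt (1 + (norm g)\<^sup>2))"
    unfolding is_outward_normal_def N_def[symmetric]
  proof (intro conjI allI impI)
    show "norm ((e - g) /\<^sub>R N) = 1" using nN N1 by simp
    fix \<epsilon> :: real assume \<epsilon>: "\<epsilon> > 0"
    then obtain d where d: "d > 0"
      "\<And>y. norm (y - x) < d \<Longrightarrow> norm (\<gamma> y - \<gamma> x - (y - x) \<bullet> g) \<le> (\<epsilon>/2) * norm (y - x)"
      using conjunct2[OF der[unfolded has_derivative_at_alt], rule_format, of "\<epsilon>/2"] by auto
    obtain r where r: "r > 0" "ball ?p r \<subseteq> U" using U p openE by blast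
    show "\<exists>\<delta>>0. \<forall>y\<in>ball ?p \<delta>.
        ((y - ?p) \<bullet> ((e - g) /\<^sub>R N) > \<epsilon> * norm (y - ?p) \<longrightarrow> y \<notin> \<Omega>) \<and>
        ((y - ?p) \<bullet> ((e - g) /\<^sub>R N) < - (\<epsilon> * norm (y - ?p)) \<longrightarrow> y \<in> \<Omega>)"
    proof (intro exI[of _ "min d r"] conjI ballI)
      show "0 < min d r" using d r by simp
      fix y assume y: "y \<in> ball ?p (min d r)"
      define k where "k = y - ?p"
      define n where "n = norm k"
      have n: "n \<ge> 0" "n < d" using y by (auto simp: n_def k_def dist_norm norm_minus_commute)
      have yU: "y \<in> U" using y r(2) by auto
      have mem: "y \<in> \<Omega> \<longleftrightarrow> y \<bullet> e < \<gamma> y" using \<Omega>U yU by blast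
      have shift: "y - c *\<^sub>R e - x = k" by (simp add: k_def c_def)
      have "\<gamma> (y - c *\<^sub>R e) = \<gamma> y" using inv[of "y" "- c"] by simp
      then have err: "\<bar>\<gamma> y - \<gamma> x - k \<bullet> g\<bar> \<le> (\<epsilon>/2) * n"
        using d(2)[of "y - c *\<^sub>R e"] n by (simp add: shift n_def)
      have ye: "y \<bullet> e = \<gamma> x + k \<bullet> e" using \<gamma>p by (simp add: k_def inner_diff_left)
      define a where "a = k \<bullet> ((e - g) /\<^sub>R N)"
      have a: "k \<bullet> (e - g) = N * a" using N1 by (simp add: a_def)
      have key: "y \<bullet> e - \<gamma> y \<ge> N * a - (\<epsilon>/2) * n" "y \<bullet> e - \<gamma> y \<le> N * a + (\<epsilon>/2) * n"
        using err[unfolded abs_le_iff] ye a[unfolded inner_diff_right] by linarith+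
      have \<epsilon>n: "0 \<le> \<epsilon> * n" using \<epsilon> n by simp
      have "y \<notin> \<Omega>" if "a > \<epsilon> * n"
      proof -
        have "0 < a" using that \<epsilon>n by linarith
        then have "N * a \<ge> a" using mult_right_mono[OF N1, of a] by simp
        then have "y \<bullet> e - \<gamma> y > 0" using key(1) that \<epsilon>n by linarith
        then show ?thesis using mem by simp
      qed
      moreover have "y \<in> \<Omega>" if "a < - (\<epsilon> * n)"
      proof -
        have "0 < - a" using that \<epsilon>n by linarith
        then have "N * (- a) \<ge> - a" using mult_right_mono[OF N1, of "- a"] by simp
        then have "y \<bullet> e - \<gamma> y < 0" using key(2) that \<epsilon>n by (simp only: mult_minus_right)
        then show ?thesis using mem by simp
      qed
      ultimately show "\<epsilon> * norm (y - ?p) < (y - ?p) \<bullet> ((e - g) /\<^sub>R N) \<longrightarrow> y \<notin> \<Omega>"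
        and "(y - ?p) \<bullet> ((e - g) /\<^sub>R N) < - (\<epsilon> * norm (y - ?p)) \<longrightarrow> y \<in> \<Omega>"
        by (simp_all add: a_def n_def k_def)
    qed
  qed
qed

text \<open>The normalization of the normal cancels the surface element.\<close>

lemma graph_integrand_flux_AE:
  fixes \<Omega> :: "'a::euclidean_space set"
  assumes chart: "lipschitz_chart \<Omega> e \<gamma> U" and supp: "closure {x. \<psi> x \<noteq> 0} \<subseteq> U"
  shows "AE x in lborel. graph_integrand e \<gamma> (\<lambda>x. \<psi> x * (F x \<bullet> outward_normal \<Omega> x)) x
    = \<psi> (graph_point e \<gamma> x) * (F (graph_point e \<gamma> x) \<bullet> (e - right_grad \<gamma> x))"
proof -
  obtain L where lip: "L-lipschitz_on UNIV \<gamma>" using chart by (auto simp: lipschitz_chart_def)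
  show ?thesis
    using rademacher[OF lip]
  proof eventually_elim
    fix x assume gd: "GDERIV \<gamma> x :> right_grad \<gamma> x"
    show "graph_integrand e \<gamma> (\<lambda>x. \<psi> x * (F x \<bullet> outward_normal \<Omega> x)) x
        = \<psi> (graph_point e \<gamma> x) * (F (graph_point e \<gamma> x) \<bullet> (e - right_grad \<gamma> x))"
    proof (cases "\<psi> (graph_point e \<gamma> x) = 0")
      case False
      then have "graph_point e \<gamma> x \<in> {x. \<psi> x \<noteq> 0}" by simp
      from subsetD[OF supp subsetD[OF closure_subset this]] have "graph_point e \<gamma> x \<in> U" .
      note n = outward_normal_graph[OF chart gd this]
      have "1 + (norm (right_grad \<gamma> x))\<^sup>2 > 0" by (simp add: add_pos_nonneg)
      then show ?thesis
        unfolding graph_integrand_def n grad_eq[OF gd] by simp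
    qed (simp add: graph_integrand_def)
  qed
qed

section \<open>The divergence theorem on bounded Lipschitz domains\<close>

text \<open>In \<open>C1_closure\<close> the derivative is continuous as a function into the space of all functions, that is, separately
  for each direction.  In finite dimensions this is continuity in the operator norm; this rule and the next one
  translate between the two.\<close>

lemma C1_closureE:
  fixes f :: "'a::euclidean_space \<Rightarrow> 'b::euclidean_space"
  assumes "C1_closure \<Omega> f"
  obtains f' :: "'a \<Rightarrow> 'a \<Rightarrow>\<^sub>L 'b" where "continuous_on (closure \<Omega>) f"
    "\<And>x. x \<in> \<Omega> \<Longrightarrow> (f has_derivative blinfun_apply (f' x)) (at x)" "continuous_on (closure \<Omega>) f'"
proof -
  obtain f' :: "'a \<Rightarrow> 'a \<Rightarrow>\<^sub>L 'b" where f': "\<forall>x\<in>\<Omega>. (f has_derivative blinfun_apply (f' x)) (at x)"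
      "continuous_on (closure \<Omega>) (\<lambda>x. blinfun_apply (f' x))"
    using assms unfolding C1_closure_def by (elim conjE exE)
  have "continuous_on (closure \<Omega>) f'"
    by (rule continuous_on_blinfun_componentwise) (rule continuous_on_product_then_coordinatewise[OF f'(2)])
  moreover have "continuous_on (closure \<Omega>) f" using assms unfolding C1_closure_def by (rule conjunct1)
  ultimately show ?thesis using f'(1) by (intro that[of f']) simp_all
qed

lemma C1_closureI:
  fixes f :: "'a::euclidean_space \<Rightarrow> 'b::euclidean_space" and f' :: "'a \<Rightarrow> 'a \<Rightarrow>\<^sub>L 'b"
  assumes "continuous_on (closure \<Omega>) f" "\<And>x. x \<in> \<Omega> \<Longrightarrow> (f has_derivative blinfun_apply (f' x)) (at x)"
    and f': "continuous_on (closure \<Omega>) f'"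
  shows "C1_closure \<Omega> f"
proof -
  have "continuous_on (closure \<Omega>) (\<lambda>x. blinfun_apply (f' x))"
    by (rule continuous_on_coordinatewise_then_product) (intro continuous_intros f')
  then show ?thesis
    unfolding C1_closure_def using assms by (intro conjI exI[of _ f']) simp_all
qed

lemma C1_closure_const: "C1_closure \<Omega> (\<lambda>_. c)"
  by (rule C1_closureI[where f' = "\<lambda>_. 0"]) (auto simp: zero_blinfun.rep_eq)

lemma C1_closure_add:
  fixes f g :: "'a::euclidean_space \<Rightarrow> 'b::euclidean_space"
  assumes "C1_closure \<Omega> f" "C1_closure \<Omega> g"
  shows "C1_closure \<Omega> (\<lambda>x. f x + g x)"
proof -
  from assms(1) obtain f' :: "'a \<Rightarrow> 'a \<Rightarrow>\<^sub>L 'b" where f: "continuous_on (closure \<Omega>) f"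
    "\<And>x. x \<in> \<Omega> \<Longrightarrow> (f has_derivative blinfun_apply (f' x)) (at x)" "continuous_on (closure \<Omega>) f'"
    by (rule C1_closureE) (rule that)
  from assms(2) obtain g' :: "'a \<Rightarrow> 'a \<Rightarrow>\<^sub>L 'b" where g: "continuous_on (closure \<Omega>) g"
    "\<And>x. x \<in> \<Omega> \<Longrightarrow> (g has_derivative blinfun_apply (g' x)) (at x)" "continuous_on (closure \<Omega>) g'"
    by (rule C1_closureE) (rule that)
  show ?thesis
  proof (rule C1_closureI[where f' = "\<lambda>x. f' x + g' x"])
    fix x assume "x \<in> \<Omega>"
    from has_derivative_add[OF f(2)[OF this] g(2)[OF this]]
    show "((\<lambda>x. f x + g x) has_derivative blinfun_apply (f' x + g' x)) (at x)"
      by (simp add: plus_blinfun.rep_eq)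
  qed (intro continuous_intros f g)+
qed

lemma C1_closure_scaleR:
  fixes f :: "'a::euclidean_space \<Rightarrow> real" and F :: "'a \<Rightarrow> 'b::euclidean_space"
  assumes "C1_closure \<Omega> f" "C1_closure \<Omega> F"
  shows "C1_closure \<Omega> (\<lambda>x. f x *\<^sub>R F x)"
proof -
  from assms(1) obtain f' :: "'a \<Rightarrow> 'a \<Rightarrow>\<^sub>L real" where f: "continuous_on (closure \<Omega>) f"
    "\<And>x. x \<in> \<Omega> \<Longrightarrow> (f has_derivative blinfun_apply (f' x)) (at x)" "continuous_on (closure \<Omega>) f'"
    by (rule C1_closureE) (rule that)
  from assms(2) obtain F' :: "'a \<Rightarrow> 'a \<Rightarrow>\<^sub>L 'b" where F: "continuous_on (closure \<Omega>) F"
    "\<And>x. x \<in> \<Omega> \<Longrightarrow> (F has_derivative blinfun_apply (F' x)) (at x)" "continuous_on (closure \<Omega>) F'"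
    by (rule C1_closureE) (rule that)
  show ?thesis
  proof (rule C1_closureI[where f' = "\<lambda>x. f x *\<^sub>R F' x + (blinfun_scaleR_left (F x) o\<^sub>L f' x)"])
    fix x assume "x \<in> \<Omega>"
    from has_derivative_scaleR[OF f(2)[OF this] F(2)[OF this]]
    show "((\<lambda>x. f x *\<^sub>R F x) has_derivative blinfun_apply (f x *\<^sub>R F' x + (blinfun_scaleR_left (F x) o\<^sub>L f' x))) (at x)"
      by (simp add: plus_blinfun.rep_eq scaleR_blinfun.rep_eq)
  qed (intro continuous_intros f F bounded_linear.continuous_on[OF bounded_linear_blinfun_scaleR_left])+
qed

lemma C1_closure_compose_real:
  fixes f :: "'a::euclidean_space \<Rightarrow> real" and g :: "real \<Rightarrow> real"
  assumes "C1_closure \<Omega> f" and S: "\<And>x. x \<in> closure \<Omega> \<Longrightarrow> f x \<in> S"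
    and g: "\<And>s. s \<in> S \<Longrightarrow> (g has_real_derivative g' s) (at s)" "continuous_on S g'"
  shows "C1_closure \<Omega> (\<lambda>x. g (f x))"
proof -
  from assms(1) obtain f' :: "'a \<Rightarrow> 'a \<Rightarrow>\<^sub>L real" where f: "continuous_on (closure \<Omega>) f"
    "\<And>x. x \<in> \<Omega> \<Longrightarrow> (f has_derivative blinfun_apply (f' x)) (at x)" "continuous_on (closure \<Omega>) f'"
    by (rule C1_closureE) (rule that)
  have cg: "continuous_on S g"
    using g(1) by (intro continuous_at_imp_continuous_on ballI DERIV_isCont) auto
  show ?thesis
  proof (rule C1_closureI[where f' = "\<lambda>x. g' (f x) *\<^sub>R f' x"])
    show "continuous_on (closure \<Omega>) (\<lambda>x. g (f x))"
      by (rule continuous_on_compose2[OF cg f(1)]) (use S in auto)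
    show "continuous_on (closure \<Omega>) (\<lambda>x. g' (f x) *\<^sub>R f' x)"
      by (intro continuous_intros f(3) continuous_on_compose2[OF g(2) f(1)]) (use S in auto)
    fix x assume x: "x \<in> \<Omega>"
    have "f x \<in> S" using S x closure_subset by blast
    from has_derivative_compose[OF f(2)[OF x] g(1)[OF this, unfolded has_field_derivative_def]]
    show "((\<lambda>x. g (f x)) has_derivative blinfun_apply (g' (f x) *\<^sub>R f' x)) (at x)"
      by (simp add: scaleR_blinfun.rep_eq)
  qed
qed

lemma C1_closure_dist_square:
  fixes z :: "'a::euclidean_space"
  shows "C1_closure \<Omega> (\<lambda>x. (norm (x - z))\<^sup>2)"
proof (rule C1_closureI[where f' = "\<lambda>x. 2 *\<^sub>R blinfun_inner_right (x - z)"])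
  show "continuous_on (closure \<Omega>) (\<lambda>x. 2 *\<^sub>R blinfun_inner_right (x - z))"
    by (intro continuous_intros bounded_linear.continuous_on[OF bounded_linear_blinfun_inner_right])
  fix x assume "x \<in> \<Omega>"
  have "((\<lambda>x. (x - z) \<bullet> (x - z)) has_derivative (\<lambda>h. (x - z) \<bullet> h + h \<bullet> (x - z))) (at x)"
    by (auto intro!: derivative_eq_intros)
  then show "((\<lambda>x. (norm (x - z))\<^sup>2) has_derivative blinfun_apply (2 *\<^sub>R blinfun_inner_right (x - z))) (at x)"
    by (simp add: power2_norm_eq_inner scaleR_blinfun.rep_eq inner_commute)
qed (intro continuous_intros)

lemma DERIV_square_positive_part: "((\<lambda>t::real. (max 0 t)\<^sup>2) has_real_derivative 2 * max 0 t) (at t)"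
proof -
  consider "t < 0" | "t = 0" | "t > 0" by linarith
  then show ?thesis
  proof cases
    case 1
    have "((\<lambda>_::real. 0::real) has_real_derivative 0) (at t)" by simp
    then have "((\<lambda>t::real. (max 0 t)\<^sup>2) has_real_derivative 0) (at t)"
      by (rule has_field_derivative_transform_within_open[of _ _ _ "{..<0}"]) (use 1 in auto)
    then show ?thesis using 1 by simp
  next
    case 2
    have "((\<lambda>h. ((max 0 h)\<^sup>2 - 0) / h) \<longlongrightarrow> (0::real)) (at 0)"
    proof (rule Lim_null_comparison)
      show "eventually (\<lambda>h::real. norm (((max 0 h)\<^sup>2 - 0) / h) \<le> \<bar>h\<bar>) (at 0)"
        by (rule always_eventually) (auto simp: max_def power2_eq_square)
      show "((\<lambda>h::real. \<bar>h\<bar>) \<longlongrightarrow> 0) (at 0)" using tendsto_rabs[OF tendsto_ident_at, of 0 UNIV] by simp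
    qed
    then show ?thesis using 2 by (simp add: has_field_derivative_iff)
  next
    case 3
    have "((\<lambda>t::real. t\<^sup>2) has_real_derivative 2 * t) (at t)" by (auto intro!: derivative_eq_intros)
    then have "((\<lambda>t::real. (max 0 t)\<^sup>2) has_real_derivative 2 * t) (at t)"
      by (rule has_field_derivative_transform_within_open[of _ _ _ "{0<..}"]) (use 3 in auto)
    then show ?thesis using 3 by simp
  qed
qed

text \<open>With \<open>c t = (max 0 t)\<^sup>2\<close>, which is \<open>C\<^sup>1\<close>, the function \<open>c (1 - c t)\<close> is one for \<open>t \<le> 0\<close> and zero for \<open>t \<ge> 1\<close>;
  it is composed with a quadratic function of the distance to \<open>z\<close>.\<close>

lemma C1_bump_exists:
  fixes z :: "'a::euclidean_space"
  assumes "\<rho> > 0"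
  obtains \<eta> :: "'a \<Rightarrow> real" where "C1_closure UNIV \<eta>" "\<And>x. 0 \<le> \<eta> x" "\<And>x. \<eta> x \<le> 1"
    "\<And>x. x \<in> cball z \<rho> \<Longrightarrow> \<eta> x = 1" "\<And>x. x \<notin> cball z (2 * \<rho>) \<Longrightarrow> \<eta> x = 0"
proof -
  define c :: "real \<Rightarrow> real" where "c t = (max 0 t)\<^sup>2" for t
  define q where "q x = (norm (x - z))\<^sup>2 * inverse (\<rho>\<^sup>2) - 1" for x
  have C1: "C1_closure UNIV (\<lambda>x. c (1 - c (q x)))"
  proof (rule C1_closure_compose_real[where f = q and g = "\<lambda>s. c (1 - c s)" and S = UNIV])
    show "C1_closure UNIV q"
      unfolding q_def
      by (rule C1_closure_compose_real[OF C1_closure_dist_square, where g = "\<lambda>s. s * inverse (\<rho>\<^sup>2) - 1" and g' = "\<lambda>_. inverse (\<rho>\<^sup>2)" and S = UNIV])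
        (auto intro!: derivative_eq_intros)
    show "((\<lambda>s. c (1 - c s)) has_real_derivative (2 * max 0 (1 - (max 0 s)\<^sup>2)) * (- (2 * max 0 s))) (at s)" for s
      unfolding c_def
      using DERIV_chain'[OF DERIV_diff[OF DERIV_const DERIV_square_positive_part] DERIV_square_positive_part, of 1 s]
      by simp
    show "continuous_on UNIV (\<lambda>s::real. (2 * max 0 (1 - (max 0 s)\<^sup>2)) * (- (2 * max 0 s)))"
      by (intro continuous_intros)
  qed auto
  show ?thesis
  proof (rule that[OF C1])
    show "0 \<le> c (1 - c (q x))" for x by (simp add: c_def)
    show "c (1 - c (q x)) \<le> 1" for x
      using power_mono[of "max 0 (1 - c (q x))" 1 2] by (simp add: c_def)
    show "c (1 - c (q x)) = 1" if "x \<in> cball z \<rho>" for x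
    proof -
      have "(norm (x - z))\<^sup>2 \<le> \<rho>\<^sup>2" using that by (intro power_mono) (auto simp: dist_norm norm_minus_commute)
      then have "q x \<le> 0" using assms by (simp add: q_def field_simps)
      then show ?thesis by (simp add: c_def)
    qed
    show "c (1 - c (q x)) = 0" if "x \<notin> cball z (2 * \<rho>)" for x
    proof -
      have "(2 * \<rho>)\<^sup>2 \<le> (norm (x - z))\<^sup>2" using that assms by (intro power_mono) (auto simp: dist_norm norm_minus_commute)
      then have "3 \<le> q x" using assms by (simp add: q_def field_simps power2_eq_square)
      then have "1 \<le> c (q x)" using power_mono[of 1 "q x" 2] by (simp add: c_def)
      then show ?thesis by (simp add: c_def)
    qed
  qed
qed

text \<open>With bump functions \<open>\<eta>\<^sub>k\<close> that are one on balls covering the frontier, put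
  \<open>\<psi>\<^sub>i = \<eta>\<^sub>i (1 - \<eta>\<^sub>0) \<dots> (1 - \<eta>\<^sub>i\<^sub>-\<^sub>1)\<close>.  The sum telescopes to one minus the product of all \<open>1 - \<eta>\<^sub>k\<close>, which is one wherever some bump function is one.\<close>

lemma boundary_partition_exists:
  fixes \<Omega> :: "'a::euclidean_space set"
  assumes dom: "bounded_lipschitz_domain \<Omega>"
  shows "\<exists>N e \<gamma> U \<psi>. boundary_partition \<Omega> N e \<gamma> U \<psi>"
proof -
  have "\<exists>e \<gamma> U \<rho>. lipschitz_chart \<Omega> e \<gamma> U \<and> \<rho> > 0 \<and> cball z (2 * \<rho>) \<subseteq> U" if z: "z \<in> frontier \<Omega>" for z
  proof -
    obtain e \<gamma> U where c: "z \<in> U" "lipschitz_chart \<Omega> e \<gamma> U"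
      using dom z unfolding bounded_lipschitz_domain_def by blast
    then have "open U" by (simp add: lipschitz_chart_def)
    then obtain r where "r > 0" "cball z r \<subseteq> U" using c(1) open_contains_cball by blast
    then show ?thesis using c(2) by (intro exI[of _ e] exI[of _ \<gamma>] exI[of _ U] exI[of _ "r/2"]) simp
  qed
  then obtain e \<gamma> U \<rho> where ch: "\<And>z. z \<in> frontier \<Omega> \<Longrightarrow> lipschitz_chart \<Omega> (e z) (\<gamma> z) (U z)"
    and \<rho>: "\<And>z. z \<in> frontier \<Omega> \<Longrightarrow> \<rho> z > 0" "\<And>z. z \<in> frontier \<Omega> \<Longrightarrow> cball z (2 * \<rho> z) \<subseteq> U z"
    by metis
  have "\<exists>\<eta>. C1_closure UNIV \<eta> \<and> (\<forall>x. 0 \<le> \<eta> x \<and> \<eta> x \<le> 1) \<and> (\<forall>x\<in>cball z (\<rho> z). \<eta> x = (1::real)) \<and>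
      (\<forall>x. x \<notin> cball z (2 * \<rho> z) \<longrightarrow> \<eta> x = 0)" if "z \<in> frontier \<Omega>" for z
    using C1_bump_exists[OF \<rho>(1)[OF that], of z] by metis
  then obtain \<eta> :: "'a \<Rightarrow> 'a \<Rightarrow> real" where \<eta>: "\<And>z. z \<in> frontier \<Omega> \<Longrightarrow> C1_closure UNIV (\<eta> z)"
      "\<And>z x. z \<in> frontier \<Omega> \<Longrightarrow> 0 \<le> \<eta> z x \<and> \<eta> z x \<le> 1"
      "\<And>z x. z \<in> frontier \<Omega> \<Longrightarrow> x \<in> cball z (\<rho> z) \<Longrightarrow> \<eta> z x = 1"
      "\<And>z x. z \<in> frontier \<Omega> \<Longrightarrow> x \<notin> cball z (2 * \<rho> z) \<Longrightarrow> \<eta> z x = 0"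
    by metis
  have "compact (frontier \<Omega>)" using dom by (simp add: bounded_lipschitz_domain_def compact_frontier_bounded)
  moreover have "frontier \<Omega> \<subseteq> (\<Union>z\<in>frontier \<Omega>. ball z (\<rho> z))" using \<rho>(1) by force
  ultimately obtain Z where Z: "Z \<subseteq> frontier \<Omega>" "finite Z" "frontier \<Omega> \<subseteq> (\<Union>z\<in>Z. ball z (\<rho> z))"
    using compactE_image[of "frontier \<Omega>" "frontier \<Omega>" "\<lambda>z. ball z (\<rho> z)"] by (metis open_ball)
  obtain N :: nat and \<zeta> where "bij_betw \<zeta> {0..<N} Z"
    using ex_bij_betw_nat_finite[OF Z(2)] by (metis)
  then have \<zeta>: "\<zeta> ` {0..<N} = Z" by (simp add: bij_betw_def)
  then have \<zeta>f: "\<zeta> i \<in> frontier \<Omega>" if "i < N" for i using Z(1) that by auto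
  define \<psi> where "\<psi> i x = \<eta> (\<zeta> i) x * (\<Prod>k<i. 1 - \<eta> (\<zeta> k) x)" for i x
  have C1p: "C1_closure UNIV (\<lambda>x. \<Prod>k<n. 1 - \<eta> (\<zeta> k) x)" if "n \<le> N" for n
    using that
  proof (induction n)
    case 0
    then show ?case by (simp add: C1_closure_const)
  next
    case (Suc n)
    have "C1_closure UNIV (\<lambda>x. 1 - \<eta> (\<zeta> n) x)"
      by (rule C1_closure_compose_real[OF \<eta>(1)[OF \<zeta>f], where g = "\<lambda>s. 1 - s" and g' = "\<lambda>_. - 1" and S = UNIV])
        (use Suc.prems in \<open>auto intro!: derivative_eq_intros\<close>)
    moreover have "C1_closure UNIV (\<lambda>x. \<Prod>k<n. 1 - \<eta> (\<zeta> k) x)" using Suc by simp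
    ultimately have "C1_closure UNIV (\<lambda>x. (\<Prod>k<n. 1 - \<eta> (\<zeta> k) x) *\<^sub>R (1 - \<eta> (\<zeta> n) x))"
      by (intro C1_closure_scaleR)
    then show ?case by simp
  qed
  have tele: "(\<Sum>i<n. \<psi> i x) = 1 - (\<Prod>k<n. 1 - \<eta> (\<zeta> k) x)" for n x
    by (induction n) (auto simp: \<psi>_def algebra_simps)
  have "boundary_partition \<Omega> N (\<lambda>i. e (\<zeta> i)) (\<lambda>i. \<gamma> (\<zeta> i)) (\<lambda>i. U (\<zeta> i)) \<psi>"
    unfolding boundary_partition_def
  proof (intro conjI allI impI ballI)
    fix i assume i: "i < N"
    note z = \<zeta>f[OF i]
    show "lipschitz_chart \<Omega> (e (\<zeta> i)) (\<gamma> (\<zeta> i)) (U (\<zeta> i))" by (rule ch[OF z])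
    have "C1_closure UNIV (\<lambda>x. \<eta> (\<zeta> i) x *\<^sub>R (\<Prod>k<i. 1 - \<eta> (\<zeta> k) x))"
      by (intro C1_closure_scaleR \<eta>(1)[OF z] C1p) (use i in simp)
    then show "C1_closure UNIV (\<psi> i)" by (simp add: \<psi>_def[abs_def])
    show "0 \<le> \<psi> i x" for x
      unfolding \<psi>_def using \<eta>(2)[OF z] \<eta>(2)[OF \<zeta>f] i
      by (intro mult_nonneg_nonneg prod_nonneg) auto
    have "{x. \<psi> i x \<noteq> 0} \<subseteq> cball (\<zeta> i) (2 * \<rho> (\<zeta> i))"
    proof
      fix x assume "x \<in> {x. \<psi> i x \<noteq> 0}"
      then have "\<eta> (\<zeta> i) x \<noteq> 0" by (simp add: \<psi>_def)
      then show "x \<in> cball (\<zeta> i) (2 * \<rho> (\<zeta> i))" using \<eta>(4)[OF z] by blast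
    qed
    then have cl: "closure {x. \<psi> i x \<noteq> 0} \<subseteq> cball (\<zeta> i) (2 * \<rho> (\<zeta> i))"
      by (intro closure_minimal) auto
    then show "closure {x. \<psi> i x \<noteq> 0} \<subseteq> U (\<zeta> i)" using \<rho>(2)[OF z] by blast
    show "compact (closure {x. \<psi> i x \<noteq> 0})"
      using cl bounded_subset[OF bounded_cball] by (auto simp: compact_eq_bounded_closed)
  next
    fix x assume "x \<in> frontier \<Omega>"
    then obtain z where z: "z \<in> Z" "x \<in> ball z (\<rho> z)" using Z(3) by blast
    then obtain k where k: "k < N" "z = \<zeta> k" using \<zeta> by auto
    have "\<eta> (\<zeta> k) x = 1" using \<eta>(3)[of z x] z Z(1) k by auto
    then have "(\<Prod>k<N. 1 - \<eta> (\<zeta> k) x) = 0" using k(1) by (intro prod_zero) auto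
    then show "(\<Sum>i<N. \<psi> i x) = 1" by (simp add: tele)
  qed
  then show ?thesis by blast
qed

text \<open>The partition sums to one on the frontier only, possibly on no neighbourhood of it.  The interior remainder
  \<open>(1 - \<Psi>) f\<close> therefore need not have compact support in \<open>\<Omega>\<close>, but it vanishes on the frontier, which suffices.\<close>

lemma boundary_partition_sum_integrals:
  fixes \<Omega> :: "'a::euclidean_space set" and f :: "'a \<Rightarrow> real" and f' :: "'a \<Rightarrow> 'a \<Rightarrow>\<^sub>L real" and v :: 'a
  assumes \<Omega>: "open \<Omega>" "bounded \<Omega>" and part: "boundary_partition \<Omega> N e \<gamma> U \<psi>"
    and f: "continuous_on (closure \<Omega>) f" "\<And>x. x \<in> \<Omega> \<Longrightarrow> (f has_derivative blinfun_apply (f' x)) (at x)"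
      "continuous_on (closure \<Omega>) f'"
  defines "S \<equiv> \<lambda>i x. indicator (slab (e i)) x * (\<psi> i (graph_point (e i) (\<gamma> i) x) * f (graph_point (e i) (\<gamma> i) x)
      * (v \<bullet> (e i - right_grad (\<gamma> i) x)))"
  shows "\<And>i. i < N \<Longrightarrow> integrable lborel (S i)"
    and "(\<Sum>i<N. LBINT x. S i x) = (LBINT x. indicator \<Omega> x * f' x v)"
proof -
  have P: "lipschitz_chart \<Omega> (e i) (\<gamma> i) (U i)" "C1_closure UNIV (\<psi> i)"
     "compact (closure {x. \<psi> i x \<noteq> 0})" "closure {x. \<psi> i x \<noteq> 0} \<subseteq> U i" if "i < N" for i
    using part that by (auto simp: boundary_partition_def)
  have one: "(\<Sum>i<N. \<psi> i x) = 1" if "x \<in> frontier \<Omega>" for x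
    using part that by (auto simp: boundary_partition_def)
  have "\<exists>\<psi>'i :: 'a \<Rightarrow> 'a \<Rightarrow>\<^sub>L real. (\<forall>x. (\<psi> i has_derivative blinfun_apply (\<psi>'i x)) (at x)) \<and> continuous_on UNIV \<psi>'i"
    if "i < N" for i
    using P(2)[OF that] by (rule C1_closureE) auto
  then obtain \<psi>' :: "nat \<Rightarrow> 'a \<Rightarrow> 'a \<Rightarrow>\<^sub>L real" where \<psi>': "\<And>i x. i < N \<Longrightarrow> (\<psi> i has_derivative blinfun_apply (\<psi>' i x)) (at x)"
    "\<And>i. i < N \<Longrightarrow> continuous_on UNIV (\<psi>' i)" by metis
  have c\<psi>: "continuous_on A (\<psi> i)" if "i < N" for A i
    using \<psi>'(1)[OF that] by (intro continuous_at_imp_continuous_on ballI has_derivative_continuous) auto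
  have bl: "\<bar>blinfun_apply g h\<bar> \<le> B * norm h" if "norm g \<le> B" for g :: "'a \<Rightarrow>\<^sub>L real" and h B
    using norm_blinfun[of g h] mult_right_mono[OF that norm_ge_zero, of h] by simp
  have cl: "x \<in> closure \<Omega>" if "x \<in> \<Omega>" for x using that closure_subset by blast
  obtain B where B: "\<And>x. x \<in> closure \<Omega> \<Longrightarrow> norm (f' x) \<le> B" using bounded_on_closure[OF \<Omega>(2) f(3)] by blast
  have bf: "\<bar>f' x h\<bar> \<le> B * norm h" if "x \<in> \<Omega>" for x h by (rule bl[OF B[OF cl[OF that]]])
  have main: "integrable lborel (S i) \<and>
      (LBINT x. indicator \<Omega> x * (\<psi> i x * f' x v + \<psi>' i x v * f x)) = (LBINT x. S i x)" if i: "i < N" for i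
  proof -
    obtain B\<^sub>\<psi> where B\<^sub>\<psi>: "\<And>x. x \<in> closure \<Omega> \<Longrightarrow> norm (\<psi>' i x) \<le> B\<^sub>\<psi>"
      using bounded_on_closure[OF \<Omega>(2) continuous_on_subset[OF \<psi>'(2)[OF i]]] by auto
    have b\<psi>: "\<bar>\<psi>' i x h\<bar> \<le> B\<^sub>\<psi> * norm h" if "x \<in> \<Omega>" for x h by (rule bl[OF B\<^sub>\<psi>[OF cl[OF that]]])
    note d = divergence_theorem_in_chart[where f' = "\<lambda>x. blinfun_apply (f' x)" and \<psi>' = "\<lambda>x. blinfun_apply (\<psi>' i x)"
        and v = v, OF \<Omega> P(1)[OF i] f(1) f(2) bf \<psi>'(1)[OF i] b\<psi> P(3)[OF i] P(4)[OF i]]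
    show ?thesis unfolding S_def using d by simp
  qed
  then show "\<And>i. i < N \<Longrightarrow> integrable lborel (S i)" by blast
  define \<Psi> where "\<Psi> x = (\<Sum>i<N. \<psi> i x)" for x
  define \<Psi>' where "\<Psi>' x = (\<Sum>i<N. \<psi>' i x)" for x
  have c\<Psi>: "continuous_on (closure \<Omega>) \<Psi>" unfolding \<Psi>_def by (intro continuous_intros c\<psi>) auto
  have c\<Psi>': "continuous_on (closure \<Omega>) \<Psi>'"
    unfolding \<Psi>'_def using continuous_on_subset[OF \<psi>'(2)] by (intro continuous_on_sum) auto
  have d\<Psi>: "(\<Psi> has_derivative blinfun_apply (\<Psi>' x)) (at x)" for x
  proof -
    have "blinfun_apply (\<Psi>' x) = (\<lambda>h. \<Sum>i<N. blinfun_apply (\<psi>' i x) h)"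
      by (simp add: fun_eq_iff \<Psi>'_def blinfun.sum_left)
    then show ?thesis unfolding \<Psi>_def using \<psi>'(1) by (simp only:) (intro has_derivative_sum, simp)
  qed
  \<comment> \<open>The derivative of \<open>(1 - \<Psi>) f\<close>.\<close>
  define w' where "w' x = (1 - \<Psi> x) *\<^sub>R f' x - f x *\<^sub>R \<Psi>' x" for x
  have cw': "continuous_on (closure \<Omega>) w'" unfolding w'_def by (intro continuous_intros f c\<Psi> c\<Psi>')
  obtain B' where B': "0 \<le> B'" "\<And>x. x \<in> closure \<Omega> \<Longrightarrow> norm (w' x) \<le> B'"
    using bounded_on_closure[OF \<Omega>(2) cw'] by blast
  have zero: "(LBINT x. indicator \<Omega> x * w' x v) = 0"
  proof (rule integral_derivative_vanishing_on_frontier[OF \<Omega>, where f = "\<lambda>x. (1 - \<Psi> x) * f x" and B = B'])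
    show "continuous_on (closure \<Omega>) (\<lambda>x. (1 - \<Psi> x) * f x)" by (intro continuous_intros c\<Psi> f)
    show "(1 - \<Psi> x) * f x = 0" if "x \<in> frontier \<Omega>" for x using one[OF that] by (simp add: \<Psi>_def)
    show "\<bar>w' x h\<bar> \<le> B' * norm h" if "x \<in> \<Omega>" for x h by (rule bl[OF B'(2)[OF cl[OF that]]])
    show "((\<lambda>x. (1 - \<Psi> x) * f x) has_derivative blinfun_apply (w' x)) (at x)" if "x \<in> \<Omega>" for x
      by (rule has_derivative_eq_rhs, rule has_derivative_mult,
          rule has_derivative_diff[OF has_derivative_const d\<Psi>], rule f(2)[OF that])
        (auto simp: w'_def fun_eq_iff blinfun.diff_left blinfun.scaleR_left)
  qed fact
  have int: "integrable lborel (\<lambda>x. indicator \<Omega> x * g x v)" if "continuous_on (closure \<Omega>) g" for g :: "'a \<Rightarrow> 'a \<Rightarrow>\<^sub>L real"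
    by (intro integrable_indicator_continuous_closure \<Omega> continuous_intros that)
  have split: "indicator \<Omega> x * f' x v = indicator \<Omega> x * w' x v
      + (\<Sum>i<N. indicator \<Omega> x * (\<psi> i x *\<^sub>R f' x + f x *\<^sub>R \<psi>' i x) v)" for x
  proof -
    have sm: "(\<Sum>i<N. (\<psi> i x *\<^sub>R f' x + f x *\<^sub>R \<psi>' i x) v) = \<Psi> x * f' x v + f x * \<Psi>' x v"
      by (simp add: \<Psi>_def \<Psi>'_def blinfun.add_left blinfun.scaleR_left blinfun.sum_left sum.distrib
          sum_distrib_left sum_distrib_right)
    have w: "w' x v = (1 - \<Psi> x) * f' x v - f x * \<Psi>' x v"
      by (simp only: w'_def blinfun.diff_left blinfun.scaleR_left real_scaleR_def)
    have "w' x v + (\<Sum>i<N. (\<psi> i x *\<^sub>R f' x + f x *\<^sub>R \<psi>' i x) v) = f' x v"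
      unfolding sm w by (simp add: algebra_simps)
    then have "indicator \<Omega> x * f' x v = indicator \<Omega> x * (w' x v + (\<Sum>i<N. (\<psi> i x *\<^sub>R f' x + f x *\<^sub>R \<psi>' i x) v))"
      by simp
    then show ?thesis by (simp only: distrib_left sum_distrib_left)
  qed
  have ii: "integrable lborel (\<lambda>x. indicator \<Omega> x * (\<psi> i x *\<^sub>R f' x + f x *\<^sub>R \<psi>' i x) v)" if "i < N" for i
    by (intro int continuous_intros c\<psi> f that continuous_on_subset[OF \<psi>'(2)]) auto
  define k where "k i x = indicator \<Omega> x * (\<psi> i x *\<^sub>R f' x + f x *\<^sub>R \<psi>' i x) v" for i x
  have ik: "integrable lborel (k i)" if "i < N" for i using ii[OF that] by (simp add: k_def[abs_def])
  have k: "k i x = indicator \<Omega> x * (\<psi> i x * f' x v + \<psi>' i x v * f x)" for i x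
    by (simp add: k_def blinfun.add_left blinfun.scaleR_left)
  have iK: "integrable lborel (\<lambda>x. \<Sum>i<N. k i x)" using ik by (intro Bochner_Integration.integrable_sum) auto
  have "(LBINT x. indicator \<Omega> x * f' x v) = (LBINT x. indicator \<Omega> x * w' x v + (\<Sum>i<N. k i x))"
    unfolding k_def by (rule Bochner_Integration.integral_cong[OF refl split])
  also have "\<dots> = (LBINT x. indicator \<Omega> x * w' x v) + (LBINT x. (\<Sum>i<N. k i x))"
    by (rule Bochner_Integration.integral_add[OF int[OF cw'] iK])
  also have "\<dots> = (\<Sum>i<N. LBINT x. k i x)"
    unfolding zero using ik by (subst Bochner_Integration.integral_sum) auto
  also have "\<dots> = (\<Sum>i<N. LBINT x. S i x)"
    using main by (intro sum.cong refl) (auto simp only: k lessThan_iff)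
  finally show "(\<Sum>i<N. LBINT x. S i x) = (LBINT x. indicator \<Omega> x * f' x v)" by simp
qed

lemma divergence_eq:
  assumes "(F has_derivative F') (at x)"
  shows "divergence F x = (\<Sum>i\<in>Basis. F' i \<bullet> i)"
  using frechet_derivative_at[OF assms] by (simp add: divergence_def)

text \<open>Apply the scalar formula to each component \<open>G \<bullet> j\<close> in direction \<open>j\<close> and add.\<close>

lemma has_surface_integral_flux:
  fixes \<Omega> :: "'a::euclidean_space set"
  assumes dom: "bounded_lipschitz_domain \<Omega>" and G: "C1_closure \<Omega> G"
  shows "has_surface_integral (\<lambda>x. G x \<bullet> outward_normal \<Omega> x) (set_lebesgue_integral lebesgue \<Omega> (divergence G)) \<Omega>"
  unfolding has_surface_integral_def
proof (intro allI impI)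
  fix N e \<gamma> U \<psi> assume part: "boundary_partition \<Omega> N e \<gamma> U \<psi>"
  have \<Omega>: "open \<Omega>" "bounded \<Omega>" using dom by (auto simp: bounded_lipschitz_domain_def)
  have P: "lipschitz_chart \<Omega> (e i) (\<gamma> i) (U i)" "closure {x. \<psi> i x \<noteq> 0} \<subseteq> U i" if "i < N" for i
    using part that by (auto simp: boundary_partition_def)
  from G obtain G' :: "'a \<Rightarrow> 'a \<Rightarrow>\<^sub>L 'a" where G': "continuous_on (closure \<Omega>) G"
    "\<And>x. x \<in> \<Omega> \<Longrightarrow> (G has_derivative blinfun_apply (G' x)) (at x)" "continuous_on (closure \<Omega>) G'"
    by (rule C1_closureE) (rule that)
  define S where "S j i x = indicator (slab (e i)) x * (\<psi> i (graph_point (e i) (\<gamma> i) x) * (G (graph_point (e i) (\<gamma> i) x) \<bullet> j)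
      * (j \<bullet> (e i - right_grad (\<gamma> i) x)))" for j i x
  define F' where "F' j x = blinfun_inner_left j o\<^sub>L G' x" for j x
  have F': "blinfun_apply (F' j x) = (\<lambda>h. G' x h \<bullet> j)" for j x
    by (simp add: fun_eq_iff F'_def blinfun_inner_left.rep_eq)
  have comp: "(\<forall>i<N. integrable lborel (S j i)) \<and> (\<Sum>i<N. LBINT x. S j i x) = (LBINT x. indicator \<Omega> x * (G' x j \<bullet> j))"
    if "j \<in> Basis" for j
  proof -
    have c: "continuous_on (closure \<Omega>) (\<lambda>x. G x \<bullet> j)" by (intro continuous_intros G')
    have d: "((\<lambda>x. G x \<bullet> j) has_derivative blinfun_apply (F' j x)) (at x)" if "x \<in> \<Omega>" for x
      using has_derivative_inner_left[OF G'(2)[OF that], of j] by (simp add: F')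
    have c': "continuous_on (closure \<Omega>) (F' j)"
      unfolding F'_def by (intro continuous_intros G')
    from boundary_partition_sum_integrals[OF \<Omega> part c d c', where v = j]
    show ?thesis by (simp add: S_def[abs_def] F')
  qed
  let ?g = "\<lambda>i. graph_integrand (e i) (\<gamma> i) (\<lambda>x. \<psi> i x * (G x \<bullet> outward_normal \<Omega> x))"
  define T where "T i x = (\<Sum>j\<in>Basis. S j i x)" for i x
  have iT: "integrable lborel (T i)" if "i < N" for i
    unfolding T_def using comp that by (intro Bochner_Integration.integrable_sum) auto
  have ae: "AE x in lborel. indicator (slab (e i)) x *\<^sub>R ?g i x = T i x"
    if "i < N" for i
    using graph_integrand_flux_AE[OF P[OF that], of G]
  proof eventually_elim
    fix x
    let ?p = "graph_point (e i) (\<gamma> i) x"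
    assume eq: "?g i x
      = \<psi> i ?p * (G ?p \<bullet> (e i - right_grad (\<gamma> i) x))"
    have "T i x = indicator (slab (e i)) x * (\<psi> i ?p * (\<Sum>j\<in>Basis. (G ?p \<bullet> j) * (j \<bullet> (e i - right_grad (\<gamma> i) x))))"
      by (simp add: T_def S_def sum_distrib_left mult.assoc)
    also have "(\<Sum>j\<in>Basis. (G ?p \<bullet> j) * (j \<bullet> (e i - right_grad (\<gamma> i) x))) = G ?p \<bullet> (e i - right_grad (\<gamma> i) x)"
      by (subst (2) euclidean_inner) (simp add: inner_commute)
    finally show "indicator (slab (e i)) x *\<^sub>R ?g i x = T i x"
      by (simp add: eq)
  qed
  have "set_integrable lebesgue (slab (e i)) (?g i)"
    if "i < N" for i
    unfolding set_integrable_def by (rule lebesgue_integral_AE_eq_lborel(1)[OF iT[OF that] ae[OF that]])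
  moreover have "(\<Sum>i<N. set_lebesgue_integral lebesgue (slab (e i)) (?g i))
      = set_lebesgue_integral lebesgue \<Omega> (divergence G)"
  proof -
    have "(\<Sum>i<N. set_lebesgue_integral lebesgue (slab (e i)) (?g i))
      = (\<Sum>i<N. LBINT x. T i x)"
      unfolding set_lebesgue_integral_def
      by (intro sum.cong refl lebesgue_integral_AE_eq_lborel(2) iT ae) auto
    also have "\<dots> = (\<Sum>i<N. \<Sum>j\<in>Basis. LBINT x. S j i x)"
      unfolding T_def using comp by (intro sum.cong refl Bochner_Integration.integral_sum) auto
    also have "\<dots> = (\<Sum>j\<in>Basis. \<Sum>i<N. LBINT x. S j i x)" by (rule sum.swap)
    also have "\<dots> = (\<Sum>j\<in>Basis. LBINT x. indicator \<Omega> x * (G' x j \<bullet> j))"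
      using comp by (intro sum.cong) auto
    also have "\<dots> = (LBINT x. (\<Sum>j\<in>Basis. indicator \<Omega> x * (G' x j \<bullet> j)))"
      by (intro Bochner_Integration.integral_sum[symmetric] integrable_indicator_continuous_closure \<Omega> continuous_intros G')
    also have "\<dots> = set_lebesgue_integral lebesgue \<Omega> (divergence G)"
      unfolding set_lebesgue_integral_def
    proof (rule lebesgue_integral_AE_eq_lborel(2)[symmetric])
      show "integrable lborel (\<lambda>x. \<Sum>j\<in>Basis. indicator \<Omega> x * (G' x j \<bullet> j))"
        by (intro Bochner_Integration.integrable_sum integrable_indicator_continuous_closure \<Omega> continuous_intros G')
      show "AE x in lborel. indicator \<Omega> x *\<^sub>R divergence G x = (\<Sum>j\<in>Basis. indicator \<Omega> x * (G' x j \<bullet> j))"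
      proof (rule AE_I2)
        fix x
        show "indicator \<Omega> x *\<^sub>R divergence G x = (\<Sum>j\<in>Basis. indicator \<Omega> x * (G' x j \<bullet> j))"
          using divergence_eq[OF G'(2)[of x]] by (cases "x \<in> \<Omega>") auto
      qed
    qed
    finally show ?thesis .
  qed
  ultimately show "(\<forall>i<N. set_integrable lebesgue (slab (e i)) (?g i)) \<and>
      (\<Sum>i<N. set_lebesgue_integral lebesgue (slab (e i)) (?g i))
        = set_lebesgue_integral lebesgue \<Omega> (divergence G)" by blast
qed

text \<open>The surface integral is a definite description, and if \<open>\<Omega>\<close> had no boundary partition, every number would satisfy it;
  uniqueness is where the existence of a partition enters.\<close>

theorem divergence_theorem:
  fixes \<Omega> :: "'a::euclidean_space set"
  assumes dom: "bounded_lipschitz_domain \<Omega>" and G: "C1_closure \<Omega> G"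
  shows "surface_integral \<Omega> (\<lambda>x. G x \<bullet> outward_normal \<Omega> x) = set_lebesgue_integral lebesgue \<Omega> (divergence G)"
  unfolding surface_integral_def
proof (rule the_equality)
  show H: "has_surface_integral (\<lambda>x. G x \<bullet> outward_normal \<Omega> x) (set_lebesgue_integral lebesgue \<Omega> (divergence G)) \<Omega>"
    by (rule has_surface_integral_flux[OF assms])
  fix I assume I: "has_surface_integral (\<lambda>x. G x \<bullet> outward_normal \<Omega> x) I \<Omega>"
  obtain N e \<gamma> U \<psi> where p: "boundary_partition \<Omega> N e \<gamma> U \<psi>"
    using boundary_partition_exists[OF dom] by blast
  show "I = set_lebesgue_integral lebesgue \<Omega> (divergence G)"
    using conjunct2[OF H[unfolded has_surface_integral_def, rule_format, OF p]]
      conjunct2[OF I[unfolded has_surface_integral_def, rule_format, OF p]] by simp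
qed

section \<open>The energy balance\<close>

lemma divergence_add:
  assumes "(F has_derivative F') (at x)" "(G has_derivative G') (at x)"
  shows "divergence (\<lambda>x. F x + G x) x = divergence F x + divergence G x"
  unfolding divergence_eq[OF has_derivative_add[OF assms]] divergence_eq[OF assms(1)] divergence_eq[OF assms(2)]
  by (simp add: inner_add_left sum.distrib)

text \<open>The term \<open>f' (F x)\<close> is \<open>grad f \<bullet> F\<close>.\<close>

lemma divergence_scaleR:
  fixes f :: "'a::euclidean_space \<Rightarrow> real"
  assumes f: "(f has_derivative f') (at x)" and F: "(F has_derivative F') (at x)"
  shows "divergence (\<lambda>x. f x *\<^sub>R F x) x = f x * divergence F x + f' (F x)"
proof -
  have lin: "linear f'" by (rule has_derivative_linear[OF f])
  have "f' (F x) = f' (\<Sum>i\<in>Basis. (F x \<bullet> i) *\<^sub>R i)" by (simp add: euclidean_representation)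
  also have "\<dots> = (\<Sum>i\<in>Basis. (F x \<bullet> i) * f' i)" by (simp add: linear_sum[OF lin] linear_scale[OF lin])
  finally have "f' (F x) = (\<Sum>i\<in>Basis. f' i * (F x \<bullet> i))" by (simp add: mult.commute)
  then show ?thesis
    unfolding divergence_eq[OF has_derivative_scaleR[OF f F]] divergence_eq[OF F]
    by (simp add: inner_add_left sum.distrib sum_distrib_left)
qed

lemma integrable_mult_divergence:
  assumes "open \<Omega>" "bounded \<Omega>" and g: "continuous_on (closure \<Omega>) g" and G: "C1_closure \<Omega> G"
  shows "integrable lborel (\<lambda>x. indicator \<Omega> x * (g x * divergence G x))"
proof -
  from G obtain G' :: "'a \<Rightarrow> 'a \<Rightarrow>\<^sub>L 'a" where G': "continuous_on (closure \<Omega>) G"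
    "\<And>x. x \<in> \<Omega> \<Longrightarrow> (G has_derivative blinfun_apply (G' x)) (at x)" "continuous_on (closure \<Omega>) G'"
    by (rule C1_closureE) (rule that)
  have "integrable lborel (\<lambda>x. indicator \<Omega> x * (g x * (\<Sum>j\<in>Basis. G' x j \<bullet> j)))"
    by (intro integrable_indicator_continuous_closure assms continuous_intros G')
  moreover have "(\<lambda>x. indicator \<Omega> x * (g x * (\<Sum>j\<in>Basis. G' x j \<bullet> j))) = (\<lambda>x. indicator \<Omega> x * (g x * divergence G x))"
    using divergence_eq[OF G'(2)] by (auto simp: fun_eq_iff indicator_def)
  ultimately show ?thesis by simp
qed

lemma energy_eq_lborel:
  assumes "open \<Omega>" "bounded \<Omega>" "continuous_on (closure \<Omega>) (\<lambda>x. h (w x))"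
  shows "energy \<Omega> h w = (LBINT x. indicator \<Omega> x * h (w x))"
  unfolding energy_def set_lebesgue_integral_def
  by (rule lebesgue_integral_AE_eq_lborel(2)[OF integrable_indicator_continuous_closure[OF assms]]) simp

text \<open>Differentiation under the integral sign; compactness of \<open>[t - \<delta>, t + \<delta>] \<times> closure \<Omega>\<close> gives a constant majorant for the
  difference quotients.\<close>

lemma energy_has_real_derivative:
  fixes \<Omega> :: "'a::euclidean_space set" and u v :: "real \<Rightarrow> 'a \<Rightarrow> real"
  assumes \<Omega>: "open \<Omega>" "bounded \<Omega>" and t: "t \<in> {0<..<T}"
    and h: "\<And>s. 0 < s \<Longrightarrow> (h has_real_derivative h' s) (at s)" and ch': "continuous_on {0<..} h'"
    and pos: "\<And>t x. t \<in> {0<..<T} \<Longrightarrow> x \<in> closure \<Omega> \<Longrightarrow> 0 < u t x"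
    and cu: "continuous_on ({0<..<T} \<times> closure \<Omega>) (\<lambda>(t, x). u t x)"
    and cv: "continuous_on ({0<..<T} \<times> closure \<Omega>) (\<lambda>(t, x). v t x)"
    and uv: "\<And>t x. t \<in> {0<..<T} \<Longrightarrow> x \<in> \<Omega> \<Longrightarrow> ((\<lambda>s. u s x) has_real_derivative v t x) (at t)"
  shows "((\<lambda>s. energy \<Omega> h (u s)) has_real_derivative
    (LBINT x. indicator \<Omega> x * (h' (u t x) * v t x))) (at t)"
proof -
  have [measurable]: "\<Omega> \<in> sets borel" using \<Omega> by simp
  have ch: "continuous_on {0<..} h"
    using h by (intro continuous_at_imp_continuous_on ballI DERIV_isCont) auto
  have cl: "x \<in> closure \<Omega>" if "x \<in> \<Omega>" for x using that closure_subset by blast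
  have cut: "continuous_on (closure \<Omega>) (u s)" if "s \<in> {0<..<T}" for s
    using continuous_on_compose2[OF cu continuous_on_Pair[OF continuous_on_const continuous_on_id], of s "closure \<Omega>"] that
    by (simp add: image_subset_iff)
  have cvt: "continuous_on (closure \<Omega>) (v s)" if "s \<in> {0<..<T}" for s
    using continuous_on_compose2[OF cv continuous_on_Pair[OF continuous_on_const continuous_on_id], of s "closure \<Omega>"] that
    by (simp add: image_subset_iff)
  have chu: "continuous_on (closure \<Omega>) (\<lambda>x. h (u s x))" if "s \<in> {0<..<T}" for s
    by (rule continuous_on_compose2[OF ch cut[OF that]]) (use pos that in auto)
  have chu': "continuous_on (closure \<Omega>) (\<lambda>x. h' (u s x) * v s x)" if "s \<in> {0<..<T}" for s
    by (intro continuous_intros cvt that continuous_on_compose2[OF ch' cut[OF that]]) (use pos that in auto)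
  define \<delta> where "\<delta> = min t (T - t) / 2"
  have \<delta>: "\<delta> > 0" and sub: "{t - \<delta>..t + \<delta>} \<subseteq> {0<..<T}" using t by (auto simp: \<delta>_def min_def field_simps)
  obtain C where C: "C \<ge> 0" "\<And>s x. s \<in> {t - \<delta>..t + \<delta>} \<Longrightarrow> x \<in> closure \<Omega> \<Longrightarrow> \<bar>h' (u s x) * v s x\<bar> \<le> C"
  proof -
    let ?f = "\<lambda>p. h' (case p of (t, x) \<Rightarrow> u t x) * (case p of (t, x) \<Rightarrow> v t x)"
    let ?Q = "{t - \<delta>..t + \<delta>} \<times> closure \<Omega>"
    have "compact ?Q"
      using \<Omega> by (intro compact_Times) (auto simp: compact_closure)
    moreover have "continuous_on ({0<..<T} \<times> closure \<Omega>) ?f"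
      by (intro continuous_intros cv continuous_on_compose2[OF ch' cu]) (use pos in auto)
    then have "continuous_on ?Q ?f"
      by (rule continuous_on_subset) (use sub in auto)
    ultimately have "bounded (?f ` ?Q)"
      by (intro compact_imp_bounded compact_continuous_image)
    then obtain C where "\<forall>y\<in>?f ` ?Q. norm y \<le> C"
      by (auto simp only: bounded_iff)
    then have "\<bar>h' (u s x) * v s x\<bar> \<le> C" if "s \<in> {t - \<delta>..t + \<delta>}" "x \<in> closure \<Omega>" for s x
      using that by force
    then have "\<bar>h' (u s x) * v s x\<bar> \<le> max 0 C" if "s \<in> {t - \<delta>..t + \<delta>}" "x \<in> closure \<Omega>" for s x
      using that by (meson max.coboundedI2)
    then show ?thesis by (intro that[of "max 0 C"]) auto
  qed
  have dh: "((\<lambda>s. h (u s x)) has_real_derivative h' (u s x) * v s x) (at s)" if "s \<in> {0<..<T}" "x \<in> \<Omega>" for s x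
    using DERIV_chain'[OF uv[OF that] h[OF pos[OF that(1) cl[OF that(2)]]]] .
  have lip: "\<bar>h (u s x) - h (u t x)\<bar> \<le> C * \<bar>s - t\<bar>" if "s \<in> {t - \<delta>..t + \<delta>}" "x \<in> \<Omega>" for s x
  proof -
    have "norm (h (u s x) - h (u t x)) \<le> C * norm (s - t)"
    proof (rule field_differentiable_bound[where S = "{t - \<delta>..t + \<delta>}" and f = "\<lambda>s. h (u s x)" and f' = "\<lambda>s. h' (u s x) * v s x"])
      fix z assume z: "z \<in> {t - \<delta>..t + \<delta>}"
      show "((\<lambda>s. h (u s x)) has_real_derivative h' (u z x) * v z x) (at z within {t - \<delta>..t + \<delta>})"
        by (rule has_field_derivative_at_within[OF dh[OF subsetD[OF sub z] that(2)]])
      show "norm (h' (u z x) * v z x) \<le> C" using C(2)[OF z cl[OF that(2)]] by simp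
    qed (use that \<delta> in auto)
    then show ?thesis by simp
  qed
  obtain R where R: "\<And>x. x \<in> \<Omega> \<Longrightarrow> norm x \<le> R" using \<Omega> by (auto simp: bounded_iff)
  define E where "E s = (LBINT x. indicator \<Omega> x * h (u s x))" for s
  have E: "energy \<Omega> h (u s) = E s" if "s \<in> {0<..<T}" for s
    unfolding E_def by (rule energy_eq_lborel[where w = "u s", OF \<Omega> chu[OF that]])
  let ?D = "LBINT x. indicator \<Omega> x * (h' (u t x) * v t x)"
  have "((\<lambda>s. (E s - E t) / (s - t)) \<longlongrightarrow> ?D) (at t)"
    unfolding tendsto_at_iff_sequentially
  proof (intro allI impI)
    fix X :: "nat \<Rightarrow> real" assume X: "\<forall>i. X i \<in> UNIV - {t}" "X \<longlonglongrightarrow> t"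
    \<comment> \<open>Finitely many terms of the sequence may lie outside the interval with the uniform bound; they are replaced.\<close>
    define Y where "Y n = (if \<bar>X n - t\<bar> \<le> \<delta> then X n else t + \<delta>)" for n
    have Y: "Y n \<in> {t - \<delta>..t + \<delta>}" "Y n \<noteq> t" for n using X(1) \<delta> by (auto simp: Y_def)
    have ev: "eventually (\<lambda>n. X n = Y n) sequentially"
      using tendstoD[OF X(2) \<delta>] by eventually_elim (auto simp: Y_def dist_real_def)
    have Yl: "Y \<longlonglongrightarrow> t" by (rule Lim_transform_eventually[OF X(2) ev])
    have YT: "Y n \<in> {0<..<T}" for n using Y(1) sub by blast
    define q where "q n x = indicator \<Omega> x * ((h (u (Y n) x) - h (u t x)) / (Y n - t))" for n x
    have iq: "integrable lborel (\<lambda>x. indicator \<Omega> x * h (u s x))" if "s \<in> {0<..<T}" for s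
      by (rule integrable_indicator_continuous_closure[OF \<Omega> chu[OF that]])
    have qeq: "q n x = (indicator \<Omega> x * h (u (Y n) x) - indicator \<Omega> x * h (u t x)) / (Y n - t)" for n x
      by (simp add: q_def right_diff_distrib)
    have Iq: "(LBINT x. q n x) = (E (Y n) - E t) / (Y n - t)" for n
      unfolding qeq E_def using iq[OF YT[of n]] iq[OF t] by simp
    have "(\<lambda>n. LBINT x. q n x) \<longlonglongrightarrow> ?D"
    proof (rule integral_dominated_bounded_support(1))
      show "q n \<in> borel_measurable borel" for n
        using iq[OF YT[of n]] iq[OF t] unfolding qeq[abs_def] by (intro borel_measurable_divide borel_measurable_diff) auto
      show "(\<lambda>x. indicator \<Omega> x * (h' (u t x) * v t x)) \<in> borel_measurable borel"
        using integrable_indicator_continuous_closure[OF \<Omega> chu'[OF t]] by auto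
      show "\<bar>q n x\<bar> \<le> C" for n x
      proof (cases "x \<in> \<Omega>")
        case True
        then have "\<bar>(h (u (Y n) x) - h (u t x)) / (Y n - t)\<bar> \<le> C"
          using lip[OF Y(1)[of n] True] Y(2)[of n] by (simp add: divide_le_eq)
        then show ?thesis using True by (simp add: q_def)
      qed (use C in \<open>simp add: q_def\<close>)
      show "q n x = 0" if "norm x > R" for n x
        using R[of x] that by (cases "x \<in> \<Omega>") (auto simp: q_def)
      show "AE x in lborel. (\<lambda>n. q n x) \<longlonglongrightarrow> indicator \<Omega> x * (h' (u t x) * v t x)"
      proof (rule AE_I2)
        fix x
        show "(\<lambda>n. q n x) \<longlonglongrightarrow> indicator \<Omega> x * (h' (u t x) * v t x)"
        proof (cases "x \<in> \<Omega>")
          case True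
          have "((\<lambda>s. (h (u s x) - h (u t x)) / (s - t)) \<longlongrightarrow> h' (u t x) * v t x) (at t)"
            using dh[OF t True] by (simp add: has_field_derivative_iff)
          from filterlim_compose[OF this, of Y sequentially]
          have "(\<lambda>n. (h (u (Y n) x) - h (u t x)) / (Y n - t)) \<longlonglongrightarrow> h' (u t x) * v t x"
            using Yl Y(2) by (simp add: filterlim_at)
          then show ?thesis using True by (simp add: q_def)
        qed (simp add: q_def)
      qed
    qed
    then have "(\<lambda>n. (E (Y n) - E t) / (Y n - t)) \<longlonglongrightarrow> ?D" by (simp add: Iq)
    then show "((\<lambda>s. (E s - E t) / (s - t)) \<circ> X) \<longlonglongrightarrow> ?D"
      by (rule Lim_transform_eventually) (use ev in \<open>auto elim!: eventually_mono\<close>)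
  qed
  then have "(E has_real_derivative ?D) (at t)" by (simp add: has_field_derivative_iff)
  then show ?thesis
    by (rule has_field_derivative_transform_within_open[of _ _ _ "{0<..<T}"]) (use t E in auto)
qed

text \<open>Writing \<open>G = (h(w) - \<mu> w) b + \<mu> J\<close> exhibits \<open>G\<close> as \<open>C\<^sup>1\<close> up to the boundary.  In its divergence the terms
  \<open>- w \<nabla>\<mu> \<bullet> b\<close> from the first summand and \<open>w \<nabla>\<mu> \<bullet> b\<close> from \<open>\<nabla>\<mu> \<bullet> J\<close> cancel.\<close>

lemma energy_flux_divergence:
  fixes \<Omega> :: "'a::euclidean_space set" and w :: "'a \<Rightarrow> real"
  assumes \<Omega>: "open \<Omega>"
    and h: "\<And>s. 0 < s \<Longrightarrow> (h has_real_derivative h' s) (at s)"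
    and h': "\<And>s. 0 < s \<Longrightarrow> (h' has_real_derivative h'' s) (at s)"
    and ch'': "continuous_on {0<..} h''"
    and b: "C1_closure \<Omega> b" "\<And>x. x \<in> \<Omega> \<Longrightarrow> divergence b x = 0"
    and pos: "\<And>x. x \<in> closure \<Omega> \<Longrightarrow> 0 < w x"
    and w: "C1_closure \<Omega> w" and J: "C1_closure \<Omega> (flux \<Omega> b M h' w)"
  defines "G \<equiv> \<lambda>x. h (w x) *\<^sub>R b x - (h' (w x) * M (w x)) *\<^sub>R closure_grad \<Omega> (\<lambda>y. h' (w y)) x"
  shows "C1_closure \<Omega> G"
    and "\<And>x. x \<in> \<Omega> \<Longrightarrow> divergence G x
      = h' (w x) * divergence (flux \<Omega> b M h' w) x - M (w x) * (norm (grad (\<lambda>y. h' (w y)) x))\<^sup>2"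
proof -
  let ?J = "flux \<Omega> b M h' w" and ?\<mu> = "\<lambda>x. h' (w x)" and ?p = "\<lambda>x. h (w x) - h' (w x) * w x"
  have G: "G = (\<lambda>x. ?p x *\<^sub>R b x + ?\<mu> x *\<^sub>R ?J x)"
    by (simp add: fun_eq_iff G_def flux_def algebra_simps)
  have dp: "((\<lambda>s. h s - h' s * s) has_real_derivative - (h'' s * s)) (at s)" if "0 < s" for s
    using h[OF that] h'[OF that] by (auto intro!: derivative_eq_intros)
  have cp: "C1_closure \<Omega> ?p"
    by (rule C1_closure_compose_real[OF w, where g = "\<lambda>s. h s - h' s * s" and S = "{0<..}"])
      (use pos dp in \<open>auto intro!: continuous_intros ch''\<close>)
  have c\<mu>: "C1_closure \<Omega> ?\<mu>"
    by (rule C1_closure_compose_real[OF w, where S = "{0<..}"]) (use pos h' ch'' in auto)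
  show "C1_closure \<Omega> G"
    unfolding G by (intro C1_closure_add C1_closure_scaleR cp c\<mu> b J)
  fix x assume x: "x \<in> \<Omega>"
  then have w0: "0 < w x" using pos closure_subset by blast
  have ex: "\<exists>D. (F has_derivative D) (at x)" if "C1_closure \<Omega> F" for F :: "'a \<Rightarrow> 'b::euclidean_space"
    using that by (rule C1_closureE) (use x in blast)
  obtain w' where w': "(w has_derivative w') (at x)" using ex[OF w] by blast
  obtain b' where b': "(b has_derivative b') (at x)" using ex[OF b(1)] by blast
  obtain J' where J': "(?J has_derivative J') (at x)" using ex[OF J] by blast
  have \<mu>': "(?\<mu> has_derivative (\<lambda>k. h'' (w x) * w' k)) (at x)"
    using has_derivative_compose[OF w' h'[OF w0, unfolded has_field_derivative_def]] .
  have p': "(?p has_derivative (\<lambda>k. - (h'' (w x) * w x) * w' k)) (at x)"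
    using has_derivative_compose[OF w' dp[OF w0, unfolded has_field_derivative_def]] .
  define m where "m = (\<Sum>i\<in>Basis. (h'' (w x) * w' i) *\<^sub>R i)"
  have lin: "linear w'" by (rule has_derivative_linear[OF w'])
  have m: "h'' (w x) * w' k = k \<bullet> m" for k
  proof -
    have "w' k = (\<Sum>i\<in>Basis. (k \<bullet> i) * w' i)"
      using linear_sum[OF lin, of "\<lambda>i. (k \<bullet> i) *\<^sub>R i" Basis] by (simp add: linear_scale[OF lin] euclidean_representation)
    then show ?thesis by (simp add: m_def inner_sum_right sum_distrib_left mult_ac)
  qed
  have "GDERIV ?\<mu> x :> m" using \<mu>' by (simp add: gderiv_def m)
  then have gm: "grad ?\<mu> x = m" by (rule grad_eq)
  then have Jx: "?J x = w x *\<^sub>R b x - M (w x) *\<^sub>R m" using x by (simp add: flux_def closure_grad_def)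
  have "divergence G x = divergence (\<lambda>x. ?p x *\<^sub>R b x) x + divergence (\<lambda>x. ?\<mu> x *\<^sub>R ?J x) x"
    unfolding G by (rule divergence_add[OF has_derivative_scaleR[OF p' b'] has_derivative_scaleR[OF \<mu>' J']])
  also have "\<dots> = (- (h'' (w x) * w x) * w' (b x)) + (?\<mu> x * divergence ?J x + h'' (w x) * w' (?J x))"
    unfolding divergence_scaleR[OF p' b'] divergence_scaleR[OF \<mu>' J'] by (simp add: b(2)[OF x])
  also have "- (h'' (w x) * w x) * w' (b x) = - (w x * (b x \<bullet> m))" using m[of "b x"] by (simp add: mult_ac)
  also have "h'' (w x) * w' (?J x) = w x * (b x \<bullet> m) - M (w x) * (m \<bullet> m)"
    unfolding m Jx by (simp add: inner_diff_left)
  finally show "divergence G x = ?\<mu> x * divergence ?J x - M (w x) * (norm (grad ?\<mu> x))\<^sup>2"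
    by (simp add: gm power2_norm_eq_inner)
qed

text \<open>All three spatial integrals are reduced to integrals of \<open>\<mu> v\<close>, \<open>\<mu> div J\<close> and \<open>div G\<close>, where \<open>v\<close> is the time
  derivative of \<open>u\<close>; in the balance, those of \<open>\<mu> div J\<close> and \<open>div G\<close> then cancel.\<close>

lemma energy_balance_at_time:
  fixes \<Omega> :: "'a::euclidean_space set" and u :: "real \<Rightarrow> 'a \<Rightarrow> real"
  assumes dom: "bounded_lipschitz_domain \<Omega>"
    and h: "\<And>s. 0 < s \<Longrightarrow> (h has_real_derivative h' s) (at s)"
    and h': "\<And>s. 0 < s \<Longrightarrow> (h' has_real_derivative h'' s) (at s)"
    and ch'': "continuous_on {0<..} h''"
    and b: "C1_closure \<Omega> b" "\<And>x. x \<in> \<Omega> \<Longrightarrow> divergence b x = 0"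
    and sol: "smooth_positive_solution \<Omega> T b M h' r u"
    and t: "t \<in> {0<..<T}"
    and eq: "AE x in lborel. x \<in> \<Omega> \<longrightarrow> equation_at \<Omega> b M h' r u t x"
  shows "energy_balance_at \<Omega> b M h h' r u t"
proof -
  have \<Omega>: "open \<Omega>" "bounded \<Omega>" using dom by (auto simp: bounded_lipschitz_domain_def)
  have pos: "0 < u s x" if "s \<in> {0<..<T}" "x \<in> closure \<Omega>" for s x
    using sol that unfolding smooth_positive_solution_def by blast
  have cu: "continuous_on ({0<..<T} \<times> closure \<Omega>) (\<lambda>(t, x). u t x)"
    using sol unfolding smooth_positive_solution_def by blast
  obtain v where cv: "continuous_on ({0<..<T} \<times> closure \<Omega>) (\<lambda>(t, x). v t x)"
    and uv: "\<And>t x. t \<in> {0<..<T} \<Longrightarrow> x \<in> \<Omega> \<Longrightarrow> ((\<lambda>s. u s x) has_real_derivative v t x) (at t)"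
    using sol unfolding smooth_positive_solution_def by blast
  have w: "C1_closure \<Omega> (u t)" and J: "C1_closure \<Omega> (flux \<Omega> b M h' (u t))"
    using sol t unfolding smooth_positive_solution_def by blast+
  have ch': "continuous_on {0<..} h'"
    using h' by (intro continuous_at_imp_continuous_on ballI DERIV_isCont) auto
  let ?J = "flux \<Omega> b M h' (u t)" and ?\<mu> = "\<lambda>x. h' (u t x)"
  define G where "G x = h (u t x) *\<^sub>R b x - (h' (u t x) * M (u t x)) *\<^sub>R closure_grad \<Omega> (\<lambda>y. h' (u t y)) x" for x
  note fl = energy_flux_divergence[OF \<Omega>(1) h h' ch'' b pos[OF t] w J]
  have CG: "C1_closure \<Omega> G" unfolding G_def[abs_def] by (rule fl(1))
  have dG: "divergence G x = ?\<mu> x * divergence ?J x - M (u t x) * (norm (grad ?\<mu> x))\<^sup>2" if "x \<in> \<Omega>" for x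
    unfolding G_def[abs_def] by (rule fl(2)) (use that in auto)
  have c\<mu>: "continuous_on (closure \<Omega>) ?\<mu>"
    by (rule continuous_on_compose2[OF ch']) (use w pos[OF t] in \<open>auto simp: C1_closure_def\<close>)
  have cvt: "continuous_on (closure \<Omega>) (v t)"
    using continuous_on_compose2[OF cv continuous_on_Pair[OF continuous_on_const continuous_on_id], of t "closure \<Omega>"] t
    by (simp add: image_subset_iff)
  have i1: "integrable lborel (\<lambda>x. indicator \<Omega> x * divergence G x)" using integrable_mult_divergence[OF \<Omega> continuous_on_const CG, of 1] by simp
  have i2: "integrable lborel (\<lambda>x. indicator \<Omega> x * (?\<mu> x * v t x))"
    by (intro integrable_indicator_continuous_closure \<Omega> continuous_intros c\<mu> cvt)
  have i3: "integrable lborel (\<lambda>x. indicator \<Omega> x * (?\<mu> x * divergence ?J x))"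
    by (rule integrable_mult_divergence[OF \<Omega> c\<mu> J])
  have diss: "set_lebesgue_integral lebesgue \<Omega> (\<lambda>x. M (u t x) * (norm (grad ?\<mu> x))\<^sup>2)
      = (LBINT x. indicator \<Omega> x * (?\<mu> x * divergence ?J x)) - (LBINT x. indicator \<Omega> x * divergence G x)"
  proof -
    have "set_lebesgue_integral lebesgue \<Omega> (\<lambda>x. M (u t x) * (norm (grad ?\<mu> x))\<^sup>2)
      = (LBINT x. indicator \<Omega> x * (?\<mu> x * divergence ?J x) - indicator \<Omega> x * divergence G x)"
      unfolding set_lebesgue_integral_def
      by (rule lebesgue_integral_AE_eq_lborel(2)[OF Bochner_Integration.integrable_diff[OF i3 i1]])
        (auto intro!: AE_I2 simp: indicator_def dG)
    then show ?thesis using i1 i3 by simp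
  qed
  have surf: "boundary_term \<Omega> b M h h' (u t) = - (LBINT x. indicator \<Omega> x * divergence G x)"
  proof -
    have "set_lebesgue_integral lebesgue \<Omega> (divergence G) = (LBINT x. indicator \<Omega> x * divergence G x)"
      unfolding set_lebesgue_integral_def by (rule lebesgue_integral_AE_eq_lborel(2)[OF i1]) simp
    then show ?thesis using divergence_theorem[OF dom CG] by (simp add: boundary_term_def G_def)
  qed
  have source: "set_lebesgue_integral lebesgue \<Omega> (\<lambda>x. ?\<mu> x * r (u t x))
      = (LBINT x. indicator \<Omega> x * (?\<mu> x * v t x)) + (LBINT x. indicator \<Omega> x * (?\<mu> x * divergence ?J x))"
  proof -
    have "set_lebesgue_integral lebesgue \<Omega> (\<lambda>x. ?\<mu> x * r (u t x))
      = (LBINT x. indicator \<Omega> x * (?\<mu> x * v t x) + indicator \<Omega> x * (?\<mu> x * divergence ?J x))"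
      unfolding set_lebesgue_integral_def
    proof (rule lebesgue_integral_AE_eq_lborel(2)[OF Bochner_Integration.integrable_add[OF i2 i3]])
      show "AE x in lborel. indicator \<Omega> x *\<^sub>R (?\<mu> x * r (u t x))
          = indicator \<Omega> x * (?\<mu> x * v t x) + indicator \<Omega> x * (?\<mu> x * divergence ?J x)"
        using eq
      proof eventually_elim
        fix x assume e: "x \<in> \<Omega> \<longrightarrow> equation_at \<Omega> b M h' r u t x"
        show "indicator \<Omega> x *\<^sub>R (?\<mu> x * r (u t x))
          = indicator \<Omega> x * (?\<mu> x * v t x) + indicator \<Omega> x * (?\<mu> x * divergence ?J x)"
        proof (cases "x \<in> \<Omega>")
          case True
          then have "r (u t x) = v t x + divergence ?J x"
            using e DERIV_imp_deriv[OF uv[OF t True]] by (simp add: equation_at_def)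
          then show ?thesis using True by (simp add: distrib_left)
        qed simp
      qed
    qed
    then show ?thesis using i2 i3 by simp
  qed
  have "((\<lambda>s. energy \<Omega> h (u s)) has_real_derivative
      (LBINT x. indicator \<Omega> x * (?\<mu> x * v t x))) (at t)"
    by (rule energy_has_real_derivative[OF \<Omega> t h ch' pos cu cv uv])
  then show ?thesis
    unfolding energy_balance_at_def diss surf source by simp
qed

theorem proposition6p1:
  fixes \<Omega> :: "'a::euclidean_space set" and T :: real
    and h h' h'' M M' r :: "real \<Rightarrow> real"
    and b :: "'a \<Rightarrow> 'a" and u :: "real \<Rightarrow> 'a \<Rightarrow> real"
  assumes "bounded_lipschitz_domain \<Omega>"
    and "\<And>s. 0 < s \<Longrightarrow> (h has_real_derivative h' s) (at s)"
    and "\<And>s. 0 < s \<Longrightarrow> (h' has_real_derivative h'' s) (at s)"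
    and "continuous_on {0<..} h''"
    and "\<And>s. 0 < s \<Longrightarrow> 0 < h'' s"
    and "\<And>s. 0 < s \<Longrightarrow> 0 \<le> M s"
    and "\<And>s. 0 < s \<Longrightarrow> (M has_real_derivative M' s) (at s)"
    and "continuous_on {0<..} M'"
    and "C1_closure \<Omega> b"
    and "\<And>x. x \<in> \<Omega> \<Longrightarrow> divergence b x = 0"
    and "smooth_positive_solution \<Omega> T b M h' r u"
  shows "(AE t in lebesgue. t \<in> {0<..<T} \<longrightarrow> energy_balance_at \<Omega> b M h h' r u t) \<and>
    (\<forall>t\<in>{0<..<T}. (AE x in lebesgue. x \<in> \<Omega> \<longrightarrow> equation_at \<Omega> b M h' r u t x) \<longrightarrow>
       energy_balance_at \<Omega> b M h h' r u t)"
proof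
  have balance: "energy_balance_at \<Omega> b M h h' r u t"
    if "t \<in> {0<..<T}" "AE x in lborel. x \<in> \<Omega> \<longrightarrow> equation_at \<Omega> b M h' r u t x" for t
    by (rule energy_balance_at_time[OF assms(1-4,9-11) that])
  show "\<forall>t\<in>{0<..<T}. (AE x in lebesgue. x \<in> \<Omega> \<longrightarrow> equation_at \<Omega> b M h' r u t x) \<longrightarrow>
       energy_balance_at \<Omega> b M h h' r u t"
    using balance by (simp add: AE_completion_iff)
  have "AE p in lebesgue. p \<in> {0<..<T} \<times> \<Omega> \<longrightarrow> equation_at \<Omega> b M h' r u (fst p) (snd p)"
    using assms(11) unfolding smooth_positive_solution_def by blast
  then have "AE p in lborel. p \<in> {0<..<T} \<times> \<Omega> \<longrightarrow> equation_at \<Omega> b M h' r u (fst p) (snd p)"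
    by (simp only: AE_completion_iff)
  then have "AE t in lborel. AE x in lborel. (t, x) \<in> {0<..<T} \<times> \<Omega> \<longrightarrow> equation_at \<Omega> b M h' r u (fst (t, x)) (snd (t, x))"
    unfolding lborel_prod[symmetric] by (rule lborel_pair.AE_pair)
  then have "AE t in lborel. t \<in> {0<..<T} \<longrightarrow> energy_balance_at \<Omega> b M h h' r u t"
  proof eventually_elim
    fix t
    assume ae: "AE x in lborel. (t, x) \<in> {0<..<T} \<times> \<Omega> \<longrightarrow> equation_at \<Omega> b M h' r u (fst (t, x)) (snd (t, x))"
    show "t \<in> {0<..<T} \<longrightarrow> energy_balance_at \<Omega> b M h h' r u t"
    proof
      assume t: "t \<in> {0<..<T}"
      show "energy_balance_at \<Omega> b M h h' r u t"
        by (rule balance[OF t]) (use ae t in auto)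
    qed
  qed
  then show "AE t in lebesgue. t \<in> {0<..<T} \<longrightarrow> energy_balance_at \<Omega> b M h h' r u t"
    by (rule AE_completion)
qed

end
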